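(* Let $G_\bullet$ be a vertex-stable $\mathrm{FI}$-graph with stable degree at most $d$ whose transition maps are all injective and whose constituent graphs $G_n$ are all connected. Then for any $m \geq 1$ the functor $n \mapsto \mathrm{Conf}_m(G_n)$ from $\mathrm{FI}$ to topological spaces is representation stable, i.e. for every $i\ge 0$ the $\mathrm{FI}$-module over $\mathbb{Z}$ given by $n\mapsto H_i(\mathrm{Conf}_m(G_n);\mathbb{Z})$ is finitely generated. In particular, if $i \geq 0$ is fixed, then the function $$n \mapsto \dim_{\mathbb{R}} H_i(\mathrm{Conf}_m(G_n);\mathbb{R})$$ agrees, for all sufficiently large $n$, with a polynomial of degree at most $2dm$.
   Context: Graphs are finite and simple (no multi-edges, no self-loops), and are also regarded as topological spaces, namely compact 1-dimensional simplicial complexes. A homomorphism of graphs $\phi:G\to G'$ is a map $V(G)\to V(G')$ such that $\{x,y\}\in E(G)$ implies $\{\phi(x),\phi(y)\}\in E(G')$. Let $[n]=\{1,\dots,n\}$, and let $\mathrm{FI}$ be the category with objects $[n]$, $n\ge 0$, and morphisms all injections. An $\mathrm{FI}$-graph $G_\bullet$ is a functor from $\mathrm{FI}$ to the category of graphs and graph homomorphisms; $G_n$ is its value on $[n]$, and the maps $G(f)$ induced by injections $f$ are the transition maps. $G_\bullet$ is vertex-stable with stable degree $\le d$ if for all $n\ge d$ and every $v\in V(G_{n+1})$ there exist $w\in V(G_n)$ and an injection $f:[n]\hookrightarrow[n+1]$ with $G(f)(w)=v$. For a graph $G$, $\mathrm{Conf}_m(G)=\{(x_1,\ldots,x_m)\in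 G^m\mid x_i\ne x_j \text{ for } i\ne j\}$. An injective graph homomorphism induces an injective continuous map of the underlying spaces, hence a map on $\mathrm{Conf}_m$; this makes $n\mapsto\mathrm{Conf}_m(G_n)$ a functor on $\mathrm{FI}$. An $\mathrm{FI}$-module over a ring $R$ is a functor $V$ from $\mathrm{FI}$ to $R$-modules; it is finitely generated if there is a finite set of elements of $\bigsqcup_n V_n$ not contained in any proper submodule. *)

theory Defs
  imports
    "HOL-Analysis.Finite_Function_Topology"
    "HOL-Homology.Homology"
    "HOL-Computational_Algebra.Polynomial"
    "Jordan_Normal_Form.VS_Connect"
begin

subsection \<open>The category FI\<close>

text \<open>Morphisms are extensional, so that each injection
  \<open>[m] \<rightarrow> [n]\<close> is represented by exactly one function.\<close>

definition FI_hom :: "nat \<Rightarrow> nat \<Rightarrow> (nat \<Rightarrow> nat) set" where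
  "FI_hom m n = {f \<in> {1..m} \<rightarrow>\<^sub>E {1..n}. inj_on f {1..m}}"

definition FI_id :: "nat \<Rightarrow> nat \<Rightarrow> nat" where
  "FI_id n = (\<lambda>i\<in>{1..n}. i)"

definition FI_comp :: "nat \<Rightarrow> (nat \<Rightarrow> nat) \<Rightarrow> (nat \<Rightarrow> nat) \<Rightarrow> nat \<Rightarrow> nat" where
  "FI_comp l g f = compose {1..l} g f"


subsection \<open>Graphs\<close>

record 'v graph =
  verts :: "'v set"
  edges :: "'v set set"

definition finite_simple_graph :: "'v graph \<Rightarrow> bool" where
  "finite_simple_graph G \<longleftrightarrow>
     finite (verts G) \<and> (\<forall>e\<in>edges G. e \<subseteq> verts G \<and> card e = 2)"

definition graph_hom :: "'v graph \<Rightarrow> 'w graph \<Rightarrow> ('v \<Rightarrow> 'w) \<Rightarrow> bool" where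
  "graph_hom G G' \<phi> \<longleftrightarrow>
     \<phi> ` verts G \<subseteq> verts G' \<and>
     (\<forall>x\<in>verts G. \<forall>y\<in>verts G. {x, y} \<in> edges G \<longrightarrow> {\<phi> x, \<phi> y} \<in> edges G')"

text \<open>The graph without vertices counts as connected.\<close>

definition connected_graph :: "'v graph \<Rightarrow> bool" where
  "connected_graph G \<longleftrightarrow>
     (\<forall>u\<in>verts G. \<forall>v\<in>verts G. (u, v) \<in> {(x, y). {x, y} \<in> edges G}\<^sup>*)"

text \<open>\<open>F m n f\<close> is the transition map \<open>G m \<rightarrow> G n\<close>
  induced by \<open>f \<in> FI_hom m n\<close>. Its values outside \<open>verts (G m)\<close> are irrelevant.\<close>

locale FI_graph =
  fixes G :: "nat \<Rightarrow> 'v graph"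
    and F :: "nat \<Rightarrow> nat \<Rightarrow> (nat \<Rightarrow> nat) \<Rightarrow> 'v \<Rightarrow> 'v"
  assumes graph: "finite_simple_graph (G n)"
    and hom: "f \<in> FI_hom m n \<Longrightarrow> graph_hom (G m) (G n) (F m n f)"
    and ident: "v \<in> verts (G n) \<Longrightarrow> F n n (FI_id n) v = v"
    and comp: "\<lbrakk>f \<in> FI_hom l m; g \<in> FI_hom m n; v \<in> verts (G l)\<rbrakk> \<Longrightarrow>
                 F l n (FI_comp l g f) v = F m n g (F l m f v)"

definition vertex_stable ::
    "(nat \<Rightarrow> 'v graph) \<Rightarrow> (nat \<Rightarrow> nat \<Rightarrow> (nat \<Rightarrow> nat) \<Rightarrow> 'v \<Rightarrow> 'v) \<Rightarrow> nat \<Rightarrow> bool" where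
  "vertex_stable G F d \<longleftrightarrow>
     (\<forall>n\<ge>d. \<forall>v\<in>verts (G (n + 1)). \<exists>w\<in>verts (G n). \<exists>f\<in>FI_hom n (n + 1).
        F n (n + 1) f w = v)"

definition injective_transitions ::
    "(nat \<Rightarrow> 'v graph) \<Rightarrow> (nat \<Rightarrow> nat \<Rightarrow> (nat \<Rightarrow> nat) \<Rightarrow> 'v \<Rightarrow> 'v) \<Rightarrow> bool" where
  "injective_transitions G F \<longleftrightarrow>
     (\<forall>m n. \<forall>f\<in>FI_hom m n. inj_on (F m n f) (verts (G m)))"


subsection \<open>Geometric realization and configuration spaces\<close>

text \<open>Points are given by their barycentric coordinates. As the complex is finite, its
  topology is the one of coordinatewise convergence.\<close>

definition graph_simplices :: "'v graph \<Rightarrow> 'v set set" where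
  "graph_simplices G = {{v} | v. v \<in> verts G} \<union> edges G"

definition realization :: "'v graph \<Rightarrow> ('v \<Rightarrow> real) topology" where
  "realization G = subtopology (powertop_real UNIV)
     {x. (\<forall>v. 0 \<le> x v) \<and>
         (\<exists>s\<in>graph_simplices G. {v. x v \<noteq> 0} \<subseteq> s \<and> (\<Sum>v\<in>s. x v) = 1)}"

definition realization_map :: "'v graph \<Rightarrow> ('v \<Rightarrow> 'w) \<Rightarrow> ('v \<Rightarrow> real) \<Rightarrow> 'w \<Rightarrow> real" where
  "realization_map G \<phi> x = (\<lambda>w. \<Sum>v | v \<in> verts G \<and> \<phi> v = w. x v)"

definition Conf :: "nat \<Rightarrow> 'a topology \<Rightarrow> (nat \<Rightarrow> 'a) topology" where
  "Conf m X = subtopology (product_topology (\<lambda>_. X) {1..m}) {x. inj_on x {1..m}}"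

definition Conf_map :: "nat \<Rightarrow> ('a \<Rightarrow> 'b) \<Rightarrow> (nat \<Rightarrow> 'a) \<Rightarrow> nat \<Rightarrow> 'b" where
  "Conf_map m h x = (\<lambda>i\<in>{1..m}. h (x i))"


subsection \<open>FI-spaces, FI-modules and representation stability\<close>

locale FI_space =
  fixes X :: "nat \<Rightarrow> 'a topology"
    and F :: "nat \<Rightarrow> nat \<Rightarrow> (nat \<Rightarrow> nat) \<Rightarrow> 'a \<Rightarrow> 'a"
  assumes cont: "f \<in> FI_hom m n \<Longrightarrow> continuous_map (X m) (X n) (F m n f)"
    and ident: "x \<in> topspace (X n) \<Longrightarrow> F n n (FI_id n) x = x"
    and comp: "\<lbrakk>f \<in> FI_hom l m; g \<in> FI_hom m n; x \<in> topspace (X l)\<rbrakk> \<Longrightarrow>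
                 F l n (FI_comp l g f) x = F m n g (F l m f x)"

text \<open>FI-modules over the integers: modules over the integers are abelian groups, which are
  written multiplicatively here to match the library's homology groups.\<close>

locale FI_module =
  fixes V :: "nat \<Rightarrow> 'a monoid"
    and F :: "nat \<Rightarrow> nat \<Rightarrow> (nat \<Rightarrow> nat) \<Rightarrow> 'a \<Rightarrow> 'a"
  assumes group: "comm_group (V n)"
    and hom: "f \<in> FI_hom m n \<Longrightarrow> F m n f \<in> hom (V m) (V n)"
    and ident: "x \<in> carrier (V n) \<Longrightarrow> F n n (FI_id n) x = x"
    and comp: "\<lbrakk>f \<in> FI_hom l m; g \<in> FI_hom m n; x \<in> carrier (V l)\<rbrakk> \<Longrightarrow>
                 F l n (FI_comp l g f) x = F m n g (F l m f x)"

definition FI_submodule ::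
    "(nat \<Rightarrow> 'a set) \<Rightarrow> (nat \<Rightarrow> 'a monoid) \<Rightarrow>
     (nat \<Rightarrow> nat \<Rightarrow> (nat \<Rightarrow> nat) \<Rightarrow> 'a \<Rightarrow> 'a) \<Rightarrow> bool" where
  "FI_submodule W V F \<longleftrightarrow>
     (\<forall>n. subgroup (W n) (V n)) \<and> (\<forall>m n. \<forall>f\<in>FI_hom m n. F m n f ` W m \<subseteq> W n)"

definition finitely_generated_FI_module ::
    "(nat \<Rightarrow> 'a monoid) \<Rightarrow> (nat \<Rightarrow> nat \<Rightarrow> (nat \<Rightarrow> nat) \<Rightarrow> 'a \<Rightarrow> 'a) \<Rightarrow> bool" where
  "finitely_generated_FI_module V F \<longleftrightarrow>
     FI_module V F \<and>
     (\<exists>S. finite S \<and> S \<subseteq> (SIGMA n:UNIV. carrier (V n)) \<and>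
        (\<forall>W. FI_submodule W V F \<and> (\<forall>(n, x)\<in>S. x \<in> W n) \<longrightarrow>
             (\<forall>n. W n = carrier (V n))))"

definition representation_stable ::
    "(nat \<Rightarrow> 'a topology) \<Rightarrow> (nat \<Rightarrow> nat \<Rightarrow> (nat \<Rightarrow> nat) \<Rightarrow> 'a \<Rightarrow> 'a) \<Rightarrow> bool" where
  "representation_stable X F \<longleftrightarrow>
     FI_space X F \<and>
     (\<forall>i::nat. finitely_generated_FI_module
        (\<lambda>n. homology_group (int i) (X n))
        (\<lambda>m n f. hom_induced (int i) (X m) {} (X n) {} (F m n f)))"


subsection \<open>Singular homology with real coefficients\<close>

text \<open>The library's singular chains have integer coefficients. The definitions below repeat
  its construction, over the same singular simplices and faces, with real coefficients.\<close>

type_synonym 'a real_chain = "((nat \<Rightarrow> real) \<Rightarrow> 'a) \<Rightarrow>\<^sub>0 real"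

definition real_chains :: "nat \<Rightarrow> 'a topology \<Rightarrow> 'a real_chain set" where
  "real_chains p X = {c. Poly_Mapping.keys c \<subseteq> singular_simplex_set p X}"

definition real_boundary :: "nat \<Rightarrow> 'a real_chain \<Rightarrow> 'a real_chain" where
  "real_boundary p c =
     (if p = 0 then 0
      else \<Sum>f\<in>Poly_Mapping.keys c. \<Sum>k\<le>p.
             Poly_Mapping.single (singular_face p k f) ((-1) ^ k * Poly_Mapping.lookup c f))"

definition real_cycles :: "nat \<Rightarrow> 'a topology \<Rightarrow> 'a real_chain set" where
  "real_cycles p X = {c \<in> real_chains p X. real_boundary p c = 0}"

definition real_boundaries :: "nat \<Rightarrow> 'a topology \<Rightarrow> 'a real_chain set" where
  "real_boundaries p X = real_boundary (Suc p) ` real_chains (Suc p) X"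

text \<open>The vector space of cosets of boundaries in cycles. The fields \<open>mult\<close> and
  \<open>one\<close> of the record play no role in a module. Scalar multiplication adds the
  boundaries back in so that multiplication by 0 yields a full coset.\<close>

definition real_homology :: "nat \<Rightarrow> 'a topology \<Rightarrow> (real, 'a real_chain set) module" where
  "real_homology p X =
     \<lparr>carrier = (\<lambda>z. {z + b | b. b \<in> real_boundaries p X}) ` real_cycles p X,
      monoid.mult = undefined, one = undefined,
      ring.zero = real_boundaries p X,
      ring.add = (\<lambda>A B. {a + b | a b. a \<in> A \<and> b \<in> B}),
      module.smult = (\<lambda>r A. {r *\<^sub>R a + b | a b. a \<in> A \<and> b \<in> real_boundaries p X})\<rparr>"

end

theory Submission
  imports Defs "HOL-Library.List_Lexorder"
begin

text \<open>Each particle of a configuration is subject to one of two open conditions: to lie in the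
  interior of an edge, or to be the strictly closest particle to some vertex, within half an edge of
  it. Conditions for further particles are imposed one at a time, and Mayer--Vietoris reduces the
  homology of the configuration space to that of the subspaces on which every particle satisfies
  one of the conditions, or both. Such a subspace is a disjoint union of \<open>O(n ^ (2 * d * m))\<close> open
  pieces, indexed by combinatorial types, and each piece contracts linearly to a configuration whose
  points come from \<open>G k\<close> for a bounded \<open>k\<close>; hence only its homology in degree 0 matters, and this
  is finitely generated as an FI-module.

  FI-modules over the integers are Noetherian: over the order-preserving injections, free modules
  have bases of words, and Dickson's lemma for the gaps of a word yields finite Groebner bases. So
  finite generation and the growth bound pass through the exact sequences. The standard words
  also show that the rank is eventually a polynomial, whose degree the growth bound controls.
  Real homology has the dimension given by the rank of integral homology.\<close>

subsection \<open>Dickson's lemma\<close>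

text \<open>Where the exponent comes from: vertex stability bounds the number of vertices of
  \<open>G n\<close> by a constant times n^d, and a particle is described, up to contraction and
  finitely many choices, by at most two vertices. So m particles contribute n^(2dm). Counting
  standard words yields a polynomial whose degree depends on the generators that happen to be found;
  hence \<open>FI_growth\<close> carries the rank bound alongside finite generation through every
  exact sequence. Noetherianity enters there because the middle term is controlled by its image in
  the third term, which is only a submodule. The obstacle to contracting is collision: a particle
  may be pulled onto a vertex only if nothing is in its way. Strict closeness secures this, since at
  most one particle is strictly closest to a given vertex, and the comparison survives the linear
  motion. For real coefficients, the coordinates of a real number in a basis over the rationals are
  additive functions. They turn real cycles and real relations into rational ones and commute with
  the boundary, whose coefficients are signs.\<close>

lemma Dickson:
  fixes A :: "nat list set"
  assumes "\<And>a. a \<in> A \<Longrightarrow> length a = k"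
  shows "\<exists>B. finite B \<and> B \<subseteq> A \<and> (\<forall>a\<in>A. \<exists>b\<in>B. list_all2 (\<le>) b a)"
  using assms
proof (induction k arbitrary: A)
  case 0
  then have "A \<subseteq> {[]}" by auto
  then show ?case
    by (intro exI[of _ A]) (auto intro: finite_subset[of A "{[]}"])
next
  case (Suc k)
  have "\<exists>B. finite B \<and> B \<subseteq> {a\<in>A. P (hd a)} \<and> (\<forall>a\<in>{a\<in>A. P (hd a)}. \<exists>b\<in>B. list_all2 (\<le>) (tl b) (tl a))" for P
  proof -
    let ?A = "{a\<in>A. P (hd a)}"
    have len: "length a = k" if "a \<in> tl ` ?A" for a using Suc.prems that by auto
    have "\<exists>B. finite B \<and> B \<subseteq> tl ` ?A \<and> (\<forall>a\<in>tl ` ?A. \<exists>b\<in>B. list_all2 (\<le>) b a)"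
      by (rule Suc.IH) (rule len)
    then obtain B' where B': "finite B'" "B' \<subseteq> tl ` ?A"
      "\<forall>a\<in>tl ` ?A. \<exists>b\<in>B'. list_all2 (\<le>) b a" by (elim exE conjE)
    then obtain B where "B \<subseteq> ?A" "finite B" "B' = tl ` B"
      using finite_subset_image[OF B'(1,2)] by blast
    then have "\<forall>a\<in>?A. \<exists>b\<in>B. list_all2 (\<le>) (tl b) (tl a)" using B'(3) by simp
    then show ?thesis using \<open>B \<subseteq> ?A\<close> \<open>finite B\<close> by blast
  qed note slice = this
  obtain B0 where B0: "finite B0" "B0 \<subseteq> A" "\<And>a. a \<in> A \<Longrightarrow> \<exists>b\<in>B0. list_all2 (\<le>) (tl b) (tl a)"
    using slice[of "\<lambda>_. True"] by auto
  \<comment> \<open>A list whose head exceeds \<open>N\<close> lies above some element of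
    \<open>B0\<close> as soon as the tails compare. Only finitely many heads up to \<open>N\<close>
    remain, and each of them forms a slice with constant head.\<close>
  define N where "N = Max (insert 0 (hd ` B0))"
  have N: "hd b \<le> N" if "b \<in> B0" for b unfolding N_def using that B0(1) by auto
  obtain C where C: "\<And>h. finite (C h)" "\<And>h. C h \<subseteq> {a\<in>A. hd a = h}"
    "\<And>h a. a \<in> A \<Longrightarrow> hd a = h \<Longrightarrow> \<exists>b\<in>C h. list_all2 (\<le>) (tl b) (tl a)"
    using slice[of "\<lambda>x. x = h" for h] by simp metis
  have cons: "list_all2 (\<le>) b a" if "a \<in> A" "b \<in> A" "hd b \<le> hd a" "list_all2 (\<le>) (tl b) (tl a)" for a b
    using that Suc.prems[of a] Suc.prems[of b] by (cases a; cases b) auto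
  let ?B = "B0 \<union> (\<Union>h\<in>{..N}. C h)"
  have "\<exists>b\<in>?B. list_all2 (\<le>) b a" if a: "a \<in> A" for a
  proof (cases "hd a \<le> N")
    case True
    obtain b where "b \<in> C (hd a)" "list_all2 (\<le>) (tl b) (tl a)" using C(3)[OF a refl] by blast
    then show ?thesis using True C(2)[of "hd a"] cons[OF a, of b] by (intro bexI[of _ b]) auto
  next
    case False
    obtain b where b: "b \<in> B0" "list_all2 (\<le>) (tl b) (tl a)" using B0(3)[OF a] by blast
    then show ?thesis using False N[of b] B0(2) cons[OF a, of b] by (intro bexI[of _ b]) auto
  qed
  moreover have "?B \<subseteq> A" using B0 C(2) by auto
  moreover have "finite ?B" using B0 C by auto
  ultimately show ?case by blast
  qed

subsection \<open>Counting lattice points\<close>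

definition evpoly :: "(nat \<Rightarrow> real) \<Rightarrow> bool" where
  "evpoly f \<longleftrightarrow> (\<exists>P. \<forall>\<^sub>F n in sequentially. f n = poly P (real n))"

lemma evpoly_const [intro]: "evpoly (\<lambda>_. c)"
  unfolding evpoly_def by (intro exI[of _ "[:c:]"]) simp

lemma evpoly_add: "evpoly f \<Longrightarrow> evpoly g \<Longrightarrow> evpoly (\<lambda>n. f n + g n)"
  unfolding evpoly_def
proof (elim exE)
  fix P Q assume "\<forall>\<^sub>F n in sequentially. f n = poly P (real n)" "\<forall>\<^sub>F n in sequentially. g n = poly Q (real n)"
  then have "\<forall>\<^sub>F n in sequentially. f n + g n = poly (P + Q) (real n)"
    by eventually_elim simp
  then show "\<exists>P. \<forall>\<^sub>F n in sequentially. f n + g n = poly P (real n)" by blast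
qed

lemma evpoly_cmult: "evpoly f \<Longrightarrow> evpoly (\<lambda>n. c * f n)"
  unfolding evpoly_def
proof (elim exE)
  fix P assume "\<forall>\<^sub>F n in sequentially. f n = poly P (real n)"
  then have "\<forall>\<^sub>F n in sequentially. c * f n = poly (Polynomial.smult c P) (real n)"
    by eventually_elim simp
  then show "\<exists>P. \<forall>\<^sub>F n in sequentially. c * f n = poly P (real n)" by blast
qed

lemma evpoly_diff: "evpoly f \<Longrightarrow> evpoly g \<Longrightarrow> evpoly (\<lambda>n. f n - g n)"
  using evpoly_add[of f "\<lambda>n. -1 * g n"] evpoly_cmult[of g "-1"] by simp

lemma evpoly_sum: "finite I \<Longrightarrow> (\<And>i. i \<in> I \<Longrightarrow> evpoly (f i)) \<Longrightarrow> evpoly (\<lambda>n. \<Sum>i\<in>I. f i n)"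
  by (induction I rule: finite_induct) (auto intro: evpoly_add)

lemma evpoly_cong: "(\<forall>\<^sub>F n in sequentially. f n = g n) \<Longrightarrow> evpoly g \<Longrightarrow> evpoly f"
  unfolding evpoly_def
proof (elim exE)
  fix P assume "\<forall>\<^sub>F n in sequentially. f n = g n" "\<forall>\<^sub>F n in sequentially. g n = poly P (real n)"
  then have "\<forall>\<^sub>F n in sequentially. f n = poly P (real n)"
    by eventually_elim simp
  then show "\<exists>P. \<forall>\<^sub>F n in sequentially. f n = poly P (real n)" by blast
qed

lemma evpoly_shift: "evpoly f \<Longrightarrow> evpoly (\<lambda>n. f (n - k))"
  unfolding evpoly_def
proof (elim exE)
  fix P assume "\<forall>\<^sub>F n in sequentially. f n = poly P (real n)"
  then obtain N where N: "\<And>n. n \<ge> N \<Longrightarrow> f n = poly P (real n)" unfolding eventually_sequentially by blast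
  have "f (n - k) = poly (pcompose P [:- real k, 1:]) (real n)" if "n \<ge> N + k" for n
    using that N[of "n - k"] by (simp add: poly_pcompose of_nat_diff)
  then show "\<exists>P. \<forall>\<^sub>F n in sequentially. f (n - k) = poly P (real n)"
    unfolding eventually_sequentially by blast
qed

lemma evpoly_binomial: "evpoly (\<lambda>n. real ((n + r) choose r))"
proof -
  have "real ((n + r) choose r) = poly (Polynomial.smult (1 / fact r) (\<Prod>i<r. [:real r - real i, 1:])) (real n)" for n
    by (simp add: binomial_gbinomial gbinomial_prod_rev poly_prod algebra_simps atLeast0LessThan)
  then show ?thesis unfolding evpoly_def by (intro exI always_eventually allI)
qed

section \<open>Hilbert functions of monomial ideals\<close>

lemma finite_length_sum_list: "finite {v::nat list. length v = r \<and> sum_list v = N}"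
proof (rule finite_subset)
  show "{v::nat list. length v = r \<and> sum_list v = N} \<subseteq> {v. set v \<subseteq> {..N} \<and> length v = r}"
    using member_le_sum_list by force
  show "finite {v::nat list. set v \<subseteq> {..N} \<and> length v = r}" by (rule finite_lists_length_eq) simp
qed

text \<open>With lists read as exponent vectors, this is the set of monomials of degree
  \<open>N\<close> in the monomial ideal generated by \<open>B\<close> in \<open>r\<close>
  variables.\<close>

definition upset :: "nat \<Rightarrow> nat list set \<Rightarrow> nat \<Rightarrow> nat list set" where
  "upset r B N = {v. length v = r \<and> sum_list v = N \<and> (\<exists>b\<in>B. list_all2 (\<le>) b v)}"

lemma finite_upset: "finite (upset r B N)"
  unfolding upset_def by (rule finite_subset[OF _ finite_length_sum_list[of r N]]) auto

lemma list_all2_le_map2_add: "length b = length v \<Longrightarrow> list_all2 (\<le>) (b::nat list) (map2 (+) b v)"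
  by (induction b v rule: list_induct2) auto

lemma sum_list_map2_add: "length b = length v \<Longrightarrow> sum_list (map2 (+) b v) = sum_list b + sum_list (v::nat list)"
  by (induction b v rule: list_induct2) auto

lemma map2_add_diff: "list_all2 (\<le>) (b::nat list) v \<Longrightarrow> map2 (+) b (map2 (-) v b) = v"
  by (induction rule: list_all2_induct) auto

lemma map2_diff_add: "length b = length v \<Longrightarrow> map2 (-) (map2 (+) b v) b = (v::nat list)"
  by (induction b v rule: list_induct2) auto

text \<open>Subtracting \<open>b\<close> leaves an arbitrary vector of sum
  \<open>N - sum_list b\<close>, so stars and bars applies. Below \<open>sum_list b\<close> the
  truncated subtraction makes the formula wrong, so the equality is an eventual one.\<close>

lemma evpoly_upset_single:
  assumes "length b = Suc r"
  shows "evpoly (\<lambda>N. real (card (upset (Suc r) {b} N)))"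
proof (rule evpoly_cong)
  show "evpoly (\<lambda>N. real ((N - sum_list b + r) choose r))"
    by (rule evpoly_shift[OF evpoly_binomial])
  have "real (card (upset (Suc r) {b} N)) = real ((N - sum_list b + r) choose r)" if N: "N \<ge> sum_list b" for N
  proof -
    have "bij_betw (map2 (+) b) {v. length v = Suc r \<and> sum_list v = N - sum_list b} (upset (Suc r) {b} N)"
    proof (rule bij_betw_byWitness[of _ "\<lambda>v. map2 (-) v b"])
      show "\<forall>v\<in>{v. length v = Suc r \<and> sum_list v = N - sum_list b}. map2 (-) (map2 (+) b v) b = v"
        using assms by (auto simp: map2_diff_add)
      show "\<forall>v\<in>upset (Suc r) {b} N. map2 (+) b (map2 (-) v b) = v"
        by (auto simp: upset_def map2_add_diff)
      show "map2 (+) b ` {v. length v = Suc r \<and> sum_list v = N - sum_list b} \<subseteq> upset (Suc r) {b} N"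
        using assms N by (auto simp: upset_def sum_list_map2_add intro!: list_all2_le_map2_add)
      have "sum_list (map2 (-) v b) = sum_list v - sum_list b" if "list_all2 (\<le>) b v" for v
        using sum_list_map2_add[of b "map2 (-) v b"] map2_add_diff[OF that] that
        by (auto dest: list_all2_lengthD)
      then show "(\<lambda>v. map2 (-) v b) ` upset (Suc r) {b} N \<subseteq> {v. length v = Suc r \<and> sum_list v = N - sum_list b}"
        using assms by (auto simp: upset_def)
    qed
    then have "card (upset (Suc r) {b} N) = card {v. length v = Suc r \<and> sum_list v = N - sum_list b}"
      by (rule bij_betw_same_card[symmetric])
    also have "\<dots> = (N - sum_list b + r) choose (N - sum_list b)"
      using card_length_sum_list[of "Suc r" "N - sum_list b"] by simp
    also have "\<dots> = (N - sum_list b + r) choose r"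
      using binomial_symmetric[of "N - sum_list b" "N - sum_list b + r"] by simp
    finally show ?thesis by simp
  qed
  then show "\<forall>\<^sub>F N in sequentially. real (card (upset (Suc r) {b} N)) = real ((N - sum_list b + r) choose r)"
    unfolding eventually_sequentially by blast
qed

lemma list_all2_max:
  assumes "length (b::nat list) = r" "length b' = r" "length v = r"
  shows "list_all2 (\<le>) (map2 max b b') v \<longleftrightarrow> list_all2 (\<le>) b v \<and> list_all2 (\<le>) b' v"
  unfolding list_all2_conv_all_nth using assms by simp blast

text \<open>Inclusion-exclusion: the up-sets of \<open>b\<close> and of \<open>B'\<close> meet in
  the up-set of the entrywise maxima of \<open>b\<close> with the elements of \<open>B'\<close>.
  There are at most \<open>card B'\<close> maxima, but they need not lie in \<open>B\<close>, hence
  the induction on cardinality.\<close>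

lemma evpoly_upset:
  assumes "finite B" "\<And>b. b \<in> B \<Longrightarrow> length b = Suc r"
  shows "evpoly (\<lambda>N. real (card (upset (Suc r) B N)))"
  using assms
proof (induction "card B" arbitrary: B rule: less_induct)
  case less
  show ?case
  proof (cases "B = {}")
    case True
    then show ?thesis by (simp add: upset_def evpoly_const)
  next
    case False
    then obtain b B' where B: "B = insert b B'" "b \<notin> B'" by (meson mk_disjoint_insert ex_in_conv)
    let ?M = "map2 max b ` B'"
    have card: "card B' < card B" "card ?M < card B"
      using B less.prems(1) card_image_le[of B' "map2 max b"] by auto
    have 1: "evpoly (\<lambda>N. real (card (upset (Suc r) B' N)))"
      using less.hyps[OF card(1)] less.prems B by auto
    have 2: "evpoly (\<lambda>N. real (card (upset (Suc r) ?M N)))"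
      by (rule less.hyps[OF card(2)]) (use less.prems B in auto)
    have "upset (Suc r) B N = upset (Suc r) B' N \<union> upset (Suc r) {b} N" for N
      by (auto simp: upset_def B)
    moreover have "upset (Suc r) B' N \<inter> upset (Suc r) {b} N = upset (Suc r) ?M N" for N
      using less.prems(2) B by (fastforce simp: upset_def list_all2_max)
    ultimately have "real (card (upset (Suc r) B N)) =
        real (card (upset (Suc r) B' N)) + real (card (upset (Suc r) {b} N)) - real (card (upset (Suc r) ?M N))" for N
      using card_Un_Int[OF finite_upset finite_upset, of "Suc r" B' N "Suc r" "{b}" N] by simp
    moreover have "evpoly (\<lambda>N. real (card (upset (Suc r) {b} N)))"
      by (rule evpoly_upset_single) (use less.prems B in auto)
    ultimately show ?thesis using evpoly_diff[OF evpoly_add[OF 1] 2] by presburger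
  qed
qed

subsection \<open>Order-preserving injections and gaps\<close>

definition OI :: "nat \<Rightarrow> nat \<Rightarrow> (nat \<Rightarrow> nat) set" where
  "OI n n' = {g \<in> {1..n} \<rightarrow>\<^sub>E {1..n'}. strict_mono_on {1..n} g}"

text \<open>Seeing \<open>xs\<close> as marked positions in the interval from \<open>p + 1\<close>
  to \<open>n\<close>, the entries count the unmarked positions before, between and after the marks.
  Entrywise comparison of gaps governs when an increasing map carries one word to another.\<close>

fun gaps :: "nat \<Rightarrow> nat list \<Rightarrow> nat \<Rightarrow> nat list" where
  "gaps p [] n = [n - p]"
| "gaps p (x # xs) n = (x - p - 1) # gaps x xs n"

text \<open>The last gap is dropped, since it only says how far \<open>n\<close> lies beyond the
  last entry.\<close>

fun ungaps :: "nat \<Rightarrow> nat list \<Rightarrow> nat list" where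
  "ungaps p (v # w # vs) = (p + v + 1) # ungaps (p + v + 1) (w # vs)"
| "ungaps p vs = []"

definition inc_lists :: "nat \<Rightarrow> nat \<Rightarrow> nat \<Rightarrow> nat list set" where
  "inc_lists k p n = {xs. length xs = k \<and> sorted_wrt (<) xs \<and> set xs \<subseteq> {p<..n}}"

lemma length_gaps [simp]: "length (gaps p xs n) = Suc (length xs)"
  by (induction xs arbitrary: p) auto

lemma inc_lists_Cons:
  "x # xs \<in> inc_lists (Suc k) p n \<longleftrightarrow> p < x \<and> x \<le> n \<and> xs \<in> inc_lists k x n"
  by (auto simp: inc_lists_def)

lemma inc_lists_0: "xs \<in> inc_lists 0 p n \<longleftrightarrow> xs = []"
  by (auto simp: inc_lists_def)

lemma inc_lists_Suc:
  "xs \<in> inc_lists (Suc k) p n \<longleftrightarrow> (\<exists>x ys. xs = x # ys \<and> p < x \<and> x \<le> n \<and> ys \<in> inc_lists k x n)"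
  by (cases xs) (simp_all add: inc_lists_Cons, simp add: inc_lists_def)

lemma finite_inc_lists [simp]: "finite (inc_lists k p n)"
  by (rule finite_subset[OF _ finite_lists_length_eq[of "{p<..n}" k]]) (auto simp: inc_lists_def)

lemma sum_gaps:
  "xs \<in> inc_lists k p n \<Longrightarrow> p \<le> n \<Longrightarrow> sum_list (gaps p xs n) + k + p = n"
proof (induction k arbitrary: xs p)
  case 0
  then show ?case by (simp add: inc_lists_0)
next
  case (Suc k)
  then obtain x ys where "xs = x # ys" "p < x" "x \<le> n" "ys \<in> inc_lists k x n" by (auto simp: inc_lists_Suc)
  with Suc.IH[of ys x] show ?case by simp
qed

lemma ungaps_gaps: "xs \<in> inc_lists k p n \<Longrightarrow> ungaps p (gaps p xs n) = xs"
proof (induction k arbitrary: xs p)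
  case 0
  then show ?case by (simp add: inc_lists_0)
next
  case (Suc k)
  then obtain x ys where x: "xs = x # ys" "p < x" "x \<le> n" "ys \<in> inc_lists k x n" by (auto simp: inc_lists_Suc)
  obtain w vs where "gaps x ys n = w # vs" by (cases "gaps x ys n") (use length_gaps[of x ys n] in auto)
  with Suc.IH[of ys x] x show ?case by simp
qed

lemma gaps_ungaps:
  "length v = Suc k \<Longrightarrow> sum_list v + k + p = n \<Longrightarrow>
     ungaps p v \<in> inc_lists k p n \<and> gaps p (ungaps p v) n = v"
proof (induction k arbitrary: v p)
  case 0
  then obtain a where "v = [a]" by (cases v) auto
  with 0 show ?case by (auto simp: inc_lists_0)
next
  case (Suc k)
  then obtain a w vs where v: "v = a # w # vs" by (cases v; cases "tl v") auto
  then have "length (w # vs) = Suc k" "sum_list (w # vs) + k + (p + a + 1) = n" using Suc.prems by auto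
  from Suc.IH[OF this] show ?case using v Suc.prems by (auto simp: inc_lists_Cons)
qed

lemma bij_betw_gaps:
  "k \<le> n \<Longrightarrow> bij_betw (\<lambda>xs. gaps 0 xs n) (inc_lists k 0 n) {v. length v = Suc k \<and> sum_list v = n - k}"
proof (rule bij_betw_byWitness[of _ "ungaps 0"])
  assume k: "k \<le> n"
  show "\<forall>xs\<in>inc_lists k 0 n. ungaps 0 (gaps 0 xs n) = xs" by (auto simp: ungaps_gaps)
  show "\<forall>v\<in>{v. length v = Suc k \<and> sum_list v = n - k}. gaps 0 (ungaps 0 v) n = v"
    using gaps_ungaps[of _ k 0 n] k by auto
  show "ungaps 0 ` {v. length v = Suc k \<and> sum_list v = n - k} \<subseteq> inc_lists k 0 n"
    using gaps_ungaps[of _ k 0 n] k by auto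
  show "(\<lambda>xs. gaps 0 xs n) ` inc_lists k 0 n \<subseteq> {v. length v = Suc k \<and> sum_list v = n - k}"
  proof
    fix v assume "v \<in> (\<lambda>xs. gaps 0 xs n) ` inc_lists k 0 n"
    then obtain xs where xs: "v = gaps 0 xs n" "xs \<in> inc_lists k 0 n" by auto
    then show "v \<in> {v. length v = Suc k \<and> sum_list v = n - k}"
      using sum_gaps[of xs k 0 n] by (simp add: inc_lists_def)
  qed
qed

text \<open>Each gap of \<open>ys\<close> has room for the positions in the corresponding gap of
  \<open>xs\<close>, so the map can be assembled block by block.\<close>

lemma gaps_le_imp:
  "xs \<in> inc_lists k p n \<Longrightarrow> ys \<in> inc_lists k q n' \<Longrightarrow> list_all2 (\<le>) (gaps p xs n) (gaps q ys n') \<Longrightarrow>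
   \<exists>g. strict_mono_on {p<..n} g \<and> g ` {p<..n} \<subseteq> {q<..n'} \<and> map g xs = ys"
proof (induction k arbitrary: xs ys p q)
  case 0
  then show ?case
    by (intro exI[of _ "\<lambda>z. z - p + q"]) (auto simp: inc_lists_0 strict_mono_on_def)
next
  case (Suc k)
  obtain x xs' where x: "xs = x # xs'" "p < x" "x \<le> n" "xs' \<in> inc_lists k x n"
    using Suc.prems(1) by (auto simp: inc_lists_Suc)
  obtain y ys' where y: "ys = y # ys'" "q < y" "y \<le> n'" "ys' \<in> inc_lists k y n'"
    using Suc.prems(2) by (auto simp: inc_lists_Suc)
  have le: "x - p - 1 \<le> y - q - 1" "list_all2 (\<le>) (gaps x xs' n) (gaps y ys' n')"
    using Suc.prems(3) x y by auto
  obtain g where g: "strict_mono_on {x<..n} g" "g ` {x<..n} \<subseteq> {y<..n'}" "map g xs' = ys'"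
    using Suc.IH[OF x(4) y(4) le(2)] by blast
  \<comment> \<open>The first block is placed flush right, ending with \<open>x\<close> sent to
    \<open>y\<close>. Comparing the first gaps shows that it stays above \<open>q\<close>.\<close>
  define h where "h z = (if z \<le> x then y - (x - z) else g z)" for z
  have gy: "y < g z" "g z \<le> n'" if "x < z" "z \<le> n" for z
    using subsetD[OF g(2), of "g z"] that by auto
  have "strict_mono_on {p<..n} h"
  proof (rule strict_mono_onI)
    fix r s assume rs: "r \<in> {p<..n}" "s \<in> {p<..n}" "r < s"
    show "h r < h s"
    proof (cases "s \<le> x")
      case True
      then show ?thesis using rs le(1) x(2) y(2) by (simp add: h_def)
    next
      case False
      show ?thesis
      proof (cases "r \<le> x")
        case True
        then show ?thesis using False gy[of s] rs by (simp add: h_def)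
      next
        case r: False
        then show ?thesis using False rs strict_mono_onD[OF g(1), of r s] by (simp add: h_def)
      qed
    qed
  qed
  moreover have "h ` {p<..n} \<subseteq> {q<..n'}"
  proof
    fix z' assume "z' \<in> h ` {p<..n}"
    then obtain z where z: "z' = h z" "p < z" "z \<le> n" by auto
    show "z' \<in> {q<..n'}"
      using z gy[of z] le(1) x(2) y(2,3) by (auto simp: h_def)
  qed
  moreover have "map h xs = ys"
  proof -
    have "map h xs' = map g xs'"
      using x(4) by (intro map_cong) (auto simp: h_def inc_lists_def)
    then show ?thesis using x y g(3) by (simp add: h_def)
  qed
  ultimately show ?case by blast
qed

lemma gaps_le_imp_OI:
  assumes "xs \<in> inc_lists k 0 n" "ys \<in> inc_lists k 0 n'" "list_all2 (\<le>) (gaps 0 xs n) (gaps 0 ys n')"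
  obtains g where "g \<in> OI n n'" "map g xs = ys"
proof -
  obtain g where g: "strict_mono_on {0<..n} g" "g ` {0<..n} \<subseteq> {0<..n'}" "map g xs = ys"
    using gaps_le_imp[OF assms] by blast
  have *: "{0<..n} = {1..n}" for n :: nat by auto
  show thesis
  proof (rule that[of "restrict g {1..n}"])
    show "restrict g {1..n} \<in> OI n n'"
      using g(1,2) by (auto simp: OI_def * strict_mono_on_def)
    show "map (restrict g {1..n}) xs = ys"
      unfolding g(3)[symmetric] using assms(1) by (intro map_cong) (auto simp: inc_lists_def)
  qed
qed

lemma map_less_map:
  "strict_mono_on A g \<Longrightarrow> set xs \<subseteq> A \<Longrightarrow> set ys \<subseteq> A \<Longrightarrow> length xs = length ys \<Longrightarrow> xs < ys \<Longrightarrow>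
   map g xs < map g (ys :: nat list)" for g :: "nat \<Rightarrow> nat"
proof (induction xs arbitrary: ys)
  case Nil
  then show ?case by simp
next
  case (Cons x xs)
  then obtain y ys' where y: "ys = y # ys'" by (cases ys) auto
  then have "x < y \<or> x = y \<and> xs < ys'" using Cons.prems(5) by simp
  then show ?case
  proof
    assume "x < y"
    then have "g x < g y" using Cons.prems y by (intro strict_mono_onD[OF Cons.prems(1)]) auto
    then show ?thesis using y by simp
  next
    assume "x = y \<and> xs < ys'"
    then show ?thesis using Cons.IH[of ys'] Cons.prems y by simp
  qed
qed

subsection \<open>Submodules of free OI-modules\<close>

text \<open>The list \<open>s # xs\<close> stands for the basis element of degree \<open>n\<close> obtained from the generator
  with index \<open>s\<close>, of degree \<open>\<kappa> s\<close>, by the increasing map with values \<open>xs\<close>. Such lists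
  are ordered lexicographically.\<close>

definition OI_mons :: "nat \<Rightarrow> (nat \<Rightarrow> nat) \<Rightarrow> nat \<Rightarrow> nat list set" where
  "OI_mons S \<kappa> n = {s # xs | s xs. s < S \<and> xs \<in> inc_lists (\<kappa> s) 0 n}"

definition OI_act :: "(nat \<Rightarrow> nat) \<Rightarrow> nat list \<Rightarrow> nat list" where
  "OI_act g m = hd m # map g (tl m)"

definition OI_push :: "nat \<Rightarrow> (nat \<Rightarrow> nat) \<Rightarrow> nat \<Rightarrow> (nat \<Rightarrow> nat) \<Rightarrow> (nat list \<Rightarrow> int) \<Rightarrow> nat list \<Rightarrow> int" where
  "OI_push S \<kappa> n g c m' = (\<Sum>m\<in>OI_mons S \<kappa> n. if OI_act g m = m' then c m else 0)"

text \<open>Closure is asked for increasing maps only. These preserve the lexicographic order of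
  words and therefore send leading words to leading words, which permutations would not do.\<close>

locale OI_submodule =
  fixes S :: nat and \<kappa> :: "nat \<Rightarrow> nat" and U :: "nat \<Rightarrow> (nat list \<Rightarrow> int) set"
  assumes supp: "c \<in> U n \<Longrightarrow> c m \<noteq> 0 \<Longrightarrow> m \<in> OI_mons S \<kappa> n"
    and zero: "(\<lambda>_. 0) \<in> U n"
    and diff: "c \<in> U n \<Longrightarrow> d \<in> U n \<Longrightarrow> (\<lambda>m. c m - d m) \<in> U n"
    and push: "c \<in> U n \<Longrightarrow> g \<in> OI n n' \<Longrightarrow> OI_push S \<kappa> n g c \<in> U n'"
begin

abbreviation mons where "mons \<equiv> OI_mons S \<kappa>"
abbreviation push where "push \<equiv> OI_push S \<kappa>"
abbreviation act where "act \<equiv> OI_act"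

lemmas mons_def = OI_mons_def[of S \<kappa>]
lemmas push_def = OI_push_def[of S \<kappa>]
lemmas act_def = OI_act_def

section \<open>Leading words and leading coefficients\<close>

definition lead :: "(nat list \<Rightarrow> int) \<Rightarrow> nat list \<Rightarrow> bool" where
  "lead c m \<longleftrightarrow> c m \<noteq> 0 \<and> (\<forall>m'. c m' \<noteq> 0 \<longrightarrow> m' \<le> m)"

definition L :: "nat \<Rightarrow> nat list set" where
  "L n = {m. \<exists>c\<in>U n. lead c m}"

text \<open>The positive generator of the ideal of integers formed by 0 and the leading coefficients
  at \<open>m\<close>; see \<open>lc_dvd\<close>.\<close>

definition lc :: "nat \<Rightarrow> nat list \<Rightarrow> nat" where
  "lc n m = (LEAST a. a > 0 \<and> (\<exists>c\<in>U n. lead c m \<and> c m = int a))"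

lemma finite_mons [simp]: "finite (mons n)"
proof (rule finite_subset)
  show "mons n \<subseteq> (\<Union>s\<in>{..<S}. (#) s ` inc_lists (\<kappa> s) 0 n)" by (auto simp: mons_def)
qed auto

lemma lead_exists:
  assumes "\<And>m. c m \<noteq> 0 \<Longrightarrow> m \<in> mons n" "c m0 \<noteq> 0"
  obtains m where "lead c m"
proof -
  let ?A = "{m. c m \<noteq> 0}"
  have fin: "finite ?A" by (rule finite_subset[OF _ finite_mons[of n]]) (use assms in auto)
  have "lead c (Max ?A)"
    unfolding lead_def using Max_in[OF fin] assms(2) Max_ge[OF fin] by blast
  then show thesis by (rule that)
qed

lemma L_subset: "L n \<subseteq> mons n"
  using supp by (auto simp: L_def lead_def)

lemma uminus: "c \<in> U n \<Longrightarrow> (\<lambda>m. - c m) \<in> U n"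
  using diff[OF zero, of c n] by simp

lemma add: "c \<in> U n \<Longrightarrow> d \<in> U n \<Longrightarrow> (\<lambda>m. c m + d m) \<in> U n"
  using diff[OF _ uminus, of c n d] by simp

lemma scale_nat: "c \<in> U n \<Longrightarrow> (\<lambda>m. int k * c m) \<in> U n"
proof (induction k)
  case 0
  then show ?case using zero by simp
next
  case (Suc k)
  then show ?case using add[of c n "\<lambda>m. int k * c m"] by (simp add: algebra_simps)
qed

lemma scale: "c \<in> U n \<Longrightarrow> (\<lambda>m. k * c m) \<in> U n"
proof (cases k rule: int_cases2)
  case (nonneg j)
  assume "c \<in> U n"
  then show ?thesis using nonneg scale_nat[of c n j] by simp
next
  case (nonpos j)
  assume "c \<in> U n"
  then show ?thesis using nonpos uminus[OF scale_nat, of c n j] by simp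
qed

lemma mons_iff: "s # xs \<in> mons n \<longleftrightarrow> s < S \<and> xs \<in> inc_lists (\<kappa> s) 0 n"
  by (auto simp: mons_def)

lemma act_Cons [simp]: "act g (s # xs) = s # map g xs"
  by (simp add: act_def)

lemma map_inc_lists: "xs \<in> inc_lists k 0 n \<Longrightarrow> g \<in> OI n n' \<Longrightarrow> map g xs \<in> inc_lists k 0 n'"
proof -
  assume xs: "xs \<in> inc_lists k 0 n" and g: "g \<in> OI n n'"
  have "sorted_wrt (\<lambda>x y. g x < g y) xs"
  proof (rule sorted_wrt_mono_rel[of _ "(<)"])
    fix x y assume "x \<in> set xs" "y \<in> set xs" "x < y"
    moreover have "set xs \<subseteq> {1..n}" using xs by (auto simp: inc_lists_def)
    ultimately show "g x < g y" using g unfolding OI_def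
      by (intro strict_mono_onD[of "{1..n}" g]) auto
  qed (use xs in \<open>auto simp: inc_lists_def\<close>)
  moreover have "g x \<in> {1..n'}" if "x \<in> set xs" for x
    using xs g that unfolding inc_lists_def OI_def by (intro PiE_mem[of g "{1..n}" "\<lambda>_. {1..n'}"]) auto
  ultimately show ?thesis using xs by (fastforce simp: inc_lists_def sorted_wrt_map)
qed

lemma act_mons: "m \<in> mons n \<Longrightarrow> g \<in> OI n n' \<Longrightarrow> act g m \<in> mons n'"
  using map_inc_lists by (auto simp: mons_def)

lemma act_less:
  assumes "m \<in> mons n" "m' \<in> mons n" "g \<in> OI n n'" "m < m'"
  shows "act g m < act g m'"
proof -
  obtain s xs s' xs' where m: "m = s # xs" "m' = s' # xs'" using assms by (auto simp: mons_def)
  then have xs: "xs \<in> inc_lists (\<kappa> s) 0 n" "xs' \<in> inc_lists (\<kappa> s') 0 n" using assms by (auto simp: mons_iff)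
  show ?thesis
  proof (cases "s = s'")
    case True
    have *: "set ys \<subseteq> {1..n}" if "ys \<in> inc_lists k 0 n" for ys k using that by (auto simp: inc_lists_def)
    have "map g xs < map g xs'"
      using assms(3,4) m True xs *[OF xs(1)] *[OF xs(2)]
      by (intro map_less_map[of "{1..n}"]) (auto simp: OI_def inc_lists_def)
    then show ?thesis using m True by simp
  next
    case False
    then show ?thesis using assms(4) m by simp
  qed
qed

lemma act_inj: "m \<in> mons n \<Longrightarrow> m' \<in> mons n \<Longrightarrow> g \<in> OI n n' \<Longrightarrow> act g m = act g m' \<Longrightarrow> m = m'"
  using act_less[of m n m' g n'] act_less[of m' n m g n'] by (cases m m' rule: linorder_cases) auto

lemma push_act: "m \<in> mons n \<Longrightarrow> g \<in> OI n n' \<Longrightarrow> push n g c (act g m) = c m"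
proof -
  assume "m \<in> mons n" "g \<in> OI n n'"
  then have "push n g c (act g m) = (\<Sum>m'\<in>mons n. if m' = m then c m' else 0)"
    unfolding push_def using act_inj by (intro sum.cong) auto
  then show ?thesis using \<open>m \<in> mons n\<close> by simp
qed

lemma push_nonzero:
  assumes "push n g c m' \<noteq> 0"
  obtains m where "m \<in> mons n" "m' = act g m" "c m \<noteq> 0"
proof -
  obtain m where "m \<in> mons n" "(if act g m = m' then c m else 0) \<noteq> 0"
    using assms unfolding push_def by (rule sum.not_neutral_contains_not_neutral)
  then show thesis using that by (metis (full_types))
qed

lemma lead_push:
  assumes "lead c m" "m \<in> mons n" "g \<in> OI n n'"
  shows "lead (push n g c) (act g m)"
  unfolding lead_def
proof (intro conjI allI impI)
  show "push n g c (act g m) \<noteq> 0" using assms by (simp add: push_act lead_def)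
  fix m' assume "push n g c m' \<noteq> 0"
  then obtain m0 where m0: "m0 \<in> mons n" "m' = act g m0" "c m0 \<noteq> 0" by (rule push_nonzero)
  then have "m0 \<le> m" using assms(1) by (simp add: lead_def)
  then show "m' \<le> act g m" using act_less[OF m0(1) assms(2,3)] m0(2) by (cases "m0 = m") (auto intro: less_imp_le)
qed

lemma L_act: "m \<in> L n \<Longrightarrow> g \<in> OI n n' \<Longrightarrow> act g m \<in> L n'"
  using L_subset lead_push push unfolding L_def by blast

lemma ex_act:
  assumes "m \<in> mons n" "m' \<in> mons n'" "hd m = hd m'" "list_all2 (\<le>) (gaps 0 (tl m) n) (gaps 0 (tl m') n')"
  obtains g where "g \<in> OI n n'" "act g m = m'"
proof -
  obtain s xs s' xs' where m: "m = s # xs" "m' = s' # xs'" using assms by (auto simp: mons_def)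
  then show thesis using assms gaps_le_imp_OI[of xs "\<kappa> s" n xs' n'] that by (auto simp: mons_iff)
qed

lemma lc_ex:
  assumes "m \<in> L n"
  shows "lc n m > 0" "\<exists>c\<in>U n. lead c m \<and> c m = int (lc n m)"
proof -
  obtain c where c: "c \<in> U n" "lead c m" using assms by (auto simp: L_def)
  have "\<exists>a>0. \<exists>c\<in>U n. lead c m \<and> c m = int a"
  proof (cases "c m > 0")
    case True
    then show ?thesis using c by (intro exI[of _ "nat (c m)"]) auto
  next
    case False
    then show ?thesis using c uminus[of c n]
      by (intro exI[of _ "nat (- c m)"] conjI bexI[of _ "\<lambda>m. - c m"]) (auto simp: lead_def)
  qed
  then have "\<exists>a. a > 0 \<and> (\<exists>c\<in>U n. lead c m \<and> c m = int a)" by blast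
  from LeastI_ex[OF this] show "lc n m > 0" "\<exists>c\<in>U n. lead c m \<and> c m = int (lc n m)"
    unfolding lc_def by auto
qed

text \<open>Division with remainder: subtracting a multiple of an element with coefficient
  \<open>lc n m\<close> leaves the remainder as coefficient at \<open>m\<close>, and a nonzero
  remainder would be a smaller positive leading coefficient.\<close>

lemma lc_dvd:
  assumes "c \<in> U n" "lead c m"
  shows "int (lc n m) dvd c m"
proof (rule ccontr)
  assume nd: "\<not> int (lc n m) dvd c m"
  have m: "m \<in> L n" using assms by (auto simp: L_def)
  obtain c0 where c0: "c0 \<in> U n" "lead c0 m" "c0 m = int (lc n m)" using lc_ex[OF m] by auto
  define q where "q = c m div int (lc n m)"
  define r where "r = c m mod int (lc n m)"
  have pos: "int (lc n m) > 0" using lc_ex(1)[OF m] by simp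
  have "r \<noteq> 0" using nd unfolding r_def by (simp add: dvd_eq_mod_eq_0)
  then have r: "r > 0" "r < int (lc n m)"
    using pos_mod_sign[OF pos, of "c m"] pos_mod_bound[OF pos, of "c m"] unfolding r_def by simp_all
  define d where "d = (\<lambda>m. c m - q * c0 m)"
  have d: "d \<in> U n" unfolding d_def by (rule diff[OF assms(1) scale[OF c0(1)]])
  have dm: "d m = r" by (simp add: d_def q_def r_def c0 minus_div_mult_eq_mod)
  have "lead d m"
    unfolding lead_def
  proof (intro conjI allI impI)
    show "d m \<noteq> 0" using r dm by simp
    fix m' assume "d m' \<noteq> 0"
    then have "c m' \<noteq> 0 \<or> c0 m' \<noteq> 0" by (auto simp: d_def)
    then show "m' \<le> m" using assms(2) c0(2) by (auto simp: lead_def)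
  qed
  then have "lc n m \<le> nat r"
    unfolding lc_def using r d dm by (intro Least_le conjI bexI[of _ d]) auto
  then show False using r by linarith
qed

text \<open>An element realizing \<open>lc n m\<close> keeps its leading coefficient when pushed
  along \<open>g\<close>.\<close>

lemma lc_push_le:
  assumes "m \<in> L n" "g \<in> OI n n'"
  shows "lc n' (act g m) \<le> lc n m"
proof -
  obtain c where c: "c \<in> U n" "lead c m" "c m = int (lc n m)" using lc_ex[OF assms(1)] by auto
  have m: "m \<in> mons n" using assms L_subset by auto
  have "int (lc n' (act g m)) dvd push n g c (act g m)"
    using c assms m by (intro lc_dvd push lead_push) auto
  then have "lc n' (act g m) dvd lc n m" using m assms c by (simp add: push_act)
  then show ?thesis using lc_ex(1)[OF assms(1)] by (auto dest: dvd_imp_le)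
qed

text \<open>The lexicographic order on lists of naturals is not well-founded. Descent on leading
  words is therefore measured by the number of words in the finite set \<open>mons n\<close> that
  lie below some word of the support.\<close>

lemma measure_less:
  assumes "lead c m" "m \<in> mons n" "\<And>m'. d m' \<noteq> 0 \<Longrightarrow> m' < m"
  shows "card {m'\<in>mons n. \<exists>m''. d m'' \<noteq> 0 \<and> m' \<le> m''} < card {m'\<in>mons n. \<exists>m''. c m'' \<noteq> 0 \<and> m' \<le> m''}"
proof (rule psubset_card_mono)
  have "m \<notin> {m'\<in>mons n. \<exists>m''. d m'' \<noteq> 0 \<and> m' \<le> m''}" using assms(3) leD by auto
  moreover have "m \<in> {m'\<in>mons n. \<exists>m''. c m'' \<noteq> 0 \<and> m' \<le> m''}" using assms by (auto simp: lead_def)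
  moreover have "{m'\<in>mons n. \<exists>m''. d m'' \<noteq> 0 \<and> m' \<le> m''} \<subseteq> {m'\<in>mons n. \<exists>m''. c m'' \<noteq> 0 \<and> m' \<le> m''}"
    using assms by (auto simp: lead_def) (meson less_imp_le order_trans)
  ultimately show "{m'\<in>mons n. \<exists>m''. d m'' \<noteq> 0 \<and> m' \<le> m''} \<subset> {m'\<in>mons n. \<exists>m''. c m'' \<noteq> 0 \<and> m' \<le> m''}"
    by blast
qed simp

lemma cancel_lead:
  assumes "lead c m" "lead d m" "a * c m = b * d m"
  shows "a * c m' - b * d m' \<noteq> 0 \<Longrightarrow> m' < m"
  using assms unfolding lead_def by (metis diff_self le_neq_trans mult_zero_right)

text \<open>A Groebner basis: by Dickson's lemma, applied to the gaps together with the least positive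
  leading coefficient, finitely many elements account for all leading terms.\<close>

theorem finitely_generated:
  obtains T where "finite T" "T \<subseteq> (SIGMA n:UNIV. U n)"
    "\<And>Q. OI_submodule S \<kappa> Q \<Longrightarrow> T \<subseteq> Sigma UNIV Q \<Longrightarrow> \<forall>n. U n \<subseteq> Q n"
proof -
  define enc where "enc = (\<lambda>(n, m). gaps 0 (tl m) n @ [lc n m])"
  have "\<exists>B. finite B \<and> B \<subseteq> {(n,m). m \<in> L n \<and> hd m = s} \<and>
     (\<forall>a\<in>{(n,m). m \<in> L n \<and> hd m = s}. \<exists>b\<in>B. list_all2 (\<le>) (enc b) (enc a))" for s
  proof -
    let ?A = "{(n,m). m \<in> L n \<and> hd m = s}"
    have len: "length a = Suc (Suc (\<kappa> s))" if "a \<in> enc ` ?A" for a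
    proof -
      obtain n m where "a = enc (n, m)" "m \<in> mons n" "hd m = s" using \<open>a \<in> enc ` ?A\<close> L_subset by blast
      then show ?thesis by (auto simp: enc_def mons_def inc_lists_def)
    qed
    obtain B' where B': "finite B'" "B' \<subseteq> enc ` ?A" "\<forall>a\<in>enc ` ?A. \<exists>b\<in>B'. list_all2 (\<le>) b a"
    proof -
      have "\<exists>B'. finite B' \<and> B' \<subseteq> enc ` ?A \<and> (\<forall>a\<in>enc ` ?A. \<exists>b\<in>B'. list_all2 (\<le>) b a)"
        by (rule Dickson) (rule len)
      then show thesis using that by (elim exE conjE)
    qed
    obtain B where B: "B \<subseteq> ?A" "finite B" "B' = enc ` B"
      using finite_subset_image[OF B'(1,2)] by blast
    have "\<exists>b\<in>B. list_all2 (\<le>) (enc b) (enc a)" if "a \<in> ?A" for a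
      using bspec[OF B'(3), of "enc a"] that B(3) by blast
    then show ?thesis using B(1,2) by blast
  qed
  then have "\<forall>s. \<exists>B. finite B \<and> B \<subseteq> {(n,m). m \<in> L n \<and> hd m = s} \<and>
     (\<forall>a\<in>{(n,m). m \<in> L n \<and> hd m = s}. \<exists>b\<in>B. list_all2 (\<le>) (enc b) (enc a))" by (rule allI)
  from choice[OF this] obtain B where "\<forall>s. finite (B s) \<and> B s \<subseteq> {(n,m). m \<in> L n \<and> hd m = s} \<and>
     (\<forall>a\<in>{(n,m). m \<in> L n \<and> hd m = s}. \<exists>b\<in>B s. list_all2 (\<le>) (enc b) (enc a))" ..
  then have B: "finite (B s)" "B s \<subseteq> {(n,m). m \<in> L n \<and> hd m = s}"
    "\<And>a. a \<in> {(n,m). m \<in> L n \<and> hd m = s} \<Longrightarrow> \<exists>b\<in>B s. list_all2 (\<le>) (enc b) (enc a)" for s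
    by (simp, simp, simp only:)
  define w where "w n m = (SOME c. c \<in> U n \<and> lead c m \<and> c m = int (lc n m))" for n m
  have w: "w n m \<in> U n" "lead (w n m) m" "w n m m = int (lc n m)" if "m \<in> L n" for n m
    using someI_ex[of "\<lambda>c. c \<in> U n \<and> lead c m \<and> c m = int (lc n m)"] lc_ex(2)[OF that]
    unfolding w_def by blast+
  define T where "T = (\<lambda>(n, m). (n, w n m)) ` (\<Union>s<S. B s)"
  show thesis
  proof (rule that[of T])
    show "finite T" unfolding T_def using B(1) by auto
    show "T \<subseteq> (SIGMA n:UNIV. U n)" unfolding T_def using B(2) w(1) by fastforce
  next
    fix Q assume Q: "OI_submodule S \<kappa> Q" and TQ: "T \<subseteq> Sigma UNIV Q"
    note Q0 = OI_submodule.zero[OF Q] and Qd = OI_submodule.diff[OF Q] and Qp = OI_submodule.push[OF Q]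
    have QT: "c \<in> Q n" if "(n, c) \<in> T" for n c using TQ that by blast
    have Qu: "(\<lambda>m. - c m) \<in> Q n" if "c \<in> Q n" for c n using Qd[OF Q0 that] by simp
    have Qa: "(\<lambda>m. c m + d m) \<in> Q n" if "c \<in> Q n" "d \<in> Q n" for c d n
      using Qd[OF that(1) Qu[OF that(2)]] by simp
    have Qn: "(\<lambda>m. int k * c m) \<in> Q n" if "c \<in> Q n" for c n k
      by (induction k) (use Q0 Qa that in \<open>auto simp: algebra_simps\<close>)
    have Qs: "(\<lambda>m. k * c m) \<in> Q n" if "c \<in> Q n" for c n k
      by (cases k rule: int_cases2) (use Qn[OF that] Qu[OF Qn[OF that]] in auto)
    have "c \<in> Q n" if "c \<in> U n" for c n
      using that
    proof (induction "card {m'\<in>mons n. \<exists>m''. c m'' \<noteq> 0 \<and> m' \<le> m''}" arbitrary: c rule: less_induct)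
      case less
      show ?case
      proof (cases "\<forall>m. c m = 0")
        case True
        then have "c = (\<lambda>_. 0)" by auto
        then show ?thesis using Q0 by simp
      next
        case False
        then obtain m where m: "lead c m" using lead_exists[of c n] supp[OF less.prems] by blast
        then have mL: "m \<in> L n" using less.prems by (auto simp: L_def)
        then have mm: "m \<in> mons n" using L_subset by auto
        have "(n, m) \<in> {(n, m'). m' \<in> L n \<and> hd m' = hd m}" using mL by simp
        from B(3)[OF this] obtain n0 m0 where m0: "(n0, m0) \<in> B (hd m)" "list_all2 (\<le>) (enc (n0, m0)) (enc (n, m))"
          by (rule bexE) (metis surj_pair)
        then have m0L: "m0 \<in> L n0" "hd m0 = hd m" using B(2) by blast+
        then have m0m: "m0 \<in> mons n0" using L_subset by auto
        have hS: "hd m < S" using mm by (auto simp: mons_def)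
        have lens: "length (gaps 0 (tl m0) n0) = length (gaps 0 (tl m) n)"
          using m0m mm m0L(2) by (auto simp: mons_def inc_lists_def)
        have le: "list_all2 (\<le>) (gaps 0 (tl m0) n0) (gaps 0 (tl m) n)" "lc n0 m0 \<le> lc n m"
          using m0(2) lens unfolding enc_def by (auto simp: list_all2_append)
        obtain g where g: "g \<in> OI n0 n" "act g m0 = m"
          using ex_act[OF m0m mm m0L(2) le(1)] .
        \<comment> \<open>The coefficient cannot grow along \<open>g\<close>, and the last entry of
          \<open>enc\<close> gives the reverse inequality. With equality, the pushed generator
          cancels every leading term at \<open>m\<close>, although leading coefficients are not
          units.\<close>
        have lceq: "lc n m = lc n0 m0" using lc_push_le[OF m0L(1) g(1)] g(2) le(2) by simp
        let ?p = "push n0 g (w n0 m0)"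
        have "(n0, w n0 m0) \<in> T"
          unfolding T_def by (rule image_eqI[of _ _ "(n0, m0)"]) (use m0(1) hS in auto)
        then have pQ: "?p \<in> Q n" by (intro Qp[OF QT g(1)])
        have pU: "?p \<in> U n" using w(1)[OF m0L(1)] g(1) by (rule push)
        have pl: "lead ?p m" using lead_push[OF w(2)[OF m0L(1)] m0m g(1)] g(2) by simp
        have pm: "?p m = int (lc n m)" using push_act[OF m0m g(1)] g(2) w(3)[OF m0L(1)] lceq by simp
        obtain q where q: "c m = int (lc n m) * q" using lc_dvd[OF less.prems m] by (elim dvdE)
        let ?d = "\<lambda>m'. c m' - q * ?p m'"
        have dU: "?d \<in> U n" using less.prems pU by (intro diff scale)
        have lt: "m' < m" if "?d m' \<noteq> 0" for m'
          using cancel_lead[OF m pl, of 1 q m'] pm q that by simp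
        have "?d \<in> Q n" by (rule less.hyps[OF measure_less[OF m mm lt] dU])
        from Qa[OF this Qs[OF pQ, of q]] show ?thesis by simp
      qed
    qed
    then show "\<forall>n. U n \<subseteq> Q n" by blast
  qed
qed

definition Std :: "nat \<Rightarrow> nat list set" where
  "Std n = mons n - L n"

lemma Std_independent:
  assumes "c \<in> U n" "\<And>m. c m \<noteq> 0 \<Longrightarrow> m \<in> Std n"
  shows "c m = 0"
proof (rule ccontr)
  assume "c m \<noteq> 0"
  then obtain m' where "lead c m'" using lead_exists[of c n m] supp[OF assms(1)] by blast
  then have "m' \<in> L n" "m' \<in> Std n" using assms by (auto simp: L_def lead_def)
  then show False by (simp add: Std_def)
qed

text \<open>Reduction to a normal form by leading terms. Cancelling over the integers requires
  multiplying by the leading coefficient of the reducing element; the factor \<open>N\<close>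
  collects these and is harmless for ranks.\<close>

lemma Std_spans:
  assumes "\<And>m. c m \<noteq> 0 \<Longrightarrow> m \<in> mons n"
  shows "\<exists>N d. N \<noteq> 0 \<and> (\<forall>m. d m \<noteq> 0 \<longrightarrow> m \<in> Std n) \<and> (\<lambda>m. N * c m - d m) \<in> U n"
  using assms
proof (induction "card {m'\<in>mons n. \<exists>m''. c m'' \<noteq> 0 \<and> m' \<le> m''}" arbitrary: c rule: less_induct)
  case less
  show ?case
  proof (cases "\<forall>m. c m = 0")
    case True
    then show ?thesis using zero by (intro exI[of _ 1] exI[of _ "\<lambda>_. 0"]) simp
  next
    case False
    then obtain m where m: "lead c m" using lead_exists[of c n] less.prems by blast
    then have mm: "m \<in> mons n" using less.prems by (auto simp: lead_def)
    show ?thesis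
    proof (cases "m \<in> L n")
      case True
      then obtain u where u: "u \<in> U n" "lead u m" by (auto simp: L_def)
      let ?c = "\<lambda>m'. u m * c m' - c m * u m'"
      have lt: "m' < m" if "?c m' \<noteq> 0" for m'
        using cancel_lead[OF m u(2), of "u m" "c m" m'] that by simp
      have supp': "m' \<in> mons n" if "?c m' \<noteq> 0" for m'
        using that less.prems[of m'] supp[OF u(1), of m'] by (cases "c m' = 0") auto
      have "\<exists>N d. N \<noteq> 0 \<and> (\<forall>m. d m \<noteq> 0 \<longrightarrow> m \<in> Std n) \<and> (\<lambda>m. N * ?c m - d m) \<in> U n"
        by (rule less.hyps[of ?c, OF measure_less[OF m mm lt] supp'])
      then obtain N d where Nd: "N \<noteq> 0" "\<forall>m. d m \<noteq> 0 \<longrightarrow> m \<in> Std n" "(\<lambda>m. N * ?c m - d m) \<in> U n"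
        by (elim exE conjE)
      have "(\<lambda>m'. (N * ?c m' - d m') + (N * c m) * u m') \<in> U n"
        using Nd(3) scale[OF u(1)] by (rule add)
      then have "(\<lambda>m'. (N * u m) * c m' - d m') \<in> U n" by (simp add: algebra_simps)
      then show ?thesis using Nd u(2) by (intro exI[of _ "N * u m"] exI[of _ d]) (auto simp: lead_def)
    next
      case False
      let ?c = "c(m := 0)"
      have lt: "m' < m" if "?c m' \<noteq> 0" for m'
        using that m by (auto simp: lead_def split: if_splits)
      have supp': "m' \<in> mons n" if "?c m' \<noteq> 0" for m'
        using that less.prems[of m'] by (auto split: if_splits)
      have "\<exists>N d. N \<noteq> 0 \<and> (\<forall>m. d m \<noteq> 0 \<longrightarrow> m \<in> Std n) \<and> (\<lambda>m. N * ?c m - d m) \<in> U n"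
        by (rule less.hyps[of ?c, OF measure_less[OF m mm lt] supp'])
      then obtain N d where Nd: "N \<noteq> 0" "\<forall>m. d m \<noteq> 0 \<longrightarrow> m \<in> Std n" "(\<lambda>m. N * ?c m - d m) \<in> U n"
        by (elim exE conjE)
      have "(\<lambda>m'. N * c m' - (d m' + (if m' = m then N * c m else 0))) = (\<lambda>m. N * ?c m - d m)" by auto
      then show ?thesis using Nd False mm
        by (intro exI[of _ N] exI[of _ "\<lambda>m'. d m' + (if m' = m then N * c m else 0)"]) (auto simp: Std_def split: if_splits)
    qed
  qed
qed

text \<open>For \<open>n\<close> at least \<open>k\<close>, taking gaps identifies words with
  vectors of length \<open>k + 1\<close> and sum \<open>n - k\<close>, so the family becomes a
  monomial ideal in degree \<open>n - k\<close>.\<close>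

lemma evpoly_upset_gaps:
  assumes "\<And>n. A n \<subseteq> inc_lists k 0 n" "finite B" "\<And>b. b \<in> B \<Longrightarrow> length b = Suc k"
    and "\<And>n xs. xs \<in> inc_lists k 0 n \<Longrightarrow> xs \<in> A n \<longleftrightarrow> (\<exists>b\<in>B. list_all2 (\<le>) b (gaps 0 xs n))"
  shows "evpoly (\<lambda>n. real (card (A n)))"
proof (rule evpoly_cong)
  show "evpoly (\<lambda>n. real (card (upset (Suc k) B (n - k))))"
    using assms by (intro evpoly_shift[OF evpoly_upset]) auto
  have "card (A n) = card (upset (Suc k) B (n - k))" if "n \<ge> k" for n
  proof (rule bij_betw_same_card)
    have bij: "bij_betw (\<lambda>xs. gaps 0 xs n) (inc_lists k 0 n) {v. length v = Suc k \<and> sum_list v = n - k}"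
      using bij_betw_gaps that by blast
    show "bij_betw (\<lambda>xs. gaps 0 xs n) (A n) (upset (Suc k) B (n - k))"
    proof (rule bij_betw_subset[OF bij assms(1)])
      have "upset (Suc k) B (n - k) = (\<lambda>xs. gaps 0 xs n) ` inc_lists k 0 n \<inter> {v. \<exists>b\<in>B. list_all2 (\<le>) b v}"
        unfolding bij_betw_imp_surj_on[OF bij] upset_def by auto
      also have "\<dots> = (\<lambda>xs. gaps 0 xs n) ` {xs \<in> inc_lists k 0 n. \<exists>b\<in>B. list_all2 (\<le>) b (gaps 0 xs n)}"
        by auto
      also have "{xs \<in> inc_lists k 0 n. \<exists>b\<in>B. list_all2 (\<le>) b (gaps 0 xs n)} = A n"
        using assms(1)[of n] assms(4)[of _ n] by (intro equalityI subsetI) auto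
      finally show "(\<lambda>xs. gaps 0 xs n) ` A n = upset (Suc k) B (n - k)" by simp
    qed
  qed
  then show "\<forall>\<^sub>F n in sequentially. real (card (A n)) = real (card (upset (Suc k) B (n - k)))"
    unfolding eventually_sequentially by auto
qed

text \<open>For each generator the leading words form an up-set of gap vectors, by
  \<open>L_act\<close>, and Dickson's lemma describes it by finitely many minimal vectors. Standard
  words are the complement, so their number is a difference of two such counts.\<close>

theorem evpoly_Std: "evpoly (\<lambda>n. real (card (Std n)))"
proof -
  \<comment> \<open>Every gap vector lies above the zero vector, so all words together are the
    up-set of that one vector.\<close>
  have 1: "evpoly (\<lambda>n. real (card (inc_lists (\<kappa> s) 0 n)))" for s
    by (rule evpoly_upset_gaps[where B="{replicate (Suc (\<kappa> s)) 0}"])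
      (auto simp: list_all2_conv_all_nth inc_lists_def nth_Cons split: nat.split)
  have 2: "evpoly (\<lambda>n. real (card {xs \<in> inc_lists (\<kappa> s) 0 n. s # xs \<in> L n}))" for s
  proof -
    let ?A = "{gaps 0 xs n | n xs. xs \<in> inc_lists (\<kappa> s) 0 n \<and> s # xs \<in> L n}"
    have len: "length a = Suc (\<kappa> s)" if "a \<in> ?A" for a using that by (auto simp: inc_lists_def)
    obtain B where B: "finite B" "B \<subseteq> ?A" "\<forall>a\<in>?A. \<exists>b\<in>B. list_all2 (\<le>) b a"
    proof -
      have "\<exists>B. finite B \<and> B \<subseteq> ?A \<and> (\<forall>a\<in>?A. \<exists>b\<in>B. list_all2 (\<le>) b a)"
        by (rule Dickson) (rule len)
      then show thesis using that by (elim exE conjE)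
    qed
    show ?thesis
    proof (rule evpoly_upset_gaps[where B=B])
      fix n xs assume xs: "xs \<in> inc_lists (\<kappa> s) 0 n"
      show "xs \<in> {xs \<in> inc_lists (\<kappa> s) 0 n. s # xs \<in> L n} \<longleftrightarrow> (\<exists>b\<in>B. list_all2 (\<le>) b (gaps 0 xs n))"
      proof
        assume "xs \<in> {xs \<in> inc_lists (\<kappa> s) 0 n. s # xs \<in> L n}"
        then show "\<exists>b\<in>B. list_all2 (\<le>) b (gaps 0 xs n)" by (intro B(3)[rule_format]) auto
      next
        assume "\<exists>b\<in>B. list_all2 (\<le>) b (gaps 0 xs n)"
        then obtain n0 ys where ys: "ys \<in> inc_lists (\<kappa> s) 0 n0" "s # ys \<in> L n0" "list_all2 (\<le>) (gaps 0 ys n0) (gaps 0 xs n)"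
          using B(2) by blast
        have "s < S" using ys(2) L_subset[of n0] by (auto simp: mons_def)
        then obtain g where g: "g \<in> OI n0 n" "act g (s # ys) = s # xs"
          using ex_act[of "s # ys" n0 "s # xs" n] ys xs by (auto simp: mons_iff)
        show "xs \<in> {xs \<in> inc_lists (\<kappa> s) 0 n. s # xs \<in> L n}"
          using L_act[OF ys(2) g(1)] g(2) xs by simp
      qed
    qed (use B(1) len[OF subsetD[OF B(2)]] in auto)
  qed
  have "card (Std n) = (\<Sum>s<S. card (inc_lists (\<kappa> s) 0 n) - card {xs \<in> inc_lists (\<kappa> s) 0 n. s # xs \<in> L n})" for n
  proof -
    have "Std n = (\<Union>s\<in>{..<S}. (#) s ` {xs \<in> inc_lists (\<kappa> s) 0 n. s # xs \<notin> L n})"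
      by (auto simp: Std_def mons_def)
    then have "card (Std n) = (\<Sum>s<S. card ((#) s ` {xs \<in> inc_lists (\<kappa> s) 0 n. s # xs \<notin> L n}))"
      by (simp only:) (rule card_UN_disjoint, auto)
    also have "\<dots> = (\<Sum>s<S. card (inc_lists (\<kappa> s) 0 n) - card {xs \<in> inc_lists (\<kappa> s) 0 n. s # xs \<in> L n})"
    proof (rule sum.cong[OF refl])
      fix s
      let ?A = "{xs \<in> inc_lists (\<kappa> s) 0 n. s # xs \<in> L n}"
      have *: "{xs \<in> inc_lists (\<kappa> s) 0 n. s # xs \<notin> L n} = inc_lists (\<kappa> s) 0 n - ?A" by auto
      show "card ((#) s ` {xs \<in> inc_lists (\<kappa> s) 0 n. s # xs \<notin> L n}) =
        card (inc_lists (\<kappa> s) 0 n) - card ?A"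
        unfolding * by (subst card_image) (auto simp: inj_on_def intro: card_Diff_subset)
    qed
    finally show ?thesis .
  qed
  moreover have "card {xs \<in> inc_lists (\<kappa> s) 0 n. s # xs \<in> L n} \<le> card (inc_lists (\<kappa> s) 0 n)" for s n
    by (intro card_mono) auto
  ultimately have "real (card (Std n)) =
      (\<Sum>s<S. real (card (inc_lists (\<kappa> s) 0 n)) - real (card {xs \<in> inc_lists (\<kappa> s) 0 n. s # xs \<in> L n}))" for n
    by (simp add: of_nat_diff)
  then show ?thesis using 1 2 by (simp only:) (intro evpoly_sum evpoly_diff, auto)
qed

end

subsection \<open>Ranks of abelian groups\<close>

definition zcomb :: "('a, 'b) monoid_scheme \<Rightarrow> 'i set \<Rightarrow> ('i \<Rightarrow> 'a) \<Rightarrow> ('i \<Rightarrow> int) \<Rightarrow> 'a" where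
  "zcomb G I x c = finprod G (\<lambda>i. x i [^]\<^bsub>G\<^esub> c i) I"

definition zindep :: "('a, 'b) monoid_scheme \<Rightarrow> 'i set \<Rightarrow> ('i \<Rightarrow> 'a) \<Rightarrow> bool" where
  "zindep G I x \<longleftrightarrow> finite I \<and> x \<in> I \<rightarrow> carrier G \<and>
     (\<forall>c. zcomb G I x c = \<one>\<^bsub>G\<^esub> \<longrightarrow> (\<forall>i\<in>I. c i = 0))"

text \<open>A definition cannot quantify over the type of index sets, so independent families are
  tested on sets of naturals; \<open>rank_leD\<close> transfers the bound to other index
  types.\<close>

definition rank_le :: "('a, 'b) monoid_scheme \<Rightarrow> nat \<Rightarrow> bool" where
  "rank_le G r \<longleftrightarrow> (\<forall>(I :: nat set) x. zindep G I x \<longrightarrow> card I \<le> r)"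

text \<open>The torsion-free rank, that is, the dimension after extending scalars to the rationals.
  The multiple \<open>N\<close> absorbs both torsion and denominators.\<close>

definition has_rank :: "('a, 'b) monoid_scheme \<Rightarrow> nat \<Rightarrow> bool" where
  "has_rank G r \<longleftrightarrow> (\<exists>(I :: nat set) x. zindep G I x \<and> card I = r \<and>
     (\<forall>y\<in>carrier G. \<exists>N c. N \<noteq> 0 \<and> y [^]\<^bsub>G\<^esub> (N::int) = zcomb G I x c))"

context comm_group
begin

lemma zcomb_closed [simp]: "x \<in> I \<rightarrow> carrier G \<Longrightarrow> zcomb G I x c \<in> carrier G"
  unfolding zcomb_def by (intro finprod_closed) auto

lemma zcomb_cong:
  assumes "x' \<in> I \<rightarrow> carrier G" "\<And>i. i \<in> I \<Longrightarrow> x i = x' i" "\<And>i. i \<in> I \<Longrightarrow> c i = c' i"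
  shows "zcomb G I x c = zcomb G I x' c'"
  unfolding zcomb_def using assms by (intro finprod_cong') auto

lemma zcomb_add:
  "x \<in> I \<rightarrow> carrier G \<Longrightarrow> zcomb G I x (\<lambda>i. c i + d i) = zcomb G I x c \<otimes> zcomb G I x d"
proof -
  assume x: "x \<in> I \<rightarrow> carrier G"
  have "zcomb G I x (\<lambda>i. c i + d i) = finprod G (\<lambda>i. x i [^] c i \<otimes> x i [^] d i) I"
    unfolding zcomb_def using x by (intro finprod_cong') (auto simp: int_pow_mult Pi_iff)
  also have "\<dots> = zcomb G I x c \<otimes> zcomb G I x d"
    unfolding zcomb_def using x by (intro finprod_multf) auto
  finally show ?thesis .
qed

lemma zcomb_zero [simp]: "zcomb G I x (\<lambda>_. 0) = \<one>"
  by (simp add: zcomb_def)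

lemma zcomb_uminus:
  "x \<in> I \<rightarrow> carrier G \<Longrightarrow> zcomb G I x (\<lambda>i. - c i) = inv (zcomb G I x c)"
  using zcomb_add[of x I "\<lambda>i. - c i" c] by (intro inv_equality[symmetric]) auto

lemma zcomb_diff:
  "x \<in> I \<rightarrow> carrier G \<Longrightarrow> zcomb G I x (\<lambda>i. c i - d i) = zcomb G I x c \<otimes> inv (zcomb G I x d)"
  using zcomb_add[of x I c "\<lambda>i. - d i"] zcomb_uminus[of x I d] by simp

lemma zcomb_scale:
  assumes x: "x \<in> I \<rightarrow> carrier G"
  shows "zcomb G I x (\<lambda>i. k * c i) = zcomb G I x c [^] (k::int)"
proof -
  have *: "zcomb G I x (\<lambda>i. int n * c i) = zcomb G I x c [^] (int n)" for n
  proof (induction n)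
    case (Suc n)
    have "zcomb G I x (\<lambda>i. int (Suc n) * c i) = zcomb G I x (\<lambda>i. int n * c i + c i)"
      using x by (intro zcomb_cong) (auto simp: algebra_simps)
    also have "\<dots> = zcomb G I x c [^] (int n) \<otimes> zcomb G I x c" using Suc zcomb_add[OF x] by simp
    also have "\<dots> = zcomb G I x c [^] (int (Suc n))"
      using int_pow_mult[OF zcomb_closed[OF x], of c "int n" 1] x by (simp add: add.commute)
    finally show ?case .
  qed (use x in simp)
  show ?thesis
  proof (cases k rule: int_cases2)
    case (nonneg n)
    then show ?thesis using * by simp
  next
    case (nonpos n)
    then show ?thesis using *[of n] zcomb_uminus[OF x, of "\<lambda>i. int n * c i"] x
      by (simp add: int_pow_neg)
  qed
qed

lemma zcomb_mono_neutral:
  assumes "finite J" "I \<subseteq> J" "x \<in> J \<rightarrow> carrier G" "\<And>j. j \<in> J - I \<Longrightarrow> c j = 0"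
  shows "zcomb G I x c = zcomb G J x c"
  unfolding zcomb_def using assms by (intro finprod_mono_neutral_cong_left) auto

lemma zcomb_reindex:
  assumes "inj_on h J" "x \<in> h ` J \<rightarrow> carrier G"
  shows "zcomb G (h ` J) x c = zcomb G J (x \<circ> h) (c \<circ> h)"
  unfolding zcomb_def using assms by (subst finprod_reindex) (auto simp: Pi_iff)

lemma zcomb_singleton:
  assumes "finite I" "x \<in> I \<rightarrow> carrier G" "i \<in> I"
  shows "zcomb G I x (\<lambda>j. if j = i then k else 0) = x i [^] k"
proof -
  have "zcomb G I x (\<lambda>j. if j = i then k else 0) = zcomb G {i} x (\<lambda>j. if j = i then k else 0)"
    using assms by (intro zcomb_mono_neutral[symmetric]) auto
  also have "\<dots> = x i [^] k" using assms by (simp add: zcomb_def Pi_iff)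
  finally show ?thesis .
qed

lemma zcomb_zcomb:
  assumes "finite I" "finite J" "x \<in> J \<rightarrow> carrier G"
  shows "zcomb G I (\<lambda>i. zcomb G J x (a i)) c = zcomb G J x (\<lambda>j. \<Sum>i\<in>I. c i * a i j)"
  using assms(1)
proof (induction I rule: finite_induct)
  case (insert i I)
  have "zcomb G (insert i I) (\<lambda>i. zcomb G J x (a i)) c =
      zcomb G J x (a i) [^] c i \<otimes> zcomb G I (\<lambda>i. zcomb G J x (a i)) c"
    unfolding zcomb_def[of _ "insert i I"] zcomb_def[of _ I] using insert.hyps assms(3)
    by (subst finprod_insert) auto
  also have "\<dots> = zcomb G J x (\<lambda>j. c i * a i j + (\<Sum>i\<in>I. c i * a i j))"
    using insert.IH zcomb_scale[OF assms(3)] zcomb_add[OF assms(3)] by simp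
  finally show ?case using insert.hyps by simp
qed (simp add: zcomb_def)

lemma zcomb_in_subgroup:
  assumes "subgroup H G" "x \<in> I \<rightarrow> H" "finite I"
  shows "zcomb G I x c \<in> H"
  using assms(3,2)
proof (induction I rule: finite_induct)
  case empty
  then show ?case using subgroup.one_closed[OF assms(1)] by (simp add: zcomb_def)
next
  case (insert i I)
  have sub: "H \<subseteq> carrier G" by (rule subgroup.subset[OF assms(1)])
  have "zcomb G (insert i I) x c = x i [^] c i \<otimes> zcomb G I x c"
    unfolding zcomb_def using insert sub by (subst finprod_insert) auto
  then show ?case using insert assms(1)
    by (auto intro!: subgroup.m_closed[OF assms(1)] subgroup_int_pow_closed)
qed

end

lemma hom_zcomb:
  assumes "comm_group G" "comm_group H" "h \<in> hom G H" "x \<in> I \<rightarrow> carrier G" "finite I"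
  shows "h (zcomb G I x c) = zcomb H I (h \<circ> x) c"
proof -
  interpret G: comm_group G by fact
  interpret H: comm_group H by fact
  interpret h: group_hom G H h using assms(3) by unfold_locales
  show ?thesis using assms(5,4)
  proof (induction I rule: finite_induct)
    case (insert i I)
    then show ?case unfolding zcomb_def
      by (subst G.finprod_insert, simp, simp, force, force) (subst H.finprod_insert, auto simp: h.hom_int_pow Pi_iff)
  qed (simp add: zcomb_def)
qed

lemma zindep_reindex:
  assumes "comm_group G" "bij_betw h J I" "zindep G I x"
  shows "zindep G J (x \<circ> h)"
  unfolding zindep_def
proof (intro conjI allI impI)
  interpret G: comm_group G by fact
  have hJ: "h ` J = I" "inj_on h J" using assms(2) by (auto simp: bij_betw_def)
  show "finite J" using assms bij_betw_finite by (auto simp: zindep_def)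
  show "x \<circ> h \<in> J \<rightarrow> carrier G" using assms(3) hJ by (auto simp: zindep_def)
  fix c assume c: "zcomb G J (x \<circ> h) c = \<one>\<^bsub>G\<^esub>"
  let ?c = "\<lambda>i. c (the_inv_into J h i)"
  have "zcomb G I x ?c = zcomb G J (x \<circ> h) (?c \<circ> h)"
    using G.zcomb_reindex[of h J x ?c] hJ assms(3) by (auto simp: zindep_def)
  also have "\<dots> = zcomb G J (x \<circ> h) c"
    by (rule G.zcomb_cong) (use hJ assms(3) in \<open>auto simp: zindep_def the_inv_into_f_f\<close>)
  finally have "zcomb G I x ?c = \<one>\<^bsub>G\<^esub>" using c by simp
  moreover have "\<forall>c. zcomb G I x c = \<one>\<^bsub>G\<^esub> \<longrightarrow> (\<forall>i\<in>I. c i = 0)" using assms(3) by (simp add: zindep_def)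
  ultimately have "\<forall>i\<in>I. ?c i = 0" by blast
  then show "\<forall>i\<in>J. c i = 0" using hJ by (auto simp: the_inv_into_f_f)
qed

lemma rank_leD:
  assumes "comm_group G" "rank_le G r" "zindep G I x"
  shows "card I \<le> r"
proof -
  have "finite I" using assms(3) by (simp add: zindep_def)
  then obtain h where h: "bij_betw h {0..<card I} I" using ex_bij_betw_nat_finite by blast
  then have "card {0..<card I} \<le> r"
    using assms(2) zindep_reindex[OF assms(1) h assms(3)] unfolding rank_le_def by blast
  then show ?thesis by simp
qed

lemma has_rankI:
  assumes "comm_group G" "zindep G I x"
    and "\<And>y. y \<in> carrier G \<Longrightarrow> \<exists>N c. N \<noteq> 0 \<and> y [^]\<^bsub>G\<^esub> (N::int) = zcomb G I x c"
  shows "has_rank G (card I)"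
proof -
  interpret G: comm_group G by fact
  have "finite I" using assms(2) by (simp add: zindep_def)
  then obtain h where h: "bij_betw h {0..<card I} I" using ex_bij_betw_nat_finite by blast
  have "zcomb G I x c = zcomb G {0..<card I} (x \<circ> h) (c \<circ> h)" for c
    using G.zcomb_reindex[of h "{0..<card I}" x c] h assms(2) by (auto simp: bij_betw_def zindep_def)
  then show ?thesis unfolding has_rank_def
    using zindep_reindex[OF assms(1) h assms(2)] assms(3)
    by (intro exI[of _ "{0..<card I}"] exI[of _ "x \<circ> h"]) (metis card_atLeastLessThan diff_zero)
qed

lemma has_rank_le: "comm_group G \<Longrightarrow> has_rank G r \<Longrightarrow> rank_le G r' \<Longrightarrow> r \<le> r'"
  unfolding has_rank_def using rank_leD by blast

text \<open>Gaussian elimination without division: a homogeneous integral system with more unknowns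
  than equations has a nonzero integral solution.\<close>

lemma int_elimination:
  fixes a :: "'i \<Rightarrow> 'j \<Rightarrow> int"
  assumes "finite J" "finite I" "card J < card I"
  shows "\<exists>c. (\<exists>i\<in>I. c i \<noteq> 0) \<and> (\<forall>j\<in>J. (\<Sum>i\<in>I. c i * a i j) = 0)"
  using assms
proof (induction J arbitrary: I a rule: finite_induct)
  case empty
  then obtain i where "i \<in> I" by fastforce
  then show ?case by (intro exI[of _ "\<lambda>_. 1"]) auto
next
  case (insert j J)
  show ?case
  proof (cases "\<forall>i\<in>I. a i j = 0")
    case True
    then show ?thesis using insert.IH[of I a] insert.prems insert.hyps by auto
  next
    case False
    then obtain p where p: "p \<in> I" "a p j \<noteq> 0" by auto
    \<comment> \<open>Row \<open>p\<close> is the pivot. Cross-multiplication clears column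
      \<open>j\<close> in all other rows and keeps the entries integral.\<close>
    let ?I = "I - {p}" and ?b = "\<lambda>i k. a p j * a i k - a i j * a p k"
    have "card J < card ?I" using insert.prems insert.hyps p by simp
    then obtain c where c: "\<exists>i\<in>?I. c i \<noteq> 0" "\<forall>k\<in>J. (\<Sum>i\<in>?I. c i * ?b i k) = 0"
      using insert.IH[of ?I ?b] insert.prems by auto
    \<comment> \<open>Back substitution: scaling the reduced solution by the pivot makes the
      required value at \<open>p\<close> an integer.\<close>
    let ?c = "\<lambda>i. if i = p then - (\<Sum>i\<in>?I. c i * a i j) else a p j * c i"
    have "(\<Sum>i\<in>I. ?c i * a i k) = (\<Sum>i\<in>?I. c i * ?b i k)" for k
    proof -
      have "(\<Sum>i\<in>I. ?c i * a i k) = ?c p * a p k + (\<Sum>i\<in>?I. ?c i * a i k)"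
        using insert.prems p by (simp add: sum.remove)
      also have "(\<Sum>i\<in>?I. ?c i * a i k) = (\<Sum>i\<in>?I. a p j * c i * a i k)"
        by (intro sum.cong) auto
      finally show ?thesis
        by (simp add: algebra_simps sum_subtractf sum_distrib_left)
    qed
    moreover have "(\<Sum>i\<in>?I. c i * ?b i j) = 0" by (simp add: algebra_simps)
    moreover have "\<exists>i\<in>I. ?c i \<noteq> 0" using c(1) p by auto
    ultimately show ?thesis using c(2) by (intro exI[of _ ?c]) auto
  qed
qed

text \<open>Independent elements are integral combinations of the generators. If there were more of
  them than generators, elimination on the matrix of coefficients would give a nontrivial
  relation.\<close>

lemma rank_le_generate:
  assumes "comm_group G" "finite J" "x \<in> J \<rightarrow> carrier G" "carrier G = generate G (x ` J)"
  shows "rank_le G (card J)"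
  unfolding rank_le_def
proof (intro allI impI)
  interpret G: comm_group G by fact
  fix I :: "nat set" and y assume y: "zindep G I y"
  have "subgroup (range (zcomb G J x)) G"
  proof (rule G.subgroupI)
    show "range (zcomb G J x) \<subseteq> carrier G" using assms(3) by auto
    show "inv\<^bsub>G\<^esub> a \<in> range (zcomb G J x)" if "a \<in> range (zcomb G J x)" for a
    proof -
      obtain c where "a = zcomb G J x c" using \<open>a \<in> range (zcomb G J x)\<close> by blast
      then show ?thesis using G.zcomb_uminus[OF assms(3), of c] by (intro image_eqI[of _ _ "\<lambda>i. - c i"]) auto
    qed
    show "a \<otimes>\<^bsub>G\<^esub> b \<in> range (zcomb G J x)" if "a \<in> range (zcomb G J x)" "b \<in> range (zcomb G J x)" for a b
    proof -
      obtain c where "a = zcomb G J x c" using \<open>a \<in> range (zcomb G J x)\<close> by (elim imageE)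
      moreover obtain d where "b = zcomb G J x d" using \<open>b \<in> range (zcomb G J x)\<close> by (elim imageE)
      ultimately show ?thesis using G.zcomb_add[OF assms(3), of c d] by (intro image_eqI[of _ _ "\<lambda>i. c i + d i"]) auto
    qed
  qed simp
  moreover have "x ` J \<subseteq> range (zcomb G J x)"
  proof
    fix z assume "z \<in> x ` J"
    then obtain j where "j \<in> J" "z = x j" by auto
    then have "zcomb G J x (\<lambda>k. if k = j then 1 else 0) = z"
      using G.zcomb_singleton[OF assms(2,3), of j 1] assms(3) by (auto simp: Pi_iff)
    then show "z \<in> range (zcomb G J x)" by blast
  qed
  ultimately have gen: "carrier G \<subseteq> range (zcomb G J x)"
    unfolding assms(4) by (intro G.generate_subgroup_incl)
  show "card I \<le> card J"
  proof (rule ccontr)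
    assume "\<not> card I \<le> card J"
    moreover have fI: "finite I" using y by (simp add: zindep_def)
    have "\<exists>a. y i = zcomb G J x a" if "i \<in> I" for i
    proof -
      have "y i \<in> carrier G" using y that by (auto simp: zindep_def)
      then have "y i \<in> range (zcomb G J x)" using gen by (rule subsetD[rotated])
      then show ?thesis by (elim imageE) (rule exI)
    qed
    then obtain a where a: "\<And>i. i \<in> I \<Longrightarrow> y i = zcomb G J x (a i)" by metis
    ultimately obtain c where c: "\<exists>i\<in>I. c i \<noteq> 0" "\<forall>j\<in>J. (\<Sum>i\<in>I. c i * a i j) = 0"
      using int_elimination[OF assms(2) fI, of a] by auto
    have "zcomb G I y c = zcomb G I (\<lambda>i. zcomb G J x (a i)) c"
      using a assms(3) by (intro G.zcomb_cong) auto
    also have "\<dots> = zcomb G J x (\<lambda>j. \<Sum>i\<in>I. c i * a i j)" by (rule G.zcomb_zcomb[OF fI assms(2,3)])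
    also have "\<dots> = zcomb G J x (\<lambda>_. 0)" using c(2) assms(3) by (intro G.zcomb_cong) auto
    finally show False using y c(1) by (auto simp: zindep_def)
  qed
qed

text \<open>Take a maximal \<open>K\<close> inside \<open>I\<close> whose images in \<open>C\<close>
  are independent, so \<open>card K\<close> is at most \<open>s\<close>. By maximality each
  remaining index \<open>i\<close> has a relation in \<open>C\<close> among \<open>i\<close> and
  \<open>K\<close> with nonzero coefficient at \<open>i\<close>. The corresponding element of
  \<open>B\<close> is killed by \<open>g\<close> and lifts to \<open>A\<close>, and these lifts are
  independent.\<close>

lemma rank_le_exact:
  assumes "comm_group A" "comm_group B" "comm_group C" "f \<in> hom A B" "g \<in> hom B C"
    and ex: "\<And>b. b \<in> carrier B \<Longrightarrow> g b = \<one>\<^bsub>C\<^esub> \<Longrightarrow> b \<in> f ` carrier A"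
    and "rank_le A r" "rank_le C s"
  shows "rank_le B (r + s)"
  unfolding rank_le_def
proof (intro allI impI)
  interpret A: comm_group A by fact
  interpret B: comm_group B by fact
  interpret C: comm_group C by fact
  fix I :: "nat set" and y assume y: "zindep B I y"
  have fI: "finite I" and yB: "y \<in> I \<rightarrow> carrier B" using y by (auto simp: zindep_def)
  have gC: "g b \<in> carrier C" if "b \<in> carrier B" for b using that assms(5) by (auto simp: hom_def)
  have gy: "g \<circ> y \<in> I \<rightarrow> carrier C" using yB gC by (auto simp: Pi_iff)
  let ?P = "\<lambda>K. K \<subseteq> I \<and> zindep C K (g \<circ> y)"
  have "?P {}" by (simp add: zindep_def)
  moreover have "card K \<le> card I" if "?P K" for K using that fI by (simp add: card_mono)
  ultimately obtain K where K: "?P K" "\<And>K'. ?P K' \<Longrightarrow> card K' \<le> card K"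
    using ex_has_greatest_nat[of ?P "{}" card "Suc (card I)"] by (metis less_Suc_eq_le)
  have fK: "finite K" using K(1) fI finite_subset by blast
  have "\<exists>c a. c i \<noteq> 0 \<and> (\<forall>j\<in>I - K - {i}. c j = 0) \<and> a \<in> carrier A \<and> f a = zcomb B I y c" if i: "i \<in> I - K" for i
  proof -
    have "\<not> ?P (insert i K)" using K(2)[of "insert i K"] i fK by auto
    then obtain c where c: "zcomb C (insert i K) (g \<circ> y) c = \<one>\<^bsub>C\<^esub>" "\<exists>j\<in>insert i K. c j \<noteq> 0"
      using K(1) i fK gy unfolding zindep_def by auto
    have ci: "c i \<noteq> 0"
    proof
      assume "c i = 0"
      then have "zcomb C K (g \<circ> y) c = \<one>\<^bsub>C\<^esub>"
        using c(1) C.zcomb_mono_neutral[of "insert i K" K "g \<circ> y" c] fK i K(1) gy by (auto simp: Pi_iff)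
      then show False using K(1) c(2) \<open>c i = 0\<close> unfolding zindep_def by auto
    qed
    let ?c = "\<lambda>j. if j \<in> insert i K then c j else 0"
    have "g (zcomb B I y ?c) = zcomb C I (g \<circ> y) ?c"
      by (rule hom_zcomb[OF assms(2,3,5) yB fI])
    also have "\<dots> = zcomb C (insert i K) (g \<circ> y) ?c"
      using fI K(1) i gy by (intro C.zcomb_mono_neutral[symmetric]) auto
    also have "\<dots> = zcomb C (insert i K) (g \<circ> y) c"
      using K(1) i gy by (intro C.zcomb_cong) auto
    finally have "zcomb B I y ?c \<in> f ` carrier A" using c(1) yB by (intro ex) auto
    then obtain a where "a \<in> carrier A" "f a = zcomb B I y ?c" by auto
    then show ?thesis using ci by (intro exI[of _ ?c] exI[of _ a]) auto
  qed
  then obtain c a where ca: "\<And>i. i \<in> I - K \<Longrightarrow> c i i \<noteq> 0" "\<And>i j. i \<in> I - K \<Longrightarrow> j \<in> I - K - {i} \<Longrightarrow> c i j = 0"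
    "\<And>i. i \<in> I - K \<Longrightarrow> a i \<in> carrier A" "\<And>i. i \<in> I - K \<Longrightarrow> f (a i) = zcomb B I y (c i)"
    by metis
  have "zindep A (I - K) a"
    unfolding zindep_def
  proof (intro conjI allI impI ballI)
    show "finite (I - K)" using fI by simp
    show "a \<in> I - K \<rightarrow> carrier A" using ca(3) by auto
    fix e i assume e: "zcomb A (I - K) a e = \<one>\<^bsub>A\<^esub>" and i: "i \<in> I - K"
    have aA: "a \<in> I - K \<rightarrow> carrier A" using ca(3) by blast
    have "\<one>\<^bsub>B\<^esub> = f (zcomb A (I - K) a e)"
      using e assms(1,2,4) by (simp add: hom_one comm_group.axioms(2))
    also have "\<dots> = zcomb B (I - K) (f \<circ> a) e"
      by (rule hom_zcomb[OF assms(1,2,4) aA]) (use fI in simp)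
    also have "\<dots> = zcomb B (I - K) (\<lambda>i. zcomb B I y (c i)) e"
      using ca(4) yB by (intro B.zcomb_cong) auto
    also have "\<dots> = zcomb B I y (\<lambda>j. \<Sum>i\<in>I - K. e i * c i j)"
      using fI yB by (intro B.zcomb_zcomb) auto
    finally have "zcomb B I y (\<lambda>j. \<Sum>k\<in>I - K. e k * c k j) = \<one>\<^bsub>B\<^esub>" by (rule sym)
    moreover have "\<forall>c. zcomb B I y c = \<one>\<^bsub>B\<^esub> \<longrightarrow> (\<forall>i\<in>I. c i = 0)" using y by (simp add: zindep_def)
    ultimately have "\<forall>i\<in>I. (\<Sum>k\<in>I - K. e k * c k i) = 0" by blast
    then have "(\<Sum>k\<in>I - K. e k * c k i) = 0" using i by blast
    \<comment> \<open>Outside \<open>K\<close> the relation of index \<open>k\<close> involves only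
      \<open>k\<close> itself, so the coefficient matrix on \<open>I - K\<close> is diagonal with
      nonzero diagonal.\<close>
    moreover have "(\<Sum>k\<in>I - K. e k * c k i) = e i * c i i"
    proof -
      have "(\<Sum>k\<in>I - K. e k * c k i) = (\<Sum>k\<in>I - K. if k = i then e k * c k i else 0)"
        using ca(2)[of _ i] i by (intro sum.cong) auto
      then show ?thesis using fI i by simp
    qed
    ultimately show "e i = 0" using ca(1)[OF i] by simp
  qed
  then have "card (I - K) \<le> r" by (rule rank_leD[OF assms(1,7)])
  moreover have "card K \<le> s" using K(1) rank_leD[OF assms(3,8)] by blast
  ultimately show "card I \<le> r + s" using K(1) fI fK card_Diff_subset[of K I] by simp
qed

lemma rank_le_mono: "rank_le G r \<Longrightarrow> r \<le> s \<Longrightarrow> rank_le G s"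
  unfolding rank_le_def by (meson le_trans)

lemma rank_le_trivial:
  assumes "trivial_group G"
  shows "rank_le G r"
proof -
  have G: "comm_group G"
    using assms by (intro group.group_comm_groupI) (auto simp: trivial_group_def)
  interpret comm_group G by fact
  have "carrier G = generate G ((\<lambda>_. \<one>\<^bsub>G\<^esub>) ` ({} :: nat set))"
    using assms by (simp add: trivial_group_def generate_empty)
  then have "rank_le G (card ({} :: nat set))" by (intro rank_le_generate[OF G]) auto
  then show ?thesis by (rule rank_le_mono) simp
qed

subsection \<open>Factorization of injections\<close>

text \<open>The shift by one reconciles lists, indexed from 0, with the objects of FI, which start
  at 1.\<close>

definition list_fun :: "nat \<Rightarrow> nat list \<Rightarrow> nat \<Rightarrow> nat" where
  "list_fun k xs = (\<lambda>i\<in>{1..k}. xs ! (i - 1))"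

lemma OI_subset_FI_hom: "OI m n \<subseteq> FI_hom m n"
  by (auto simp: OI_def FI_hom_def strict_mono_on_imp_inj_on)

lemma OI_FI_hom: "f \<in> OI m n \<Longrightarrow> f \<in> FI_hom m n"
  using OI_subset_FI_hom by blast

lemma finite_FI_hom [simp]: "finite (FI_hom m n)"
  by (rule finite_subset[of _ "{1..m} \<rightarrow>\<^sub>E {1..n}"]) (auto simp: FI_hom_def intro!: finite_PiE)

lemma FI_id_in: "FI_id n \<in> FI_hom n n"
  by (auto simp: FI_hom_def FI_id_def inj_on_def)

lemma FI_comp_in: "f \<in> FI_hom l m \<Longrightarrow> g \<in> FI_hom m n \<Longrightarrow> FI_comp l g f \<in> FI_hom l n"
proof -
  assume f: "f \<in> FI_hom l m" and g: "g \<in> FI_hom m n"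
  have im: "f ` {1..l} \<subseteq> {1..m}" "g ` {1..m} \<subseteq> {1..n}"
    using f g unfolding FI_hom_def PiE_iff mem_Collect_eq image_subset_iff by blast+
  have "inj_on (g \<circ> f) {1..l}"
    by (rule comp_inj_on[OF _ inj_on_subset[OF _ im(1)]]) (use f g in \<open>simp_all add: FI_hom_def\<close>)
  moreover have "inj_on (FI_comp l g f) {1..l} \<longleftrightarrow> inj_on (g \<circ> f) {1..l}"
    by (rule inj_on_cong) (simp add: FI_comp_def compose_def)
  ultimately have "inj_on (FI_comp l g f) {1..l}" by (rule iffD2[rotated])
  moreover have "FI_comp l g f \<in> {1..l} \<rightarrow>\<^sub>E {1..n}"
  proof (rule PiE_I)
    fix i assume i: "i \<in> {1..l}"
    then have "g (f i) \<in> {1..n}" using im by blast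
    then show "FI_comp l g f i \<in> {1..n}" using i by (simp add: FI_comp_def compose_def)
  qed (auto simp: FI_comp_def compose_def)
  ultimately show ?thesis by (simp add: FI_hom_def)
qed

lemma list_fun_OI: "xs \<in> inc_lists k 0 n \<Longrightarrow> list_fun k xs \<in> OI k n"
proof -
  assume xs: "xs \<in> inc_lists k 0 n"
  have "xs ! (i - 1) \<in> {1..n}" if "i \<in> {1..k}" for i
  proof -
    have "xs ! (i - 1) \<in> set xs" using xs that by (intro nth_mem) (auto simp: inc_lists_def)
    then show ?thesis using xs by (auto simp: inc_lists_def)
  qed
  moreover have "strict_mono_on {1..k} (list_fun k xs)"
  proof (rule strict_mono_onI)
    fix r s assume "r \<in> {1..k}" "s \<in> {1..k}" "r < s"
    then show "list_fun k xs r < list_fun k xs s"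
      using xs sorted_wrt_nth_less[of "(<)" xs "r - 1" "s - 1"] by (auto simp: list_fun_def inc_lists_def)
  qed
  ultimately show ?thesis by (auto simp: OI_def list_fun_def)
qed

lemma list_fun_map:
  assumes "xs \<in> inc_lists k 0 n"
  shows "list_fun k (map g xs) = FI_comp k g (list_fun k xs)"
  using assms by (auto simp: list_fun_def FI_comp_def compose_def inc_lists_def fun_eq_iff)

text \<open>Sorting the image of \<open>f\<close> gives the increasing part; the permutation records
  the order in which \<open>f\<close> visits the image.\<close>

lemma FI_factor:
  assumes f: "f \<in> FI_hom k n"
  obtains xs \<sigma> where "xs \<in> inc_lists k 0 n" "\<sigma> \<in> FI_hom k k" "f = FI_comp k (list_fun k xs) \<sigma>"
proof -
  let ?A = "f ` {1..k}"
  have inj: "inj_on f {1..k}" and fim: "?A \<subseteq> {1..n}" and ext: "f \<in> extensional {1..k}"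
    using f by (auto simp: FI_hom_def PiE_def)
  define xs where "xs = sorted_list_of_set ?A"
  have len: "length xs = k" and setxs: "set xs = ?A"
    using inj by (simp_all add: xs_def card_image)
  have xs: "xs \<in> inc_lists k 0 n"
    using len setxs fim by (auto simp: inc_lists_def xs_def)
  let ?g = "list_fun k xs"
  have g: "?g \<in> OI k n" by (rule list_fun_OI[OF xs])
  have ginj: "inj_on ?g {1..k}" using g OI_subset_FI_hom by (auto simp: FI_hom_def)
  have gim: "?g ` {1..k} = ?A"
  proof -
    have "?g ` {1..k} \<subseteq> ?A"
    proof
      fix y assume "y \<in> ?g ` {1..k}"
      then obtain i where "i \<in> {1..k}" "y = xs ! (i - 1)" by (auto simp: list_fun_def)
      then have "y \<in> set xs" using len by auto
      then show "y \<in> ?A" using setxs by simp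
    qed
    moreover have "card (?g ` {1..k}) = card ?A" using ginj inj by (simp add: card_image)
    ultimately show ?thesis by (intro card_subset_eq) auto
  qed
  define \<sigma> where "\<sigma> = (\<lambda>i\<in>{1..k}. the_inv_into {1..k} ?g (f i))"
  have s: "\<sigma> i \<in> {1..k}" "?g (\<sigma> i) = f i" if "i \<in> {1..k}" for i
  proof -
    have "f i \<in> ?g ` {1..k}" using that gim by auto
    then show "\<sigma> i \<in> {1..k}" "?g (\<sigma> i) = f i"
      using that the_inv_into_into[OF ginj, of "f i" "{1..k}"] f_the_inv_into_f[OF ginj, of "f i"]
      by (simp_all add: \<sigma>_def)
  qed
  have "inj_on \<sigma> {1..k}"
  proof (rule inj_onI)
    fix i j assume "i \<in> {1..k}" "j \<in> {1..k}" "\<sigma> i = \<sigma> j"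
    then have "f i = f j" using s(2)[of i] s(2)[of j] by simp
    then show "i = j" using inj \<open>i \<in> {1..k}\<close> \<open>j \<in> {1..k}\<close> by (auto dest: inj_onD)
  qed
  moreover have "\<sigma> \<in> {1..k} \<rightarrow>\<^sub>E {1..k}"
  proof (rule PiE_I)
    show "\<sigma> i \<in> {1..k}" if "i \<in> {1..k}" for i by (rule s(1)[OF that])
    show "\<sigma> i = undefined" if "i \<notin> {1..k}" for i using that unfolding \<sigma>_def restrict_def by (rule if_not_P)
  qed
  ultimately have "\<sigma> \<in> FI_hom k k" by (simp add: FI_hom_def)
  moreover have "f = FI_comp k ?g \<sigma>"
  proof
    fix i show "f i = FI_comp k ?g \<sigma> i"
      using s(2)[of i] ext by (cases "i \<in> {1..k}") (auto simp: FI_comp_def compose_def extensional_def)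
  qed
  ultimately show thesis using that xs by blast
qed

subsection \<open>Finitely generated FI-modules\<close>

text \<open>One application of transition maps followed by one generated subgroup is enough to
  obtain a submodule, because transition maps compose and are homomorphisms.\<close>

definition FI_span :: "(nat \<times> 'a) set \<Rightarrow> (nat \<Rightarrow> 'a monoid) \<Rightarrow>
    (nat \<Rightarrow> nat \<Rightarrow> (nat \<Rightarrow> nat) \<Rightarrow> 'a \<Rightarrow> 'a) \<Rightarrow> nat \<Rightarrow> 'a set" where
  "FI_span S V F n = generate (V n) {F k n f x | k x f. (k, x) \<in> S \<and> f \<in> FI_hom k n}"

lemma FI_module_closed:
  "FI_module V F \<Longrightarrow> f \<in> FI_hom m n \<Longrightarrow> x \<in> carrier (V m) \<Longrightarrow> F m n f x \<in> carrier (V n)"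
  using FI_module.hom by (fastforce simp: hom_def)

lemma FI_submodule_image:
  assumes "FI_module V F" "\<And>n. subgroup (W n) (V n)" "\<And>m n f x. f \<in> FI_hom m n \<Longrightarrow> x \<in> W m \<Longrightarrow> F m n f x \<in> W n"
  shows "FI_submodule W V F"
  using assms by (auto simp: FI_submodule_def)

lemma FI_span_submodule:
  assumes V: "FI_module V F" and S: "S \<subseteq> (SIGMA n:UNIV. carrier (V n))"
  shows "FI_submodule (FI_span S V F) V F"
proof (rule FI_submodule_image[OF V])
  have gr: "Group.group (V n)" for n using FI_module.group[OF V] by (rule comm_group.axioms)
  let ?gen = "\<lambda>n. {F k n f x | k x f. (k, x) \<in> S \<and> f \<in> FI_hom k n}"
  have sub: "?gen n \<subseteq> carrier (V n)" for n using S FI_module_closed[OF V] by auto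
  show sg: "subgroup (FI_span S V F n) (V n)" for n
    unfolding FI_span_def by (rule group.generate_is_subgroup[OF gr sub])
  fix m n f x assume f: "f \<in> FI_hom m n" and x: "x \<in> FI_span S V F m"
  interpret h: group_hom "V m" "V n" "F m n f"
    using gr FI_module.hom[OF V f] by (intro group_hom.intro group_hom_axioms.intro)
  have "F m n f ` FI_span S V F m = generate (V n) (F m n f ` ?gen m)"
    unfolding FI_span_def using h.generate_img[OF sub] by simp
  also have "\<dots> \<subseteq> FI_span S V F n"
  proof (rule group.generate_subgroup_incl[OF gr _ sg])
    show "F m n f ` ?gen m \<subseteq> FI_span S V F n"
    proof clarify
      fix k x g assume kx: "(k, x) \<in> S" "g \<in> FI_hom k m"
      have "F m n f (F k m g x) = F k n (FI_comp k f g) x"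
        using FI_module.comp[OF V kx(2) f] kx S by auto
      then show "F m n f (F k m g x) \<in> FI_span S V F n"
        unfolding FI_span_def using kx FI_comp_in[OF kx(2) f] by (intro generate.incl) auto
    qed
  qed
  finally show "F m n f x \<in> FI_span S V F n" using x by auto
qed

lemma FI_span_incl:
  assumes "FI_module V F" "S \<subseteq> (SIGMA n:UNIV. carrier (V n))" "(n, x) \<in> S"
  shows "x \<in> FI_span S V F n"
proof -
  have "F n n (FI_id n) x = x" using assms by (intro FI_module.ident[OF assms(1)]) auto
  moreover have "F n n (FI_id n) x \<in> FI_span S V F n"
    unfolding FI_span_def using assms(3) FI_id_in by (intro generate.incl) blast
  ultimately show ?thesis by simp
qed

lemma FI_span_least:
  assumes "FI_module V F" "FI_submodule W V F" "\<And>n x. (n, x) \<in> S \<Longrightarrow> x \<in> W n"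
  shows "FI_span S V F n \<subseteq> W n"
proof -
  interpret comm_group "V n" by (rule FI_module.group[OF assms(1)])
  show ?thesis unfolding FI_span_def
  proof (rule generate_subgroup_incl)
    show "{F k n f x |k x f. (k, x) \<in> S \<and> f \<in> FI_hom k n} \<subseteq> W n"
    proof clarify
      fix k x f assume "(k, x) \<in> S" "f \<in> FI_hom k n"
      then have "x \<in> W k" "F k n f ` W k \<subseteq> W n" using assms(2,3) by (auto simp: FI_submodule_def)
      then show "F k n f x \<in> W n" by auto
    qed
  qed (use assms(2) in \<open>simp add: FI_submodule_def\<close>)
qed

lemma finitely_generated_iff:
  "finitely_generated_FI_module V F \<longleftrightarrow> FI_module V F \<and>
     (\<exists>S. finite S \<and> S \<subseteq> (SIGMA n:UNIV. carrier (V n)) \<and> (\<forall>n. FI_span S V F n = carrier (V n)))"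
proof
  assume *: "finitely_generated_FI_module V F"
  then have V: "FI_module V F" by (simp add: finitely_generated_FI_module_def)
  obtain S where S: "finite S" "S \<subseteq> (SIGMA n:UNIV. carrier (V n))"
    "\<And>W. FI_submodule W V F \<Longrightarrow> (\<forall>(n, x)\<in>S. x \<in> W n) \<Longrightarrow> (\<forall>n. W n = carrier (V n))"
    using * unfolding finitely_generated_FI_module_def by (elim conjE exE) auto
  have "\<forall>n. FI_span S V F n = carrier (V n)"
    by (rule S(3)) (use FI_span_submodule[OF V S(2)] FI_span_incl[OF V S(2)] in auto)
  then show "FI_module V F \<and> (\<exists>S. finite S \<and> S \<subseteq> (SIGMA n:UNIV. carrier (V n)) \<and> (\<forall>n. FI_span S V F n = carrier (V n)))"
    using V S by blast
next
  assume *: "FI_module V F \<and> (\<exists>S. finite S \<and> S \<subseteq> (SIGMA n:UNIV. carrier (V n)) \<and> (\<forall>n. FI_span S V F n = carrier (V n)))"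
  then obtain S where V: "FI_module V F" and S: "finite S" "S \<subseteq> (SIGMA n:UNIV. carrier (V n))" "\<And>n. FI_span S V F n = carrier (V n)"
    by auto
  show "finitely_generated_FI_module V F" unfolding finitely_generated_FI_module_def
  proof (intro conjI exI[of _ S] allI impI)
    fix W n assume W: "FI_submodule W V F \<and> (\<forall>(n, x)\<in>S. x \<in> W n)"
    then have "subgroup (W n) (V n)" by (simp add: FI_submodule_def)
    then have "W n \<subseteq> carrier (V n)" by (rule subgroup.subset)
    moreover have "carrier (V n) \<subseteq> W n" using FI_span_least[OF V, of W S n] W S(3)[of n] by auto
    ultimately show "W n = carrier (V n)" by simp
  qed (use V S in auto)
qed

text \<open>A finitely generated FI-module is finitely generated already under order-preserving
  injections, since permutations can be moved into the generators; it is therefore a quotient of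
  a free OI-module on finitely many generators.\<close>

locale OI_presentation =
  fixes V :: "nat \<Rightarrow> 'a monoid" and F :: "nat \<Rightarrow> nat \<Rightarrow> (nat \<Rightarrow> nat) \<Rightarrow> 'a \<Rightarrow> 'a"
    and S :: nat and \<kappa> :: "nat \<Rightarrow> nat" and x :: "nat \<Rightarrow> 'a"
  assumes FI: "FI_module V F" and x: "s < S \<Longrightarrow> x s \<in> carrier (V (\<kappa> s))"
begin

definition el :: "nat \<Rightarrow> nat list \<Rightarrow> 'a" where
  "el n m = F (\<kappa> (hd m)) n (list_fun (\<kappa> (hd m)) (tl m)) (x (hd m))"

definition ev :: "nat \<Rightarrow> (nat list \<Rightarrow> int) \<Rightarrow> 'a" where
  "ev n c = zcomb (V n) (OI_mons S \<kappa> n) (el n) c"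

abbreviation mons where "mons \<equiv> OI_mons S \<kappa>"

lemma cg: "comm_group (V n)" by (rule FI_module.group[OF FI])

lemma finite_mons [simp]: "finite (mons n)"
proof (rule finite_subset)
  show "mons n \<subseteq> (\<Union>s\<in>{..<S}. (#) s ` inc_lists (\<kappa> s) 0 n)" by (auto simp: OI_mons_def)
qed auto

lemma el_closed: "m \<in> mons n \<Longrightarrow> el n m \<in> carrier (V n)"
  unfolding el_def using x by (intro FI_module_closed[OF FI] OI_FI_hom list_fun_OI) (auto simp: OI_mons_def)

lemma el_funcset: "el n \<in> mons n \<rightarrow> carrier (V n)"
  using el_closed by auto

lemma el_act:
  assumes "m \<in> mons n" "g \<in> OI n n'"
  shows "el n' (OI_act g m) = F n n' g (el n m)"
proof -
  obtain s xs where m: "m = s # xs" "s < S" "xs \<in> inc_lists (\<kappa> s) 0 n" using assms by (auto simp: OI_mons_def)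
  then show ?thesis
    using FI_module.comp[OF FI, of "list_fun (\<kappa> s) xs" "\<kappa> s" n g n' "x s"] list_fun_OI[OF m(3)]
      OI_subset_FI_hom assms(2) x list_fun_map[OF m(3), of g]
    by (simp add: el_def OI_act_def subset_iff)
qed

lemma ev_zero: "ev n (\<lambda>_. 0) = \<one>\<^bsub>V n\<^esub>"
  unfolding ev_def by (rule comm_group.zcomb_zero[OF cg])

lemma ev_diff: "ev n (\<lambda>m. c m - d m) = ev n c \<otimes>\<^bsub>V n\<^esub> inv\<^bsub>V n\<^esub> ev n d"
  unfolding ev_def by (rule comm_group.zcomb_diff[OF cg el_funcset])

text \<open>The zero submodule is an instance whose purpose is to make the facts about
  \<open>act\<close>, \<open>push\<close> and words available here, as these do not depend on the
  submodule.\<close>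

sublocale triv: OI_submodule S \<kappa> "\<lambda>n. {\<lambda>_. 0}"
  by unfold_locales (auto simp: OI_push_def fun_eq_iff)

lemma ev_push:
  assumes g: "g \<in> OI n n'"
  shows "ev n' (OI_push S \<kappa> n g c) = F n n' g (ev n c)"
proof -
  interpret V': comm_group "V n'" by (rule cg)
  have inj: "inj_on (OI_act g) (mons n)" using triv.act_inj[OF _ _ g] by (auto intro: inj_onI)
  have im: "OI_act g ` mons n \<subseteq> mons n'" using triv.act_mons[OF _ g] by auto
  have "ev n' (OI_push S \<kappa> n g c) = zcomb (V n') (OI_act g ` mons n) (el n') (OI_push S \<kappa> n g c)"
    unfolding ev_def
  proof (rule V'.zcomb_mono_neutral[symmetric])
    fix m assume "m \<in> mons n' - OI_act g ` mons n"
    then show "OI_push S \<kappa> n g c m = 0" using triv.push_nonzero[of n g c m] by blast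
  qed (use im el_funcset in auto)
  also have "\<dots> = zcomb (V n') (mons n) (el n' \<circ> OI_act g) (OI_push S \<kappa> n g c \<circ> OI_act g)"
    using im el_closed by (intro V'.zcomb_reindex[OF inj]) auto
  also have "\<dots> = zcomb (V n') (mons n) (F n n' g \<circ> el n) c"
    using el_act[OF _ g] triv.push_act[OF _ g] el_closed im
    by (intro V'.zcomb_cong) (auto simp: FI_module_closed[OF FI] subsetD[OF OI_subset_FI_hom g])
  also have "\<dots> = F n n' g (ev n c)"
    unfolding ev_def by (intro hom_zcomb[symmetric] cg el_funcset FI_module.hom[OF FI] OI_FI_hom g finite_mons)
  finally show ?thesis .
qed

text \<open>Submodules of \<open>V\<close> are pulled back to the free module on words, where the
  Groebner argument applies. With \<open>W\<close> trivial this gives the module of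
  relations.\<close>

lemma preimage_OI_submodule:
  assumes "\<And>n. subgroup (W n) (V n)" "\<And>n n' g y. g \<in> OI n n' \<Longrightarrow> y \<in> W n \<Longrightarrow> F n n' g y \<in> W n'"
  shows "OI_submodule S \<kappa> (\<lambda>n. {c. (\<forall>m. c m \<noteq> 0 \<longrightarrow> m \<in> mons n) \<and> ev n c \<in> W n})"
proof
  show "(\<lambda>m. c m - d m) \<in> {c. (\<forall>m. c m \<noteq> 0 \<longrightarrow> m \<in> mons n) \<and> ev n c \<in> W n}"
    if "c \<in> {c. (\<forall>m. c m \<noteq> 0 \<longrightarrow> m \<in> mons n) \<and> ev n c \<in> W n}"
       "d \<in> {c. (\<forall>m. c m \<noteq> 0 \<longrightarrow> m \<in> mons n) \<and> ev n c \<in> W n}" for c d n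
    using that subgroup.m_closed[OF assms(1)] subgroup.m_inv_closed[OF assms(1)]
    by (auto simp: ev_diff) (metis diff_0_right)
  show "OI_push S \<kappa> n g c \<in> {c. (\<forall>m. c m \<noteq> 0 \<longrightarrow> m \<in> mons n') \<and> ev n' c \<in> W n'}"
    if "c \<in> {c. (\<forall>m. c m \<noteq> 0 \<longrightarrow> m \<in> mons n) \<and> ev n c \<in> W n}" "g \<in> OI n n'" for c n g n'
    using that assms(2)[OF that(2)] triv.act_mons[OF _ that(2)] by (auto simp: ev_push elim: triv.push_nonzero)
qed (use subgroup.one_closed[OF assms(1)] in \<open>auto simp: ev_zero\<close>)

end

lemma OI_presentation_exists:
  assumes "finitely_generated_FI_module V F"
  obtains S \<kappa> x where "OI_presentation V F S \<kappa> x"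
    "\<And>n y. y \<in> carrier (V n) \<Longrightarrow> \<exists>c. (\<forall>m. c m \<noteq> 0 \<longrightarrow> m \<in> OI_mons S \<kappa> n) \<and> y = OI_presentation.ev V F S \<kappa> x n c"
proof -
  obtain S0 where V: "FI_module V F" and S0: "finite S0" "S0 \<subseteq> (SIGMA n:UNIV. carrier (V n))"
      "\<And>n. FI_span S0 V F n = carrier (V n)"
    using assms unfolding finitely_generated_iff by blast
  \<comment> \<open>All permuted copies of the generators are added, finitely many because
    \<open>FI_hom k k\<close> is finite. After \<open>FI_factor\<close> only increasing maps remain
    to be applied.\<close>
  define S1 where "S1 = (\<Union>(k, y)\<in>S0. (\<lambda>\<sigma>. (k, F k k \<sigma> y)) ` FI_hom k k)"
  have "finite S1" unfolding S1_def using S0(1) by auto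
  then obtain l where l: "set l = S1" using finite_list by blast
  define \<kappa> x where "\<kappa> s = fst (l ! s)" and "x s = snd (l ! s)" for s
  have S1: "y \<in> carrier (V k)" if "(k, y) \<in> S1" for k y
    using that S0(2) FI_module_closed[OF V] unfolding S1_def by auto
  interpret OI_presentation V F "length l" \<kappa> x
  proof (rule OI_presentation.intro[OF V])
    fix s assume "s < length l"
    then have "(\<kappa> s, x s) \<in> S1" using l nth_mem by (fastforce simp: \<kappa>_def x_def)
    then show "x s \<in> carrier (V (\<kappa> s))" by (rule S1)
  qed
  have "y \<in> range (ev n)" if "y \<in> carrier (V n)" for n y
  proof -
    interpret Vn: comm_group "V n" by (rule cg)
    have "subgroup (range (ev n)) (V n)"
    proof (rule Vn.subgroupI)
      show "range (ev n) \<subseteq> carrier (V n)" using Vn.zcomb_closed[OF el_funcset] by (auto simp: ev_def)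
      show "inv\<^bsub>V n\<^esub> a \<in> range (ev n)" if "a \<in> range (ev n)" for a
      proof -
        obtain c where "a = ev n c" using \<open>a \<in> range (ev n)\<close> by blast
        then have "inv\<^bsub>V n\<^esub> a = ev n (\<lambda>m. - c m)"
          using Vn.zcomb_uminus[OF el_funcset, of c] by (simp add: ev_def)
        then show ?thesis by (simp only: rangeI)
      qed
      show "a \<otimes>\<^bsub>V n\<^esub> b \<in> range (ev n)" if "a \<in> range (ev n)" "b \<in> range (ev n)" for a b
      proof -
        obtain c where "a = ev n c" using \<open>a \<in> range (ev n)\<close> by (elim imageE)
        moreover obtain d where "b = ev n d" using \<open>b \<in> range (ev n)\<close> by (elim imageE)
        ultimately have "a \<otimes>\<^bsub>V n\<^esub> b = ev n (\<lambda>m. c m + d m)"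
          using Vn.zcomb_add[OF el_funcset, of c d] by (simp add: ev_def)
        then show ?thesis by (simp only: rangeI)
      qed
    qed auto
    moreover have "{F k n f y | k y f. (k, y) \<in> S0 \<and> f \<in> FI_hom k n} \<subseteq> range (ev n)"
    proof clarify
      fix k y f assume ky: "(k, y) \<in> S0" and f: "f \<in> FI_hom k n"
      obtain xs \<sigma> where xs: "xs \<in> inc_lists k 0 n" "\<sigma> \<in> FI_hom k k" "f = FI_comp k (list_fun k xs) \<sigma>"
        by (rule FI_factor[OF f])
      have "(k, F k k \<sigma> y) \<in> set l" unfolding l S1_def using ky xs(2) by auto
      then obtain s where s: "s < length l" "l ! s = (k, F k k \<sigma> y)" by (auto simp: in_set_conv_nth)
      have k: "\<kappa> s = k" and xk: "x s = F k k \<sigma> y" using s by (simp_all add: \<kappa>_def x_def)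
      have m: "s # xs \<in> mons n" using s xs k by (simp add: OI_mons_def)
      have "F k n f y = el n (s # xs)"
        using FI_module.comp[OF V xs(2), of "list_fun k xs" n y] xs list_fun_OI[OF xs(1)] OI_subset_FI_hom S0(2) ky
        by (auto simp: el_def k xk)
      also have "\<dots> = ev n (\<lambda>m. if m = s # xs then 1 else 0)"
        unfolding ev_def using Vn.zcomb_singleton[OF finite_mons el_funcset m, of 1] el_closed[OF m] by simp
      finally show "F k n f y \<in> range (ev n)" by simp
    qed
    ultimately have "carrier (V n) \<subseteq> range (ev n)"
      unfolding S0(3)[of n, symmetric] FI_span_def by (intro Vn.generate_subgroup_incl)
    then show ?thesis using that by auto
  qed note surj = this
  have "\<exists>c. (\<forall>m. c m \<noteq> 0 \<longrightarrow> m \<in> mons n) \<and> y = ev n c" if y: "y \<in> carrier (V n)" for n y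
  proof -
    interpret Vn: comm_group "V n" by (rule cg)
    obtain c where c: "y = ev n c" using surj[OF y] by blast
    have "ev n c = ev n (\<lambda>m. if m \<in> mons n then c m else 0)"
      unfolding ev_def by (rule Vn.zcomb_cong[OF el_funcset]) auto
    then show ?thesis using c by (intro exI[of _ "\<lambda>m. if m \<in> mons n then c m else 0"]) auto
  qed
  then show thesis using that OI_presentation_axioms by blast
qed

text \<open>The preimage of \<open>W\<close> in the free module is generated under increasing maps
  by a finite \<open>T\<close>. The images of \<open>T\<close> then generate \<open>W\<close>, and
  increasing maps are among all injections.\<close>

theorem FI_Noetherian:
  assumes fg: "finitely_generated_FI_module V F" and W: "FI_submodule W V F"
  obtains T where "finite T" "T \<subseteq> (SIGMA n:UNIV. W n)" "\<And>n. W n \<subseteq> FI_span T V F n"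
proof -
  have V: "FI_module V F" using fg by (simp add: finitely_generated_FI_module_def)
  obtain S \<kappa> x where P: "OI_presentation V F S \<kappa> x"
    and surj: "\<And>n y. y \<in> carrier (V n) \<Longrightarrow> \<exists>c. (\<forall>m. c m \<noteq> 0 \<longrightarrow> m \<in> OI_mons S \<kappa> n) \<and> y = OI_presentation.ev V F S \<kappa> x n c"
    using OI_presentation_exists[OF fg] by metis
  interpret P: OI_presentation V F S \<kappa> x by (rule P)
  define pre where "pre W n = {c. (\<forall>m. c m \<noteq> 0 \<longrightarrow> m \<in> OI_mons S \<kappa> n) \<and> P.ev n c \<in> W n}" for W n
  have sub: "OI_submodule S \<kappa> (pre Q)" if "FI_submodule Q V F" for Q
    unfolding pre_def
  proof (rule P.preimage_OI_submodule)
    show "subgroup (Q n) (V n)" for n using that by (simp add: FI_submodule_def)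
    fix n n' g y assume g: "g \<in> OI n n'" and y: "y \<in> Q n"
    have "F n n' g ` Q n \<subseteq> Q n'" using that OI_FI_hom[OF g] by (simp add: FI_submodule_def)
    then show "F n n' g y \<in> Q n'" using y by blast
  qed
  interpret U: OI_submodule S \<kappa> "pre W" by (rule sub[OF W])
  obtain T where T: "finite T" "T \<subseteq> (SIGMA n:UNIV. pre W n)"
    "\<And>Q. OI_submodule S \<kappa> Q \<Longrightarrow> T \<subseteq> Sigma UNIV Q \<Longrightarrow> \<forall>n. pre W n \<subseteq> Q n"
    using U.finitely_generated by blast
  define T' where "T' = (\<lambda>(n, c). (n, P.ev n c)) ` T"
  show thesis
  proof (rule that[of T'])
    show "finite T'" using T(1) by (simp add: T'_def)
    show T'W: "T' \<subseteq> (SIGMA n:UNIV. W n)" using T(2) by (auto simp: T'_def pre_def)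
    have T'V: "T' \<subseteq> (SIGMA n:UNIV. carrier (V n))"
      using T'W W subgroup.subset by (fastforce simp: FI_submodule_def)
    have Q: "FI_submodule (FI_span T' V F) V F" by (rule FI_span_submodule[OF V T'V])
    have "c \<in> pre (FI_span T' V F) n" if "(n, c) \<in> T" for n c
      using that T(2) FI_span_incl[OF V T'V, of n "P.ev n c"] by (force simp: T'_def pre_def)
    \<comment> \<open>The preimage of the span of \<open>T'\<close> is again a submodule of the free
      module and contains \<open>T\<close>, so it contains the whole preimage of
      \<open>W\<close>.\<close>
    then have *: "\<forall>n. pre W n \<subseteq> pre (FI_span T' V F) n"
      by (intro T(3) sub[OF Q]) auto
    show "W n \<subseteq> FI_span T' V F n" for n
    proof
      fix y assume y: "y \<in> W n"
      then have "y \<in> carrier (V n)" using W subgroup.subset by (fastforce simp: FI_submodule_def)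
      then obtain c where c: "\<forall>m. c m \<noteq> 0 \<longrightarrow> m \<in> OI_mons S \<kappa> n" "y = P.ev n c" using surj by blast
      then have "c \<in> pre W n" using y by (simp add: pre_def)
      then have "c \<in> pre (FI_span T' V F) n" using * by blast
      then show "y \<in> FI_span T' V F n" using c by (simp add: pre_def)
    qed
  qed
qed

text \<open>The standard words of the relation module map to a maximal independent family:
  \<open>Std_independent\<close> excludes relations, and \<open>Std_spans\<close> expresses a
  nonzero multiple of every element.\<close>

theorem rank_evpoly:
  assumes fg: "finitely_generated_FI_module V F"
  obtains r where "\<And>n. has_rank (V n) (r n)" "evpoly (\<lambda>n. real (r n))"
proof -
  have V: "FI_module V F" using fg by (simp add: finitely_generated_FI_module_def)
  obtain S \<kappa> x where P: "OI_presentation V F S \<kappa> x"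
    and surj: "\<And>n y. y \<in> carrier (V n) \<Longrightarrow> \<exists>c. (\<forall>m. c m \<noteq> 0 \<longrightarrow> m \<in> OI_mons S \<kappa> n) \<and> y = OI_presentation.ev V F S \<kappa> x n c"
    using OI_presentation_exists[OF fg] by metis
  interpret P: OI_presentation V F S \<kappa> x by (rule P)
  have gr: "Group.group (V n)" for n by (rule comm_group.axioms(2)[OF P.cg])
  have Fone: "F n n' g \<one>\<^bsub>V n\<^esub> = \<one>\<^bsub>V n'\<^esub>" if "g \<in> OI n n'" for n n' g
    by (rule hom_one[OF FI_module.hom[OF V OI_FI_hom[OF that]] gr gr])
  define K where "K = (\<lambda>n. {c. (\<forall>m. c m \<noteq> 0 \<longrightarrow> m \<in> P.mons n) \<and> P.ev n c \<in> {\<one>\<^bsub>V n\<^esub>}})"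
  interpret U: OI_submodule S \<kappa> K
    unfolding K_def by (rule P.preimage_OI_submodule) (auto simp: Fone group.triv_subgroup[OF gr])
  have Std: "U.Std n \<subseteq> P.mons n" for n unfolding U.Std_def by (rule Diff_subset)
  have fin: "finite (U.Std n)" for n by (rule finite_subset[OF Std P.finite_mons])
  have el: "P.el n \<in> U.Std n \<rightarrow> carrier (V n)" for n using Std P.el_closed by blast
  have evS: "zcomb (V n) (U.Std n) (P.el n) c = P.ev n c" if "\<And>m. c m \<noteq> 0 \<Longrightarrow> m \<in> U.Std n" for n c
    unfolding P.ev_def
    by (rule comm_group.zcomb_mono_neutral[OF P.cg P.finite_mons Std P.el_funcset]) (use that in blast)
  have "has_rank (V n) (card (U.Std n))" for n
  proof (rule has_rankI[OF P.cg])
    interpret Vn: comm_group "V n" by (rule P.cg)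
    show "zindep (V n) (U.Std n) (P.el n)" unfolding zindep_def
    proof (intro conjI allI impI ballI fin el)
      fix c m assume c: "zcomb (V n) (U.Std n) (P.el n) c = \<one>\<^bsub>V n\<^esub>" and m: "m \<in> U.Std n"
      let ?c = "\<lambda>m. if m \<in> U.Std n then c m else 0"
      have "zcomb (V n) (U.Std n) (P.el n) c = zcomb (V n) (U.Std n) (P.el n) ?c"
        by (intro Vn.zcomb_cong el) auto
      also have "\<dots> = P.ev n ?c" by (rule evS) (auto split: if_splits)
      finally have "P.ev n ?c = \<one>\<^bsub>V n\<^esub>" using c by simp
      then have "?c \<in> K n" using Std by (auto simp: K_def)
      then have "?c m = 0" by (rule U.Std_independent) (auto split: if_splits)
      then show "c m = 0" using m by simp
    qed
    fix y assume "y \<in> carrier (V n)"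
    then obtain c where c: "\<forall>m. c m \<noteq> 0 \<longrightarrow> m \<in> P.mons n" "y = P.ev n c" using surj by blast
    obtain N d where Nd: "N \<noteq> 0" "\<forall>m. d m \<noteq> 0 \<longrightarrow> m \<in> U.Std n" "P.ev n (\<lambda>m. N * c m - d m) = \<one>\<^bsub>V n\<^esub>"
      using U.Std_spans[of c n] c(1) unfolding K_def by auto
    have cl: "P.ev n c' \<in> carrier (V n)" for c' unfolding P.ev_def by (rule Vn.zcomb_closed[OF P.el_funcset])
    have "P.ev n (\<lambda>m. N * c m) \<otimes>\<^bsub>V n\<^esub> inv\<^bsub>V n\<^esub> P.ev n d = \<one>\<^bsub>V n\<^esub>" using Nd(3) by (simp add: P.ev_diff)
    then have "P.ev n (\<lambda>m. N * c m) = P.ev n d" using cl Vn.inv_equality Vn.inv_inv Vn.inv_closed by metis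
    moreover have "P.ev n (\<lambda>m. N * c m) = y [^]\<^bsub>V n\<^esub> N"
      unfolding c(2) P.ev_def by (rule Vn.zcomb_scale[OF P.el_funcset])
    ultimately show "\<exists>N c. N \<noteq> 0 \<and> y [^]\<^bsub>V n\<^esub> (N::int) = zcomb (V n) (U.Std n) (P.el n) c"
      using Nd(1,2) evS[of d n] by (intro exI[of _ N] exI[of _ d]) simp
  qed
  then show thesis using U.evpoly_Std that[of "\<lambda>n. card (U.Std n)"] by blast
qed

text \<open>The case \<open>n = 0\<close> is excluded because the bound would be 0 there whenever
  \<open>D\<close> is positive.\<close>

definition FI_growth :: "(nat \<Rightarrow> 'a monoid) \<Rightarrow> (nat \<Rightarrow> nat \<Rightarrow> (nat \<Rightarrow> nat) \<Rightarrow> 'a \<Rightarrow> 'a) \<Rightarrow> nat \<Rightarrow> bool" where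
  "FI_growth V F D \<longleftrightarrow> finitely_generated_FI_module V F \<and>
     (\<exists>C::nat. \<forall>n\<ge>1. rank_le (V n) (C * n ^ D))"

lemma FI_growthD: "FI_growth V F D \<Longrightarrow> FI_module V F"
  by (simp add: FI_growth_def finitely_generated_FI_module_def)

lemma FI_submodule_mem:
  "FI_submodule W V F \<Longrightarrow> f \<in> FI_hom m n \<Longrightarrow> x \<in> W m \<Longrightarrow> F m n f x \<in> W n"
  unfolding FI_submodule_def by blast

lemma FI_submodule_subset: "FI_submodule W V F \<Longrightarrow> W n \<subseteq> carrier (V n)"
  unfolding FI_submodule_def by (intro subgroup.subset) blast

text \<open>The module \<open>B\<close> is generated by the images of generators of \<open>A\<close>
  together with lifts of generators of its image in \<open>C\<close>. Ranks add along the
  sequence.\<close>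

theorem FI_growth_exact:
  assumes A: "FI_growth A FA D" and C: "FI_growth C FC D" and B: "FI_module B FB"
    and \<alpha>: "\<And>n. \<alpha> n \<in> hom (A n) (B n)" and \<beta>: "\<And>n. \<beta> n \<in> hom (B n) (C n)"
    and nat\<alpha>: "\<And>m n f x. f \<in> FI_hom m n \<Longrightarrow> x \<in> carrier (A m) \<Longrightarrow> \<alpha> n (FA m n f x) = FB m n f (\<alpha> m x)"
    and nat\<beta>: "\<And>m n f x. f \<in> FI_hom m n \<Longrightarrow> x \<in> carrier (B m) \<Longrightarrow> \<beta> n (FB m n f x) = FC m n f (\<beta> m x)"
    and ex: "\<And>n b. b \<in> carrier (B n) \<Longrightarrow> \<beta> n b = \<one>\<^bsub>C n\<^esub> \<Longrightarrow> b \<in> \<alpha> n ` carrier (A n)"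
  shows "FI_growth B FB D"
proof -
  have FA: "FI_module A FA" and FC: "FI_module C FC" using FI_growthD[OF A] FI_growthD[OF C] by auto
  have gA: "comm_group (A n)" and gB: "comm_group (B n)" and gC: "comm_group (C n)" for n
    using FI_module.group[OF FA] FI_module.group[OF B] FI_module.group[OF FC] by auto
  interpret A: comm_group "A n" for n by (rule gA)
  interpret B: comm_group "B n" for n by (rule gB)
  interpret C: comm_group "C n" for n by (rule gC)
  interpret \<alpha>: group_hom "A n" "B n" "\<alpha> n" for n using \<alpha> by unfold_locales
  interpret \<beta>: group_hom "B n" "C n" "\<beta> n" for n using \<beta> by unfold_locales
  have sub\<beta>: "FI_submodule (\<lambda>n. \<beta> n ` Q n) C FC" if Q: "FI_submodule Q B FB" for Q
  proof (rule FI_submodule_image[OF FC])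
    show "subgroup (\<beta> n ` Q n) (C n)" for n
      using Q by (intro \<beta>.subgroup_img_is_subgroup) (simp add: FI_submodule_def)
    fix m n f y assume f: "f \<in> FI_hom m n" and "y \<in> \<beta> m ` Q m"
    then obtain x where x: "x \<in> Q m" "y = \<beta> m x" by auto
    then have "FC m n f y = \<beta> n (FB m n f x)"
      using nat\<beta>[OF f, of x] FI_submodule_subset[OF Q, of m] by auto
    then show "FC m n f y \<in> \<beta> n ` Q n" using FI_submodule_mem[OF Q f x(1)] by simp
  qed
  have sub\<alpha>: "FI_submodule (\<lambda>n. {a \<in> carrier (A n). \<alpha> n a \<in> Q n}) A FA" if Q: "FI_submodule Q B FB" for Q
  proof (rule FI_submodule_image[OF FA])
    have sg: "subgroup (Q n) (B n)" for n using Q by (simp add: FI_submodule_def)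
    show "subgroup {a \<in> carrier (A n). \<alpha> n a \<in> Q n} (A n)" for n
    proof (rule A.subgroupI)
      show "{a \<in> carrier (A n). \<alpha> n a \<in> Q n} \<noteq> {}"
        using subgroup.one_closed[OF sg[of n]] \<alpha>.hom_one[of n] A.one_closed by fastforce
    qed (use subgroup.m_closed[OF sg] subgroup.m_inv_closed[OF sg] in auto)
    fix m n f y assume f: "f \<in> FI_hom m n" and y: "y \<in> {a \<in> carrier (A m). \<alpha> m a \<in> Q m}"
    then show "FA m n f y \<in> {a \<in> carrier (A n). \<alpha> n a \<in> Q n}"
      using nat\<alpha>[OF f] FI_submodule_mem[OF Q f] FI_module_closed[OF FA f] by simp
  qed
  obtain SA where SA: "finite SA" "SA \<subseteq> (SIGMA n:UNIV. carrier (A n))" "\<And>n. FI_span SA A FA n = carrier (A n)"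
    using A unfolding FI_growth_def finitely_generated_iff by blast
  have BB: "FI_submodule (\<lambda>n. carrier (B n)) B FB"
    using FI_module_closed[OF B] by (intro FI_submodule_image[OF B]) (auto simp: B.subgroup_self)
  \<comment> \<open>The image of \<open>B\<close> need not be all of \<open>C\<close>, so its finite
    generation is the Noetherian property of \<open>C\<close>.\<close>
  obtain T where T: "finite T" "T \<subseteq> (SIGMA n:UNIV. \<beta> n ` carrier (B n))"
      "\<And>n. \<beta> n ` carrier (B n) \<subseteq> FI_span T C FC n"
    using FI_Noetherian[OF _ sub\<beta>[OF BB]] C unfolding FI_growth_def by blast
  have "\<forall>t\<in>T. \<exists>b. b \<in> carrier (B (fst t)) \<and> snd t = \<beta> (fst t) b"
  proof
    fix t assume "t \<in> T"
    then have "snd t \<in> \<beta> (fst t) ` carrier (B (fst t))" using T(2) by (cases t) auto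
    then show "\<exists>b. b \<in> carrier (B (fst t)) \<and> snd t = \<beta> (fst t) b" by (elim imageE) blast
  qed
  then obtain l where l: "\<And>t. t \<in> T \<Longrightarrow> l t \<in> carrier (B (fst t)) \<and> snd t = \<beta> (fst t) (l t)"
    unfolding bchoice_iff by blast
  define S where "S = (\<lambda>(n, a). (n, \<alpha> n a)) ` SA \<union> (\<lambda>t. (fst t, l t)) ` T"
  have S: "finite S" "S \<subseteq> (SIGMA n:UNIV. carrier (B n))"
    using SA(1,2) T(1) l by (auto simp: S_def)
  let ?Q = "FI_span S B FB"
  have Q: "FI_submodule ?Q B FB" by (rule FI_span_submodule[OF B S(2)])
  have Qsub: "subgroup (?Q n) (B n)" for n using Q by (simp add: FI_submodule_def)
  have 1: "\<alpha> n a \<in> ?Q n" if "a \<in> carrier (A n)" for n a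
  proof -
    have "x \<in> {a \<in> carrier (A k). \<alpha> k a \<in> ?Q k}" if kx: "(k, x) \<in> SA" for k x
    proof -
      have "(k, \<alpha> k x) \<in> S" unfolding S_def using kx by force
      then show ?thesis using FI_span_incl[OF B S(2)] SA(2) kx by auto
    qed
    then have "FI_span SA A FA n \<subseteq> {a \<in> carrier (A n). \<alpha> n a \<in> ?Q n}"
      by (intro FI_span_least[OF FA sub\<alpha>[OF Q]])
    then show ?thesis using that SA(3)[of n] by auto
  qed
  have 2: "\<beta> n ` carrier (B n) \<subseteq> \<beta> n ` ?Q n" for n
  proof -
    have "x \<in> \<beta> k ` ?Q k" if kx: "(k, x) \<in> T" for k x
    proof -
      have "(k, l (k, x)) \<in> S" unfolding S_def using kx by force
      then show ?thesis using FI_span_incl[OF B S(2)] l[OF kx] by auto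
    qed
    then have "FI_span T C FC n \<subseteq> \<beta> n ` ?Q n"
      by (intro FI_span_least[OF FC sub\<beta>[OF Q]])
    then show ?thesis using T(3)[of n] by auto
  qed
  have "?Q n = carrier (B n)" for n
  proof
    show "?Q n \<subseteq> carrier (B n)" by (rule FI_submodule_subset[OF Q])
    show "carrier (B n) \<subseteq> ?Q n"
    proof
      fix b assume b: "b \<in> carrier (B n)"
      then have "\<beta> n b \<in> \<beta> n ` ?Q n" using 2[of n] by blast
      then obtain q where q: "q \<in> ?Q n" "\<beta> n q = \<beta> n b" by auto
      have qB: "q \<in> carrier (B n)" using q(1) FI_submodule_subset[OF Q, of n] by auto
      have "\<beta> n (b \<otimes>\<^bsub>B n\<^esub> inv\<^bsub>B n\<^esub> q) = \<one>\<^bsub>C n\<^esub>" using b qB q(2) by simp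
      then obtain a where a: "a \<in> carrier (A n)" "b \<otimes>\<^bsub>B n\<^esub> inv\<^bsub>B n\<^esub> q = \<alpha> n a"
        using ex[of "b \<otimes>\<^bsub>B n\<^esub> inv\<^bsub>B n\<^esub> q" n] b qB by auto
      have "b = \<alpha> n a \<otimes>\<^bsub>B n\<^esub> q" unfolding a(2)[symmetric] using b qB by (simp add: B.m_assoc)
      then show "b \<in> ?Q n" using 1[OF a(1)] q(1) subgroup.m_closed[OF Qsub] by simp
    qed
  qed
  then have fg: "finitely_generated_FI_module B FB" unfolding finitely_generated_iff using B S by blast
  obtain CA CC where CA: "\<And>n. n \<ge> 1 \<Longrightarrow> rank_le (A n) (CA * n ^ D)" and CC: "\<And>n. n \<ge> 1 \<Longrightarrow> rank_le (C n) (CC * n ^ D)"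
    using A C unfolding FI_growth_def by blast
  have "rank_le (B n) (CA * n ^ D + CC * n ^ D)" if "n \<ge> 1" for n
    by (rule rank_le_exact[OF gA gB gC \<alpha> \<beta> ex CA[OF that] CC[OF that]])
  then have "rank_le (B n) ((CA + CC) * n ^ D)" if "n \<ge> 1" for n using that by (simp add: algebra_simps)
  then show ?thesis using fg unfolding FI_growth_def by blast
qed

text \<open>The exact case with \<open>\<beta>\<close> trivial. Its target may be any module of the
  required growth, and \<open>A\<close> itself is at hand.\<close>

lemma FI_growth_surj:
  assumes A: "FI_growth A FA D" and B: "FI_module B FB"
    and \<alpha>: "\<And>n. \<alpha> n \<in> hom (A n) (B n)"
    and nat\<alpha>: "\<And>m n f x. f \<in> FI_hom m n \<Longrightarrow> x \<in> carrier (A m) \<Longrightarrow> \<alpha> n (FA m n f x) = FB m n f (\<alpha> m x)"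
    and surj: "\<And>n. carrier (B n) \<subseteq> \<alpha> n ` carrier (A n)"
  shows "FI_growth B FB D"
proof (rule FI_growth_exact[OF A A B \<alpha>, where \<beta> = "\<lambda>n _. \<one>\<^bsub>A n\<^esub>"])
  have FA: "FI_module A FA" by (rule FI_growthD[OF A])
  have gr: "Group.group (A n)" for n by (rule comm_group.axioms(2)[OF FI_module.group[OF FA]])
  show "(\<lambda>_. \<one>\<^bsub>A n\<^esub>) \<in> hom (B n) (A n)" for n using gr[of n] by (auto simp: hom_def group.is_monoid)
  show "\<one>\<^bsub>A n\<^esub> = FA m n f \<one>\<^bsub>A m\<^esub>" if "f \<in> FI_hom m n" for m n f
    using hom_one[OF FI_module.hom[OF FA that] gr gr] by simp
  show "b \<in> \<alpha> n ` carrier (A n)" if "b \<in> carrier (B n)" for n b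
    by (rule subsetD[OF surj that])
qed (use nat\<alpha> in auto)

text \<open>If the degree exceeded \<open>D\<close>, the quotient of the bounding monomial by
  \<open>P\<close> would tend to 0, so the bound would eventually be violated.\<close>

lemma degree_le_of_growth:
  fixes P :: "real poly"
  assumes "\<forall>\<^sub>F n in sequentially. \<bar>poly P (real n)\<bar> \<le> C * real n ^ D"
  shows "degree P \<le> D"
proof (rule ccontr)
  assume *: "\<not> degree P \<le> D"
  then have deg: "degree (monom C D) < degree P"
    using degree_monom_le[of C D] by linarith
  have P0: "P \<noteq> 0" using deg by auto
  have "((\<lambda>x. poly (monom C D) x / poly P x) \<longlongrightarrow> 0) at_infinity"
    by (rule poly_divide_tendsto_0_at_infinity[OF deg])
  then have "((\<lambda>n. poly (monom C D) (real n) / poly P (real n)) \<longlongrightarrow> 0) sequentially"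
    by (rule filterlim_compose[OF _ tendsto_of_nat])
  then have "\<forall>\<^sub>F n in sequentially. \<bar>poly (monom C D) (real n) / poly P (real n)\<bar> < 1"
    by (auto dest!: tendstoD[where e=1])
  moreover have "\<forall>\<^sub>F n in sequentially. poly P (real n) \<noteq> 0"
  proof -
    have "finite {x. poly P x = 0}" by (rule poly_roots_finite[OF P0])
    then have "finite (real -` {x. poly P x = 0})" by (rule finite_vimageI) (simp add: inj_on_def)
    then show ?thesis by (simp add: eventually_cofinite vimage_def flip: cofinite_eq_sequentially)
  qed
  ultimately have "\<forall>\<^sub>F n in sequentially. False"
    using assms
  proof eventually_elim
    case (elim n)
    have "\<bar>poly (monom C D) (real n)\<bar> < \<bar>poly P (real n)\<bar>"
      using elim(1,2) by (simp add: abs_divide)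
    then show ?case using elim(3) by (simp add: poly_monom)
  qed
  then show False by simp
qed

section \<open>Integral combinations of homology classes as chains\<close>

lemma zcomb_relcycle_group:
  assumes "finite I" "\<And>i. i \<in> I \<Longrightarrow> singular_relcycle p X {} (z i)"
  shows "zcomb (relcycle_group p X {}) I z c = (\<Sum>i\<in>I. frag_cmul (c i) (z i))"
  using assms
proof (induction I rule: finite_induct)
  case empty
  interpret R: comm_group "relcycle_group p X {}" by simp
  show ?case by (simp add: zcomb_def R.finprod_empty)
next
  case (insert i I)
  interpret R: comm_group "relcycle_group p X {}" by simp
  have pow: "z i [^]\<^bsub>relcycle_group p X {}\<^esub> c i = frag_cmul (c i) (z i)"
  proof -
    have zi: "singular_relcycle p X {} (z i)" using insert.prems by simp
    then have "z i \<in> carrier (subgroup_generated (chain_group p X) (Collect (singular_relcycle p X {})))"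
      unfolding relcycle_group_def[symmetric] by simp
    from group.int_pow_subgroup_generated[OF group_chain_group this, of "c i"]
    have "z i [^]\<^bsub>relcycle_group p X {}\<^esub> c i = z i [^]\<^bsub>chain_group p X\<^esub> c i"
      by (simp add: relcycle_group_def)
    also have "\<dots> = frag_cmul (c i) (z i)"
      using zi unfolding chain_group_def by (intro int_pow_free_Abelian_group) (auto simp: singular_relcycle singular_chain_def)
    finally show ?thesis .
  qed
  have "z \<in> insert i I \<rightarrow> carrier (relcycle_group p X {})" using insert.prems by auto
  then show ?case using insert unfolding zcomb_def
  proof (subst R.finprod_insert)
    show "(\<lambda>i. z i [^]\<^bsub>relcycle_group p X {}\<^esub> c i) \<in> I \<rightarrow> carrier (relcycle_group p X {})"
      by (rule Pi_I, rule R.int_pow_closed) (simp add: insert.prems)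
    show "z i [^]\<^bsub>relcycle_group p X {}\<^esub> c i \<in> carrier (relcycle_group p X {})"
      by (rule R.int_pow_closed) (simp add: insert.prems)
  qed (auto simp: pow)
qed

text \<open>Passing to homology classes is a homomorphism from the cycle group; this translates the
  multiplicative notation for homology into additive chains.\<close>

lemma zcomb_homology_group:
  assumes "finite I" "\<And>i. i \<in> I \<Longrightarrow> singular_relcycle p X {} (z i)"
  shows "zcomb (homology_group (int p) X) I (\<lambda>i. homologous_rel_set p X {} (z i)) c
    = homologous_rel_set p X {} (\<Sum>i\<in>I. frag_cmul (c i) (z i))"
proof -
  let ?h = "homologous_rel_set p X {}"
  have "?h \<in> hom (relcycle_group p X {}) (homology_group (int p) X)"
  proof -
    have "(\<lambda>a. singular_relboundary_set p X {} #>\<^bsub>relcycle_group p X {}\<^esub> a)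
        \<in> hom (relcycle_group p X {}) (relcycle_group p X {} Mod singular_relboundary_set p X {})"
      by (rule normal.r_coset_hom_Mod[OF normal_subgroup_singular_relboundary_relcycle])
    then show ?thesis
      by (simp add: right_coset_singular_relboundary nontrivial_relative_homology_group)
  qed
  then have "?h (zcomb (relcycle_group p X {}) I z c) = zcomb (homology_group (int p) X) I (?h \<circ> z) c"
    using assms by (intro hom_zcomb) auto
  then show ?thesis by (simp add: zcomb_relcycle_group[OF assms] o_def)
qed

subsection \<open>Homology of FI-spaces\<close>

abbreviation FI_homology :: "int \<Rightarrow> (nat \<Rightarrow> 'a topology) \<Rightarrow> nat \<Rightarrow> 'a chain set monoid" where
  "FI_homology p X \<equiv> \<lambda>n. homology_group p (X n)"

abbreviation FI_homology_map ::
    "int \<Rightarrow> (nat \<Rightarrow> 'a topology) \<Rightarrow> (nat \<Rightarrow> nat \<Rightarrow> (nat \<Rightarrow> nat) \<Rightarrow> 'a \<Rightarrow> 'a) \<Rightarrow>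
     nat \<Rightarrow> nat \<Rightarrow> (nat \<Rightarrow> nat) \<Rightarrow> 'a chain set \<Rightarrow> 'a chain set" where
  "FI_homology_map p X F \<equiv> \<lambda>m n f. hom_induced p (X m) {} (X n) {} (F m n f)"

lemma FI_module_pair:
  assumes X: "FI_space X F" and S: "\<And>m n f. f \<in> FI_hom m n \<Longrightarrow> F m n f \<in> S m \<rightarrow> S n"
  shows "FI_module (\<lambda>n. relative_homology_group p (X n) (S n))
           (\<lambda>m n f. hom_induced p (X m) (S m) (X n) (S n) (F m n f))"
proof (rule FI_module.intro)
  show "comm_group (relative_homology_group p (X n) (S n))" for n by simp
  show "hom_induced p (X m) (S m) (X n) (S n) (F m n f)
      \<in> hom (relative_homology_group p (X m) (S m)) (relative_homology_group p (X n) (S n))" for m n f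
    by (rule hom_induced_hom)
  show "hom_induced p (X n) (S n) (X n) (S n) (F n n (FI_id n)) x = x"
    if "x \<in> carrier (relative_homology_group p (X n) (S n))" for n x
    using that FI_space.cont[OF X FI_id_in] FI_space.ident[OF X] by (intro hom_induced_id_gen) auto
  fix f l m g n x
  assume f: "f \<in> FI_hom l m" and g: "g \<in> FI_hom m n"
  have "hom_induced p (X l) (S l) (X n) (S n) (F l n (FI_comp l g f))
      = hom_induced p (X l) (S l) (X n) (S n) (F m n g \<circ> F l m f)"
    using FI_space.comp[OF X f g] by (intro hom_induced_eq) auto
  then show "hom_induced p (X l) (S l) (X n) (S n) (F l n (FI_comp l g f)) x
      = hom_induced p (X m) (S m) (X n) (S n) (F m n g) (hom_induced p (X l) (S l) (X m) (S m) (F l m f) x)"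
    using hom_induced_compose'[OF FI_space.cont[OF X f] S[OF f] FI_space.cont[OF X g] S[OF g]] by simp
qed

lemma FI_module_homology: "FI_space X F \<Longrightarrow> FI_module (FI_homology p X) (FI_homology_map p X F)"
  by (rule FI_module_pair[where S = "\<lambda>_. {}"]) auto

lemma FI_space_subspace:
  assumes X: "FI_space X F" and S: "\<And>m n f. f \<in> FI_hom m n \<Longrightarrow> F m n f \<in> S m \<rightarrow> S n"
  shows "FI_space (\<lambda>n. subtopology (X n) (S n)) F"
proof
  show "continuous_map (subtopology (X m) (S m)) (subtopology (X n) (S n)) (F m n f)" if "f \<in> FI_hom m n" for m n f
    using FI_space.cont[OF X that] S[OF that]
    by (auto simp: continuous_map_in_subtopology continuous_map_from_subtopology)
qed (use FI_space.ident[OF X] FI_space.comp[OF X] in auto)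

text \<open>Mayer-Vietoris in three steps: the sequence of the pair consisting of \<open>B\<close>
  and the intersection bounds their relative homology; excision carries this to the homology of
  \<open>X\<close> relative to \<open>A\<close>; the sequence of that pair then bounds
  \<open>X\<close>. The assumptions cover all integral degrees because the boundary map lowers the
  degree.\<close>

theorem FI_growth_union:
  assumes X: "FI_space X F"
    and op: "\<And>n. openin (X n) (A n)" "\<And>n. openin (X n) (B n)" and cover: "\<And>n. A n \<union> B n = topspace (X n)"
    and FA: "\<And>m n f. f \<in> FI_hom m n \<Longrightarrow> F m n f \<in> A m \<rightarrow> A n"
    and FB: "\<And>m n f. f \<in> FI_hom m n \<Longrightarrow> F m n f \<in> B m \<rightarrow> B n"
    and GA: "\<And>p. FI_growth (FI_homology p (\<lambda>n. subtopology (X n) (A n))) (FI_homology_map p (\<lambda>n. subtopology (X n) (A n)) F) D"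
    and GB: "\<And>p. FI_growth (FI_homology p (\<lambda>n. subtopology (X n) (B n))) (FI_homology_map p (\<lambda>n. subtopology (X n) (B n)) F) D"
    and GC: "\<And>p. FI_growth (FI_homology p (\<lambda>n. subtopology (X n) (A n \<inter> B n))) (FI_homology_map p (\<lambda>n. subtopology (X n) (A n \<inter> B n)) F) D"
  shows "FI_growth (FI_homology p X) (FI_homology_map p X F) D"
proof -
  let ?XA = "\<lambda>n. subtopology (X n) (A n)" and ?XB = "\<lambda>n. subtopology (X n) (B n)"
  let ?C = "\<lambda>n. A n \<inter> B n"
  have FC: "F m n f \<in> ?C m \<rightarrow> ?C n" if "f \<in> FI_hom m n" for m n f using FA[OF that] FB[OF that] by blast
  have XB: "FI_space ?XB F" by (rule FI_space_subspace[OF X FB])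
  have XBC: "subtopology (?XB n) (?C n) = subtopology (X n) (?C n)" for n
    by (simp add: subtopology_subtopology Int_absorb1 inf.commute inf.left_commute)
  have 1: "FI_growth (\<lambda>n. relative_homology_group p (?XB n) (?C n))
      (\<lambda>m n f. hom_induced p (?XB m) (?C m) (?XB n) (?C n) (F m n f)) D" for p
  proof (rule FI_growth_exact[OF GB[of p] GC[of "p - 1"] FI_module_pair[OF XB FC],
      where \<alpha> = "\<lambda>n. hom_induced p (?XB n) {} (?XB n) (?C n) id" and \<beta> = "\<lambda>n. hom_boundary p (?XB n) (?C n)"])
    show "hom_induced p (?XB n) {} (?XB n) (?C n) id \<in> hom (homology_group p (?XB n)) (relative_homology_group p (?XB n) (?C n))" for n
      by (rule hom_induced_hom)
    show "hom_boundary p (?XB n) (?C n) \<in> hom (relative_homology_group p (?XB n) (?C n)) (homology_group (p - 1) (subtopology (X n) (?C n)))" for n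
      using hom_boundary_hom[of p "?XB n" "?C n"] unfolding XBC by simp
    fix m n f assume f: "f \<in> FI_hom m n"
    have contf: "continuous_map (?XB m) (?XB n) (F m n f)" by (rule FI_space.cont[OF XB f])
    show "hom_induced p (?XB n) {} (?XB n) (?C n) id (hom_induced p (?XB m) {} (?XB n) {} (F m n f) x)
        = hom_induced p (?XB m) (?C m) (?XB n) (?C n) (F m n f) (hom_induced p (?XB m) {} (?XB m) (?C m) id x)" for x
      using contf FC[OF f] by (subst (1 2) hom_induced_compose') auto
    show "hom_boundary p (?XB n) (?C n) (hom_induced p (?XB m) (?C m) (?XB n) (?C n) (F m n f) x)
        = hom_induced (p - 1) (subtopology (X m) (?C m)) {} (subtopology (X n) (?C n)) {} (F m n f) (hom_boundary p (?XB m) (?C m) x)" for x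
      using fun_cong[OF naturality_hom_induced[OF contf FC[OF f], of p], of x] unfolding XBC by simp
  next
    fix n b assume "b \<in> carrier (relative_homology_group p (?XB n) (?C n))"
      "hom_boundary p (?XB n) (?C n) b = \<one>\<^bsub>homology_group (p - 1) (subtopology (X n) (?C n))\<^esub>"
    then show "b \<in> hom_induced p (?XB n) {} (?XB n) (?C n) id ` carrier (homology_group p (?XB n))"
      using homology_exactness_axiom_1[of p "?XB n" "?C n"] unfolding XBC by (auto simp: kernel_def)
  qed
  have 2: "FI_growth (\<lambda>n. relative_homology_group p (X n) (A n))
      (\<lambda>m n f. hom_induced p (X m) (A m) (X n) (A n) (F m n f)) D" for p
  proof (rule FI_growth_surj[OF 1[of p] FI_module_pair[OF X FA],
      where \<alpha> = "\<lambda>n. hom_induced p (?XB n) (?C n) (X n) (A n) id"])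
    show "hom_induced p (?XB n) (?C n) (X n) (A n) id \<in> hom (relative_homology_group p (?XB n) (?C n)) (relative_homology_group p (X n) (A n))" for n
      by (rule hom_induced_hom)
    show "hom_induced p (?XB n) (?C n) (X n) (A n) id (hom_induced p (?XB m) (?C m) (?XB n) (?C n) (F m n f) x)
        = hom_induced p (X m) (A m) (X n) (A n) (F m n f) (hom_induced p (?XB m) (?C m) (X m) (A m) id x)"
      if f: "f \<in> FI_hom m n" for m n f x
    proof -
      have i: "continuous_map (?XB k) (X k) id" for k by (simp add: continuous_map_from_subtopology)
      show ?thesis
        using i FI_space.cont[OF XB f] FI_space.cont[OF X f] FC[OF f] FA[OF f]
        by (subst (1 2) hom_induced_compose') auto
    qed
    show "carrier (relative_homology_group p (X n) (A n))
        \<subseteq> hom_induced p (?XB n) (?C n) (X n) (A n) id ` carrier (relative_homology_group p (?XB n) (?C n))" for n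
    proof -
      \<comment> \<open>What is excised is the complement of \<open>B\<close>. It is closed and
        contained in the open set \<open>A\<close>, so it satisfies the closure condition of the
        excision axiom.\<close>
      let ?U = "topspace (X n) - B n"
      have UA: "?U \<subseteq> A n" using cover[of n] by blast
      have "X n closure_of ?U \<subseteq> X n interior_of A n"
        using UA op[of n] by (simp add: closure_of_closedin interior_of_openin closedin_diff)
      moreover have "A n \<subseteq> topspace (X n)" using openin_subset[OF op(1)] .
      ultimately have "hom_induced p (subtopology (X n) (topspace (X n) - ?U)) (A n - ?U) (subtopology (X n) (topspace (X n))) (A n) id
        \<in> iso (relative_homology_group p (subtopology (X n) (topspace (X n) - ?U)) (A n - ?U))
          (relative_homology_group p (subtopology (X n) (topspace (X n))) (A n))"
        by (rule homology_excision_axiom)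
      moreover have "topspace (X n) - ?U = B n" using openin_subset[OF op(2)[of n]] by blast
      moreover have "A n - ?U = ?C n" using openin_subset[OF op(1)[of n]] by blast
      ultimately show ?thesis by (auto simp: iso_def bij_betw_def)
    qed
  qed
  show ?thesis
  proof (rule FI_growth_exact[OF GA[of p] 2[of p] FI_module_homology[OF X],
      where \<alpha> = "\<lambda>n. hom_induced p (?XA n) {} (X n) {} id" and \<beta> = "\<lambda>n. hom_induced p (X n) {} (X n) (A n) id"])
    show "hom_induced p (?XA n) {} (X n) {} id \<in> hom (homology_group p (?XA n)) (homology_group p (X n))"
      "hom_induced p (X n) {} (X n) (A n) id \<in> hom (homology_group p (X n)) (relative_homology_group p (X n) (A n))" for n
      by (rule hom_induced_hom)+
    fix m n f assume f: "f \<in> FI_hom m n"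
    have i: "continuous_map (?XA k) (X k) id" for k by (simp add: continuous_map_from_subtopology)
    have XA: "FI_space ?XA F" by (rule FI_space_subspace[OF X FA])
    show "hom_induced p (?XA n) {} (X n) {} id (hom_induced p (?XA m) {} (?XA n) {} (F m n f) x)
        = hom_induced p (X m) {} (X n) {} (F m n f) (hom_induced p (?XA m) {} (X m) {} id x)" for x
      using i FI_space.cont[OF X f] FI_space.cont[OF XA f] by (subst (1 2) hom_induced_compose') auto
    show "hom_induced p (X n) {} (X n) (A n) id (hom_induced p (X m) {} (X n) {} (F m n f) x)
        = hom_induced p (X m) (A m) (X n) (A n) (F m n f) (hom_induced p (X m) {} (X m) (A m) id x)" for x
      using FI_space.cont[OF X f] FA[OF f] by (subst (1 2) hom_induced_compose') auto
  next
    fix n b assume "b \<in> carrier (homology_group p (X n))"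
      "hom_induced p (X n) {} (X n) (A n) id b = \<one>\<^bsub>relative_homology_group p (X n) (A n)\<^esub>"
    then show "b \<in> hom_induced p (?XA n) {} (X n) {} id ` carrier (homology_group p (?XA n))"
      using homology_exactness_axiom_3[of p "X n" "A n"] by (auto simp: kernel_def)
  qed
qed

subsection \<open>Spaces with contractible components\<close>

text \<open>The class of a point in degree 0. Singular simplices are extensional functions, hence
  the \<open>restrict\<close>.\<close>

definition pt_class :: "'a topology \<Rightarrow> 'a \<Rightarrow> 'a chain set" where
  "pt_class X c = homologous_rel_set 0 X {} (frag_of (restrict (\<lambda>_. c) (standard_simplex 0)))"

lemma pt_class_cycle:
  assumes "c \<in> topspace X"
  shows "singular_relcycle 0 X {} (frag_of (restrict (\<lambda>_. c) (standard_simplex 0)))"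
  using assms by (simp add: singular_cycle singular_chain_of singular_simplex_def chain_boundary_def)

lemma pt_class_carrier: "c \<in> topspace X \<Longrightarrow> pt_class X c \<in> carrier (homology_group 0 X)"
  using pt_class_cycle[of c X] by (auto simp: pt_class_def carrier_relative_homology_group_0)

lemma hom_induced_pt_class:
  assumes "continuous_map X Y g" "c \<in> topspace X"
  shows "hom_induced 0 X {} Y {} g (pt_class X c) = pt_class Y (g c)"
proof -
  have "simplex_map 0 g (restrict (\<lambda>_. c) (standard_simplex 0)) = restrict (\<lambda>_. g c) (standard_simplex 0)"
    by (auto simp: simplex_map_def)
  then show ?thesis
    using hom_induced_chain_map[OF assms(1) _ pt_class_cycle[OF assms(2)], of "{}"]
    by (simp add: pt_class_def)
qed

text \<open>Outside degree 0 the dimension axiom makes the group trivial; in degree 0 every chain is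
  a multiple of the one constant simplex.\<close>

lemma homology_group_singleton:
  assumes X: "topspace X = {c}" and H: "subgroup H (homology_group p X)" and c: "p = 0 \<Longrightarrow> pt_class X c \<in> H"
  shows "carrier (homology_group p X) \<subseteq> H"
proof (cases "p = 0")
  case False
  then have "carrier (homology_group p X) = {\<one>\<^bsub>homology_group p X\<^esub>}"
    using homology_dimension_axiom[OF X False] by (simp add: trivial_group_def)
  then show ?thesis using subgroup.one_closed[OF H] by simp
next
  case True
  let ?g = "frag_of (restrict (\<lambda>_. c) (standard_simplex 0))" and ?h = "homologous_rel_set 0 X {}"
  interpret G: comm_group "homology_group 0 X" by simp
  have "?h z \<in> H" if z: "singular_relcycle 0 X {} z" for z
  proof -
    obtain b where b: "z = frag_cmul b ?g" using z singular_chain_singleton[OF X] by (auto simp: singular_cycle)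
    have "?h z = zcomb (homology_group (int 0) X) {()} (\<lambda>_. ?h ?g) (\<lambda>_. b)"
      using zcomb_homology_group[of "{()}" 0 X "\<lambda>_. ?g" "\<lambda>_. b"] pt_class_cycle[of c X] X by (simp add: b)
    also have "\<dots> \<in> H"
      using G.zcomb_in_subgroup[of H "\<lambda>_. ?h ?g" "{()}"] H c True by (simp add: pt_class_def)
    finally show ?thesis .
  qed
  then show ?thesis unfolding True carrier_relative_homology_group_0 by auto
qed

text \<open>The contraction of a piece \<open>U\<close> to \<open>c\<close> factors the inclusion of \<open>U\<close> through the
  one-point space, up to homotopy.\<close>

lemma homology_contractible_piece:
  assumes c: "c \<in> U" "U \<subseteq> topspace X"
    and h: "homotopic_with (\<lambda>_. True) (subtopology X U) (subtopology X U) id (\<lambda>_. c)"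
    and H: "subgroup H (homology_group p X)" "p = 0 \<Longrightarrow> pt_class X c \<in> H"
  shows "hom_induced p (subtopology X U) {} X {} id y \<in> H"
proof -
  let ?XU = "subtopology X U" and ?Xc = "subtopology X {c}"
  have cX: "c \<in> topspace X" using c by blast
  have i: "continuous_map ?XU X id" by (simp add: continuous_map_from_subtopology)
  have ic: "continuous_map ?Xc X id" by (simp add: continuous_map_from_subtopology)
  have k: "continuous_map ?XU ?Xc (\<lambda>_. c)" using cX by simp
  have "homotopic_with (\<lambda>_. True) ?XU X (id \<circ> id) (id \<circ> (\<lambda>_. c))"
    by (rule homotopic_with_compose_continuous_map_left[OF h i]) auto
  then have "hom_induced p ?XU {} X {} id = hom_induced p ?XU {} X {} (id \<circ> (\<lambda>_. c))"
    using homology_homotopy_empty by fastforce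
  also have "\<dots> = hom_induced p ?Xc {} X {} id \<circ> hom_induced p ?XU {} ?Xc {} (\<lambda>_. c)"
    using k ic by (rule hom_induced_compose_empty)
  finally have eq: "hom_induced p ?XU {} X {} id y = hom_induced p ?Xc {} X {} id (hom_induced p ?XU {} ?Xc {} (\<lambda>_. c) y)"
    by simp
  let ?i = "hom_induced p ?Xc {} X {} id"
  interpret i: group_hom "homology_group p ?Xc" "homology_group p X" ?i
    by (intro group_hom.intro group_hom_axioms.intro hom_induced_hom) auto
  have sg: "subgroup {a \<in> carrier (homology_group p ?Xc). ?i a \<in> H} (homology_group p ?Xc)"
  proof (rule i.G.subgroupI)
    show "{a \<in> carrier (homology_group p ?Xc). ?i a \<in> H} \<noteq> {}"
      using subgroup.one_closed[OF H(1)] i.hom_one i.G.one_closed by (metis (mono_tags, lifting) empty_iff mem_Collect_eq)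
  qed (use subgroup.m_closed[OF H(1)] subgroup.m_inv_closed[OF H(1)] in auto)
  have "carrier (homology_group p ?Xc) \<subseteq> {a \<in> carrier (homology_group p ?Xc). ?i a \<in> H}"
  proof (rule homology_group_singleton[OF _ sg])
    show "topspace ?Xc = {c}" using cX by auto
    then have cc: "c \<in> topspace ?Xc" by simp
    assume p: "p = 0"
    show "pt_class ?Xc c \<in> {a \<in> carrier (homology_group p ?Xc). ?i a \<in> H}"
      using hom_induced_pt_class[OF ic cc] pt_class_carrier[OF cc] H(2)[OF p] unfolding p by simp
  qed
  then show ?thesis unfolding eq using hom_induced_carrier[of p ?XU "{}" ?Xc "{}" "\<lambda>_. c" y] by blast
qed

text \<open>By additivity the homology is the direct sum over the disjoint open pieces, so it
  suffices to place the contribution of each piece in \<open>H\<close>.\<close>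

lemma homology_contractible_pieces:
  assumes fin: "finite \<U>" and disj: "pairwise disjnt \<U>" and cov: "\<Union>\<U> = topspace X" and op: "\<And>U. U \<in> \<U> \<Longrightarrow> openin X U"
    and c: "\<And>U. U \<in> \<U> \<Longrightarrow> c U \<in> U"
    and h: "\<And>U. U \<in> \<U> \<Longrightarrow> homotopic_with (\<lambda>_. True) (subtopology X U) (subtopology X U) id (\<lambda>_. c U)"
    and H: "subgroup H (homology_group p X)" "p = 0 \<Longrightarrow> (\<And>U. U \<in> \<U> \<Longrightarrow> pt_class X (c U) \<in> H)"
  shows "carrier (homology_group p X) \<subseteq> H"
proof
  fix x assume x: "x \<in> carrier (homology_group p X)"
  let ?s = "sum_group \<U> (\<lambda>S. homology_group p (subtopology X S))"
  let ?t = "\<lambda>y V. hom_induced p (subtopology X V) {} X {} id (y V)"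
  have "(\<lambda>y. gfinprod (homology_group p X) (?t y) \<U>) \<in> iso ?s (homology_group p X)"
    by (rule homology_additivity_axiom[OF disj cov op])
  then have "x \<in> (\<lambda>y. gfinprod (homology_group p X) (?t y) \<U>) ` carrier ?s"
    using x by (auto simp: iso_def bij_betw_def)
  then obtain y where y: "x = gfinprod (homology_group p X) (?t y) \<U>" by (elim imageE)
  interpret G: comm_group "homology_group p X" by simp
  have tH: "?t y V \<in> H" if "V \<in> \<U>" for V
    using c[OF that] h[OF that] openin_subset[OF op[OF that]] H that by (intro homology_contractible_piece) auto
  have sub: "H \<subseteq> carrier (homology_group p X)" by (rule subgroup.subset[OF H(1)])
  have "x = zcomb (homology_group p X) \<U> (?t y) (\<lambda>_. 1)"
  proof -
    have tG: "?t y \<in> \<U> \<rightarrow> carrier (homology_group p X)" by (simp add: hom_induced_carrier)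
    show ?thesis unfolding y zcomb_def G.gfinprod_eq_finprod[OF fin tG]
      by (rule G.finprod_cong') (simp_all add: hom_induced_carrier)
  qed
  also have "\<dots> \<in> H" by (rule G.zcomb_in_subgroup[OF H(1) _ fin]) (use tH in auto)
  finally show "x \<in> H" .
qed

text \<open>Outside degree 0 the homology vanishes. In degree 0 it is generated by one class per
  piece, which bounds the rank, and each such class comes from a point in degree at most
  \<open>K\<close>.\<close>

theorem FI_growth_contractible_pieces:
  assumes X: "FI_space X F"
    and fin: "\<And>n. finite (\<U> n)" and disj: "\<And>n. pairwise disjnt (\<U> n)" and cov: "\<And>n. \<Union>(\<U> n) = topspace (X n)"
    and op: "\<And>n U. U \<in> \<U> n \<Longrightarrow> openin (X n) U"
    and c: "\<And>n U. U \<in> \<U> n \<Longrightarrow> c n U \<in> U"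
    and h: "\<And>n U. U \<in> \<U> n \<Longrightarrow> homotopic_with (\<lambda>_. True) (subtopology (X n) U) (subtopology (X n) U) id (\<lambda>_. c n U)"
    and card: "\<And>n. n \<ge> 1 \<Longrightarrow> card (\<U> n) \<le> C * n ^ D"
    and bdd: "\<And>n U. U \<in> \<U> n \<Longrightarrow> \<exists>k\<le>K. \<exists>f\<in>FI_hom k n. \<exists>c'\<in>topspace (X k). c n U = F k n f c'"
  shows "FI_growth (FI_homology p X) (FI_homology_map p X F) D"
proof (cases "p = 0")
  case False
  have V: "FI_module (FI_homology p X) (FI_homology_map p X F)" by (rule FI_module_homology[OF X])
  have triv: "carrier (homology_group p (X n)) = {\<one>\<^bsub>homology_group p (X n)\<^esub>}" for n
  proof -
    interpret G: comm_group "homology_group p (X n)" by simp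
    have "carrier (homology_group p (X n)) \<subseteq> {\<one>\<^bsub>homology_group p (X n)\<^esub>}"
      by (rule homology_contractible_pieces[OF fin disj cov op c h G.triv_subgroup]) (use False in auto)
    then show ?thesis using G.one_closed by blast
  qed
  then have "rank_le (homology_group p (X n)) (0 * n ^ D)" for n
    by (intro rank_le_trivial) (simp add: trivial_group_def)
  moreover have "FI_span {} (FI_homology p X) (FI_homology_map p X F) n = carrier (homology_group p (X n))" for n
    unfolding FI_span_def by (simp add: triv group.generate_empty)
  ultimately show ?thesis unfolding FI_growth_def finitely_generated_iff using V by blast
next
  case True
  have V: "FI_module (FI_homology 0 X) (FI_homology_map 0 X F)" by (rule FI_module_homology[OF X])
  have cX: "c n U \<in> topspace (X n)" if "U \<in> \<U> n" for n U using c[OF that] cov[of n] that by blast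
  have gen: "carrier (homology_group 0 (X n)) = generate (homology_group 0 (X n)) ((\<lambda>U. pt_class (X n) (c n U)) ` \<U> n)" for n
  proof
    interpret G: comm_group "homology_group 0 (X n)" by simp
    have sub: "(\<lambda>U. pt_class (X n) (c n U)) ` \<U> n \<subseteq> carrier (homology_group 0 (X n))"
      by (rule image_subsetI) (rule pt_class_carrier[OF cX])
    show "generate (homology_group 0 (X n)) ((\<lambda>U. pt_class (X n) (c n U)) ` \<U> n) \<subseteq> carrier (homology_group 0 (X n))"
      by (rule G.generate_incl[OF sub])
    show "carrier (homology_group 0 (X n)) \<subseteq> generate (homology_group 0 (X n)) ((\<lambda>U. pt_class (X n) (c n U)) ` \<U> n)"
      by (rule homology_contractible_pieces[OF fin disj cov op c h G.generate_is_subgroup[OF sub]]) (auto intro: generate.incl)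
  qed
  have "rank_le (homology_group 0 (X n)) (C * n ^ D)" if "n \<ge> 1" for n
  proof (rule rank_le_mono[OF _ card[OF that]])
    show "rank_le (homology_group 0 (X n)) (card (\<U> n))"
    proof -
      have "(\<lambda>U. pt_class (X n) (c n U)) \<in> \<U> n \<rightarrow> carrier (homology_group 0 (X n))"
        by (rule Pi_I) (rule pt_class_carrier[OF cX])
      from rank_le_generate[OF abelian_homology_group fin this gen] show ?thesis .
    qed
  qed
  \<comment> \<open>The classes of all centers in degrees up to \<open>K\<close>, finitely
    many.\<close>
  moreover define S where "S = (\<Union>k\<in>{..K}. (\<lambda>U. (k, pt_class (X k) (c k U))) ` \<U> k)"
  have S: "finite S" "S \<subseteq> (SIGMA n:UNIV. carrier (homology_group 0 (X n)))"
  proof -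
    show "finite S" using fin by (simp add: S_def)
    show "S \<subseteq> (SIGMA n:UNIV. carrier (homology_group 0 (X n)))"
      unfolding S_def
    proof (intro UN_least image_subsetI SigmaI UNIV_I)
      fix k U assume "U \<in> \<U> k"
      then show "pt_class (X k) (c k U) \<in> carrier (homology_group 0 (X k))" by (intro pt_class_carrier cX)
    qed
  qed
  let ?Q = "FI_span S (FI_homology 0 X) (FI_homology_map 0 X F)"
  have Q: "FI_submodule ?Q (FI_homology 0 X) (FI_homology_map 0 X F)" by (rule FI_span_submodule[OF V S(2)])
  have Qs: "subgroup (?Q n) (homology_group 0 (X n))" for n using Q by (simp add: FI_submodule_def)
  have "?Q n = carrier (homology_group 0 (X n))" for n
  proof
    show "?Q n \<subseteq> carrier (homology_group 0 (X n))" by (rule FI_submodule_subset[OF Q])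
    interpret G: comm_group "homology_group 0 (X n)" by simp
    have "pt_class (X n) (c n U) \<in> ?Q n" if U: "U \<in> \<U> n" for U
    proof -
      obtain k f c' where k: "k \<le> K" "f \<in> FI_hom k n" "c' \<in> topspace (X k)" "c n U = F k n f c'"
        using bdd[OF U] by blast
      interpret Gk: comm_group "homology_group 0 (X k)" by simp
      have "generate (homology_group 0 (X k)) ((\<lambda>U. pt_class (X k) (c k U)) ` \<U> k) \<subseteq> ?Q k"
      proof (rule Gk.generate_subgroup_incl[OF _ Qs])
        show "(\<lambda>U. pt_class (X k) (c k U)) ` \<U> k \<subseteq> ?Q k"
        proof (rule image_subsetI)
          fix U assume "U \<in> \<U> k"
          then have "(k, pt_class (X k) (c k U)) \<in> S" unfolding S_def using k(1) by blast
          then show "pt_class (X k) (c k U) \<in> ?Q k" by (rule FI_span_incl[OF V S(2)])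
        qed
      qed
      \<comment> \<open>The point \<open>c'\<close> need not be a chosen center, but its class is a
        combination of the center classes in degree \<open>k\<close>, all of which belong to
        \<open>S\<close>.\<close>
      then have "pt_class (X k) c' \<in> ?Q k" using pt_class_carrier[OF k(3)] gen[of k] by blast
      then have "hom_induced 0 (X k) {} (X n) {} (F k n f) (pt_class (X k) c') \<in> ?Q n"
        by (rule FI_submodule_mem[OF Q k(2)])
      then show ?thesis using hom_induced_pt_class[OF FI_space.cont[OF X k(2)] k(3)] k(4) by simp
    qed
    then show "carrier (homology_group 0 (X n)) \<subseteq> ?Q n"
      unfolding gen[of n] by (intro G.generate_subgroup_incl[OF _ Qs]) blast
  qed
  ultimately show ?thesis unfolding FI_growth_def finitely_generated_iff True using V S by blast
qed

subsection \<open>Extension and factorization of injections\<close>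

lemma FI_hom_iff:
  "f \<in> FI_hom m n \<longleftrightarrow> f ` {1..m} \<subseteq> {1..n} \<and> inj_on f {1..m} \<and> f \<in> extensional {1..m}"
  unfolding FI_hom_def PiE_def Pi_def by blast

lemma FI_hom_card_image: "f \<in> FI_hom m n \<Longrightarrow> card (f ` {1..m}) = m"
  by (simp add: FI_hom_iff card_image)

text \<open>Together the images have at most \<open>K\<close> points. They are enlarged to a set of
  exactly \<open>K\<close> points, possible as \<open>K\<close> is at most \<open>n\<close>, and an
  enumeration of that set is the common second factor.\<close>

lemma FI_factor_through:
  assumes I: "finite I" and g: "\<And>i. i \<in> I \<Longrightarrow> g i \<in> FI_hom (k i) n" and "(\<Sum>i\<in>I. k i) \<le> K" "K \<le> n"
  obtains h where "h \<in> FI_hom K n" "\<And>i. i \<in> I \<Longrightarrow> \<exists>g'\<in>FI_hom (k i) K. g i = FI_comp (k i) h g'"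
proof -
  define A where "A = (\<Union>i\<in>I. g i ` {1..k i})"
  have "card A \<le> (\<Sum>i\<in>I. card (g i ` {1..k i}))" unfolding A_def by (rule card_UN_le[OF I])
  also have "\<dots> = (\<Sum>i\<in>I. k i)" using FI_hom_card_image[OF g] by (intro sum.cong) auto
  finally have cA: "card A \<le> K" using assms(3) by simp
  have A: "A \<subseteq> {1..n}" unfolding A_def using g by (intro UN_least) (simp add: FI_hom_iff)
  obtain A' where A': "A \<subseteq> A'" "A' \<subseteq> {1..n}" "card A' = K"
    using exists_subset_between[OF cA _ A] assms(4) by auto
  have fA': "finite A'" using A'(2) finite_subset by blast
  obtain h0 where h0: "bij_betw h0 {1..K} A'" using ex_bij_betw_nat_finite_1[OF fA'] A'(3) by auto
  define h where "h = restrict h0 {1..K}"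
  have hb: "bij_betw h {1..K} A'" unfolding h_def using h0 by (rule bij_betw_cong[THEN iffD1, rotated]) simp
  have h: "h \<in> FI_hom K n"
    using hb A'(2) by (simp add: FI_hom_iff bij_betw_def h_def)
  have "\<exists>g'\<in>FI_hom (k i) K. g i = FI_comp (k i) h g'" if i: "i \<in> I" for i
  proof -
    define g' where "g' = (\<lambda>a\<in>{1..k i}. the_inv_into {1..K} h (g i a))"
    have gA: "g i a \<in> h ` {1..K}" if "a \<in> {1..k i}" for a
    proof -
      have "g i a \<in> A" unfolding A_def using that i by blast
      then show ?thesis unfolding bij_betw_imp_surj_on[OF hb] using A'(1) by blast
    qed
    have inj: "inj_on h {1..K}" using hb by (simp add: bij_betw_def)
    have g'1: "g' a \<in> {1..K}" "h (g' a) = g i a" if "a \<in> {1..k i}" for a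
      using that the_inv_into_into[OF inj gA[OF that], of "{1..K}"] f_the_inv_into_f[OF inj gA[OF that]]
      by (simp_all add: g'_def)
    have "inj_on g' {1..k i}"
    proof (rule inj_onI)
      fix a b assume ab: "a \<in> {1..k i}" "b \<in> {1..k i}" "g' a = g' b"
      then have "g i a = g i b" using g'1(2)[of a] g'1(2)[of b] by simp
      then show "a = b" using g[OF i] ab(1,2) by (auto simp: FI_hom_iff dest: inj_onD)
    qed
    then have "g' \<in> FI_hom (k i) K" using g'1(1) by (auto simp: FI_hom_iff g'_def)
    moreover have "g i = FI_comp (k i) h g'"
    proof
      fix a show "g i a = FI_comp (k i) h g' a"
      proof (cases "a \<in> {1..k i}")
        case True
        then show ?thesis using g'1(2) by (simp add: FI_comp_def compose_def)
      next
        case False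
        then show ?thesis using g[OF i] unfolding FI_comp_def compose_def FI_hom_iff extensional_def by auto
      qed
    qed
    ultimately show ?thesis by blast
  qed
  then show thesis using that h by blast
qed

text \<open>On the image of \<open>h0\<close> the map is forced. Elsewhere any injection into the
  complement of the image of \<open>h\<close> will do, and there is room since both images have
  \<open>a\<close> points and \<open>N\<close> is at most \<open>n\<close>.\<close>

lemma FI_extend:
  assumes h0: "h0 \<in> FI_hom a N" and h: "h \<in> FI_hom a n" and "N \<le> n"
  obtains g where "g \<in> FI_hom N n" "FI_comp a g h0 = h"
proof -
  let ?P = "h0 ` {1..a}" and ?Q = "h ` {1..a}"
  have P: "?P \<subseteq> {1..N}" "inj_on h0 {1..a}" and Q: "?Q \<subseteq> {1..n}" "inj_on h {1..a}"
    using h0 h by (simp_all add: FI_hom_iff)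
  have "card ({1..N} - ?P) \<le> card ({1..n} - ?Q)"
    using P Q FI_hom_card_image[OF h0] FI_hom_card_image[OF h] assms(3) by (simp add: card_Diff_subset)
  then obtain r where r: "r ` ({1..N} - ?P) \<subseteq> {1..n} - ?Q" "inj_on r ({1..N} - ?P)"
    using card_le_inj[of "{1..N} - ?P" "{1..n} - ?Q"] by auto
  define g where "g = (\<lambda>i\<in>{1..N}. if i \<in> ?P then h (the_inv_into {1..a} h0 i) else r i)"
  have gh: "g (h0 i) = h i" if "i \<in> {1..a}" for i
  proof -
    have "h0 i \<in> ?P" using that by (rule imageI)
    then have "h0 i \<in> {1..N}" using P(1) by blast
    then show ?thesis using \<open>h0 i \<in> ?P\<close> the_inv_into_f_f[OF P(2) that] by (simp add: g_def)
  qed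
  have gr: "g i = r i" if "i \<in> {1..N} - ?P" for i using that by (simp add: g_def)
  have gP: "g i \<in> ?Q" if "i \<in> ?P" for i using that gh by auto
  have gR: "g i \<in> {1..n} - ?Q" if "i \<in> {1..N} - ?P" for i
    unfolding gr[OF that] by (rule subsetD[OF r(1) imageI[OF that]])
  have "inj_on g {1..N}"
  proof (rule inj_onI)
    fix i j assume ij: "i \<in> {1..N}" "j \<in> {1..N}" "g i = g j"
    show "i = j"
    proof (cases "i \<in> ?P")
      case True
      then have j: "j \<in> ?P" using gP[of i] gR[of j] ij by auto
      obtain i' where i': "i' \<in> {1..a}" "i = h0 i'" using True by (elim imageE)
      obtain j' where j': "j' \<in> {1..a}" "j = h0 j'" using j by (elim imageE)
      have "h i' = h j'" using gh[OF i'(1)] gh[OF j'(1)] ij(3) i'(2) j'(2) by simp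
      then show ?thesis using inj_onD[OF Q(2)] i' j' by auto
    next
      case False
      then have j: "j \<notin> ?P" using gP[of j] gR[of i] ij by auto
      then have "r i = r j" using gr[of i] gr[of j] ij False by simp
      then show ?thesis using inj_onD[OF r(2)] ij j False by blast
    qed
  qed
  moreover have "g ` {1..N} \<subseteq> {1..n}"
  proof (rule image_subsetI)
    fix i assume "i \<in> {1..N}"
    then show "g i \<in> {1..n}" using gP[of i] gR[of i] Q(1) by (cases "i \<in> ?P") blast+
  qed
  moreover have "g \<in> extensional {1..N}" unfolding g_def by (rule restrict_extensional)
  ultimately have "g \<in> FI_hom N n" by (simp add: FI_hom_iff)
  moreover have "FI_comp a g h0 = h"
  proof
    fix i show "FI_comp a g h0 i = h i"
    proof (cases "i \<in> {1..a}")
      case True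
      then show ?thesis using gh by (simp add: FI_comp_def compose_def)
    next
      case False
      then show ?thesis using h unfolding FI_comp_def compose_def FI_hom_iff extensional_def by auto
    qed
  qed
  ultimately show thesis using that by blast
qed

lemma card_FI_hom_le: "card (FI_hom m n) \<le> n ^ m"
proof -
  have "card (FI_hom m n) \<le> card ({1..m} \<rightarrow>\<^sub>E {1..n})"
    by (rule card_mono) (auto simp: FI_hom_def intro!: finite_PiE)
  then show ?thesis by (simp add: card_PiE)
qed

subsection \<open>Generation of FI-graphs\<close>

context FI_graph
begin

lemma F_verts: "f \<in> FI_hom m n \<Longrightarrow> v \<in> verts (G m) \<Longrightarrow> F m n f v \<in> verts (G n)"
  using hom[of f m n] by (auto simp: graph_hom_def)

lemma simplex_subset: "s \<in> graph_simplices (G n) \<Longrightarrow> s \<subseteq> verts (G n)"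
  using graph[of n] by (auto simp: graph_simplices_def finite_simple_graph_def)

lemma F_simplex: "f \<in> FI_hom m n \<Longrightarrow> s \<in> graph_simplices (G m) \<Longrightarrow> F m n f ` s \<in> graph_simplices (G n)"
proof -
  assume f: "f \<in> FI_hom m n" and s: "s \<in> graph_simplices (G m)"
  show ?thesis
  proof (cases "s \<in> edges (G m)")
    case True
    then have "s \<subseteq> verts (G m)" "card s = 2" using graph[of m] by (auto simp: finite_simple_graph_def)
    moreover then obtain u v where "s = {u, v}" by (auto simp: card_2_iff)
    ultimately have "F m n f ` s \<in> edges (G n)" using hom[OF f] True by (auto simp: graph_hom_def)
    then show ?thesis by (simp add: graph_simplices_def)
  next
    case False
    then show ?thesis using s F_verts[OF f] by (auto simp: graph_simplices_def)
  qed
qed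

lemma F_comp_image:
  assumes "f \<in> FI_hom l m" "g \<in> FI_hom m n" "s \<subseteq> verts (G l)"
  shows "F m n g ` F l m f ` s = F l n (FI_comp l g f) ` s"
  using comp[OF assms(1,2)] assms(3) by (force simp: image_image intro!: image_cong)

lemma vertex_from_degree:
  assumes "vertex_stable G F d" "n \<ge> d" "v \<in> verts (G n)"
  shows "\<exists>f\<in>FI_hom d n. \<exists>w\<in>verts (G d). F d n f w = v"
  using assms(2,3)
proof (induction n arbitrary: v rule: dec_induct)
  case base
  then show ?case using ident[OF base] FI_id_in[of d] by blast
next
  case (step n)
  obtain w f where w: "w \<in> verts (G n)" "f \<in> FI_hom n (n + 1)" "F n (n + 1) f w = v"
  proof -
    have "\<exists>w\<in>verts (G n). \<exists>f\<in>FI_hom n (n + 1). F n (n + 1) f w = v"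
      using assms(1) step.hyps(1) step.prems unfolding vertex_stable_def by simp
    then show thesis using that by blast
  qed
  obtain g u where g: "g \<in> FI_hom d n" "u \<in> verts (G d)" "F d n g u = w" using step.IH[OF w(1)] by blast
  have "F d (n + 1) (FI_comp d f g) u = v" using comp[OF g(1) w(2) g(2)] g(3) w(3) by simp
  moreover have "FI_comp d f g \<in> FI_hom d (n + 1)" using FI_comp_in[OF g(1) w(2)] .
  ultimately show ?case using g(2) by auto
qed

text \<open>From degree \<open>d\<close> on, a vertex is determined by an injection from
  \<open>d\<close> points and a vertex of \<open>G d\<close>. The sum over smaller degrees makes one
  constant serve for all \<open>n\<close>.\<close>

lemma card_verts_growth:
  assumes "vertex_stable G F d"
  obtains C where "\<And>n. n \<ge> 1 \<Longrightarrow> card (verts (G n)) \<le> C * n ^ d"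
proof
  fix n :: nat assume n: "n \<ge> 1"
  define C where "C = (\<Sum>k\<le>d. card (verts (G k)))"
  have fin: "finite (verts (G k))" for k using graph[of k] by (simp add: finite_simple_graph_def)
  show "card (verts (G n)) \<le> (\<Sum>k\<le>d. card (verts (G k))) * n ^ d"
  proof (cases "n \<le> d")
    case True
    then have "card (verts (G n)) \<le> (\<Sum>k\<le>d. card (verts (G k)))" by (intro member_le_sum) auto
    then show ?thesis using n by (simp add: le_trans[OF _ mult_le_mono2[of 1 "n ^ d"]])
  next
    case False
    then have "verts (G n) \<subseteq> (\<lambda>(f, w). F d n f w) ` (FI_hom d n \<times> verts (G d))"
      using vertex_from_degree[OF assms, of n] by force
    then have "card (verts (G n)) \<le> card (FI_hom d n \<times> verts (G d))"
      using fin by (intro surj_card_le) auto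
    also have "\<dots> = card (FI_hom d n) * card (verts (G d))" by (rule card_cartesian_product)
    also have "\<dots> \<le> n ^ d * (\<Sum>k\<le>d. card (verts (G k)))"
      using card_FI_hom_le[of d n] by (intro mult_le_mono member_le_sum) auto
    finally show ?thesis by (simp add: mult.commute)
  qed
qed

text \<open>Whether an injective image of a pair of vertices of \<open>G (2 * d)\<close> is an edge depends
  only on its degree, and is inherited by larger degrees; so finitely many edges generate.\<close>

lemma simplices_generated:
  assumes vs: "vertex_stable G F d"
  obtains K where "\<And>n s. s \<in> graph_simplices (G n) \<Longrightarrow>
    \<exists>k\<le>K. \<exists>g\<in>FI_hom k n. \<exists>s0\<in>graph_simplices (G k). F k n g ` s0 = s"
proof -
  have fin: "finite (verts (G k))" for k using graph[of k] by (simp add: finite_simple_graph_def)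
  \<comment> \<open>Some injection into degree \<open>N\<close> turns the pair into an edge. Which
    injection is chosen is immaterial later, because \<open>FI_extend\<close> can correct
    it.\<close>
  define E where "E \<pi> N \<longleftrightarrow> (\<exists>h\<in>FI_hom (2 * d) N. F (2 * d) N h ` \<pi> \<in> edges (G N))" for \<pi> N
  \<comment> \<open>The sum bounds each of the finitely many least degrees. For a pair that never
    becomes an edge \<open>LEAST\<close> is some unspecified number, which merely enlarges
    \<open>K\<close>.\<close>
  define K where "K = 2 * d + (\<Sum>\<pi>\<in>Pow (verts (G (2 * d))). LEAST N. E \<pi> N)"
  have id: "\<exists>k\<le>K. \<exists>g\<in>FI_hom k n. \<exists>s0\<in>graph_simplices (G k). F k n g ` s0 = s"
    if "s \<in> graph_simplices (G n)" "n \<le> K" for s n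
  proof -
    have "F n n (FI_id n) ` s = s" using ident simplex_subset[OF that(1)] by (force simp: subset_iff)
    then show ?thesis using that FI_id_in by blast
  qed
  show thesis
  proof (rule that[of K])
    fix n s assume s: "s \<in> graph_simplices (G n)"
    show "\<exists>k\<le>K. \<exists>g\<in>FI_hom k n. \<exists>s0\<in>graph_simplices (G k). F k n g ` s0 = s"
    proof (cases "n \<le> K")
      case True
      then show ?thesis by (rule id[OF s])
    next
      case False
      then have n: "2 * d \<le> n" by (simp add: K_def)
      then have n': "d \<le> n" by simp
      show ?thesis
      proof (cases "s \<in> edges (G n)")
        case False
        then obtain v where v: "s = {v}" "v \<in> verts (G n)" using s by (auto simp: graph_simplices_def)
        obtain f w where "f \<in> FI_hom d n" "w \<in> verts (G d)" "F d n f w = v"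
          using vertex_from_degree[OF vs n' v(2)] by blast
        moreover have "d \<le> K" by (simp add: K_def)
        ultimately show ?thesis using v(1)
          by (intro exI[of _ d] conjI bexI[of _ f] bexI[of _ "{w}"]) (auto simp: graph_simplices_def)
      next
        case True
        then have "s \<subseteq> verts (G n)" "card s = 2" using graph[of n] by (auto simp: finite_simple_graph_def)
        moreover then obtain u v where uv: "s = {u, v}" by (auto simp: card_2_iff)
        ultimately have "u \<in> verts (G n)" "v \<in> verts (G n)" by auto
        then obtain f u' g v' where f: "f \<in> FI_hom d n" "u' \<in> verts (G d)" "F d n f u' = u"
            and g: "g \<in> FI_hom d n" "v' \<in> verts (G d)" "F d n g v' = v"
          using vertex_from_degree[OF vs n'] by meson
        \<comment> \<open>Each end of the edge needs \<open>d\<close> points of the index set, so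
          both ends together come from \<open>2 * d\<close> points.\<close>
        obtain h where h: "h \<in> FI_hom (2 * d) n"
            "\<And>b. b \<in> {True, False} \<Longrightarrow> \<exists>g'\<in>FI_hom d (2 * d). (if b then f else g) = FI_comp d h g'"
          by (rule FI_factor_through[of "{True, False}" "\<lambda>b. if b then f else g" "\<lambda>_. d" n "2 * d"])
            (use f g n in auto)
        obtain f' where f': "f' \<in> FI_hom d (2 * d)" "f = FI_comp d h f'" using h(2)[of True] by auto
        obtain g' where g': "g' \<in> FI_hom d (2 * d)" "g = FI_comp d h g'" using h(2)[of False] by auto
        let ?\<pi> = "{F d (2 * d) f' u', F d (2 * d) g' v'}"
        have \<pi>: "?\<pi> \<subseteq> verts (G (2 * d))" using F_verts f' g' f g by auto
        have h\<pi>: "F (2 * d) n h ` ?\<pi> = s"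
          using comp[OF f'(1) h(1) f(2)] comp[OF g'(1) h(1) g(2)] f g f' g' uv by simp
        have "E ?\<pi> n" unfolding E_def using h(1) h\<pi> True by auto
        define N where "N = (LEAST N. E ?\<pi> N)"
        have "E ?\<pi> N" unfolding N_def by (rule LeastI[of _ n]) fact
        then obtain h0 where h0: "h0 \<in> FI_hom (2 * d) N" "F (2 * d) N h0 ` ?\<pi> \<in> edges (G N)" by (auto simp: E_def)
        have Nn: "N \<le> n" unfolding N_def by (rule Least_le) fact
        have "N \<le> (\<Sum>\<pi>\<in>Pow (verts (G (2 * d))). LEAST N. E \<pi> N)"
          unfolding N_def using \<pi> fin by (intro member_le_sum[where f = "\<lambda>\<pi>. LEAST N. E \<pi> N"]) auto
        then have NK: "N \<le> K" by (simp add: K_def)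
        \<comment> \<open>Extending along \<open>h0\<close> gives a transition map that carries the
          edge found in the least degree \<open>N\<close> onto \<open>s\<close>.\<close>
        obtain k where k: "k \<in> FI_hom N n" "FI_comp (2 * d) k h0 = h" by (rule FI_extend[OF h0(1) h(1) Nn])
        have "F N n k ` F (2 * d) N h0 ` ?\<pi> = s"
          unfolding F_comp_image[OF h0(1) k(1) \<pi>] k(2) by (rule h\<pi>)
        moreover have "F (2 * d) N h0 ` ?\<pi> \<in> graph_simplices (G N)" using h0(2) by (simp add: graph_simplices_def)
        ultimately show ?thesis using NK k(1) by blast
      qed
    qed
  qed
qed

end

subsection \<open>Points of the realization\<close>

definition vsupp :: "('v \<Rightarrow> real) \<Rightarrow> 'v set" where
  "vsupp x = {v. x v \<noteq> 0}"

lemma vsupp_iff: "v \<in> vsupp x \<longleftrightarrow> x v \<noteq> 0"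
  by (simp add: vsupp_def)

lemma not_in_vsupp: "vsupp x \<subseteq> s \<Longrightarrow> v \<notin> s \<Longrightarrow> x v = 0"
  by (auto simp: vsupp_iff subset_iff)

definition vertex_point :: "'v \<Rightarrow> 'v \<Rightarrow> real" where
  "vertex_point v = (\<lambda>u. if u = v then 1 else 0)"

lemma realization_points:
  "topspace (realization G) = {x. (\<forall>v. 0 \<le> x v) \<and> (\<exists>s\<in>graph_simplices G. vsupp x \<subseteq> s \<and> sum x s = 1)}"
  by (simp add: realization_def vsupp_def)

lemma simplex_finite: "finite_simple_graph G \<Longrightarrow> s \<in> graph_simplices G \<Longrightarrow> finite s"
  unfolding graph_simplices_def finite_simple_graph_def by (auto intro: finite_subset)

lemma simplex_card: "finite_simple_graph G \<Longrightarrow> s \<in> graph_simplices G \<Longrightarrow> card s \<le> 2"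
  unfolding graph_simplices_def finite_simple_graph_def by auto

lemma simplex_verts: "finite_simple_graph G \<Longrightarrow> s \<in> graph_simplices G \<Longrightarrow> s \<subseteq> verts G"
  unfolding graph_simplices_def finite_simple_graph_def by auto

lemma realization_pointE:
  assumes "finite_simple_graph G" "x \<in> topspace (realization G)"
  obtains s where "s \<in> graph_simplices G" "vsupp x \<subseteq> s" "finite s" "card s \<le> 2" "s \<subseteq> verts G" "sum x s = 1"
  using assms simplex_finite[OF assms(1)] simplex_card[OF assms(1)] simplex_verts[OF assms(1)]
  unfolding realization_points by blast

lemma realization_point_nonneg: "x \<in> topspace (realization G) \<Longrightarrow> 0 \<le> x v"
  by (simp add: realization_points)

lemma finite_vsupp: "finite_simple_graph G \<Longrightarrow> x \<in> topspace (realization G) \<Longrightarrow> finite (vsupp x)"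
  by (rule realization_pointE) (auto intro: finite_subset)

lemma vsupp_verts: "finite_simple_graph G \<Longrightarrow> x \<in> topspace (realization G) \<Longrightarrow> vsupp x \<subseteq> verts G"
  by (rule realization_pointE) auto

lemma sum_realization_point:
  assumes "finite_simple_graph G" "x \<in> topspace (realization G)" "finite s" "vsupp x \<subseteq> s"
  shows "sum x s = 1"
proof -
  obtain t where t: "vsupp x \<subseteq> t" "finite t" "sum x t = 1" using assms(1,2) by (rule realization_pointE)
  have "sum x s = sum x (vsupp x)" using assms(3,4) by (intro sum.mono_neutral_right) (auto simp: vsupp_def)
  also have "\<dots> = sum x t" using t(1,2) by (intro sum.mono_neutral_left) (auto simp: vsupp_def)
  finally show ?thesis using t(3) by simp
qed

lemma realization_two_coords:
  assumes "finite_simple_graph G" "x \<in> topspace (realization G)" "u \<noteq> v"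
  shows "x u + x v \<le> 1"
proof -
  have "x u + x v = sum x {u, v}" using assms(3) by simp
  also have "\<dots> \<le> sum x (vsupp x \<union> {u, v})"
    using finite_vsupp[OF assms(1,2)] realization_point_nonneg[OF assms(2)] by (intro sum_mono2) auto
  also have "\<dots> = 1" using finite_vsupp[OF assms(1,2)] by (intro sum_realization_point[OF assms(1,2)]) auto
  finally show ?thesis .
qed

lemma realization_point_le_1:
  assumes "finite_simple_graph G" "x \<in> topspace (realization G)"
  shows "x v \<le> 1"
proof -
  have "x v = sum x {v}" by simp
  also have "\<dots> \<le> sum x (vsupp x \<union> {v})"
    using finite_vsupp[OF assms] realization_point_nonneg[OF assms(2)] by (intro sum_mono2) auto
  also have "\<dots> = 1" using finite_vsupp[OF assms] by (intro sum_realization_point[OF assms]) auto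
  finally show ?thesis .
qed

lemma realization_point_eq_1:
  assumes "finite_simple_graph G" "x \<in> topspace (realization G)" "x v = 1"
  shows "x = vertex_point v"
proof
  fix u show "x u = vertex_point v u"
    using realization_two_coords[OF assms(1,2), of v u] realization_point_nonneg[OF assms(2), of u] assms(3)
    by (auto simp: vertex_point_def)
qed

lemma vertex_point_realization: "v \<in> verts G \<Longrightarrow> vertex_point v \<in> topspace (realization G)"
  by (auto simp: realization_points vertex_point_def vsupp_def graph_simplices_def intro!: bexI[of _ "{v}"])

text \<open>A support has at most two elements since the complex has dimension at most 1; it is not
  empty, and a single vertex would carry the coordinate 1.\<close>

lemma vsupp_edge:
  assumes "finite_simple_graph G" "x \<in> topspace (realization G)" "\<forall>v. x v \<noteq> 1"
  shows "vsupp x \<in> edges G" "card (vsupp x) = 2"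
proof -
  obtain s where s: "s \<in> graph_simplices G" "vsupp x \<subseteq> s" "finite s" "card s \<le> 2" "sum x s = 1"
    using assms(1,2) by (rule realization_pointE)
  have "card (vsupp x) \<noteq> 0"
  proof
    assume "card (vsupp x) = 0"
    then have "vsupp x = {}" using finite_vsupp[OF assms(1,2)] by simp
    then show False using sum_realization_point[OF assms(1,2), of "{}"] by simp
  qed
  moreover have "card (vsupp x) \<noteq> 1"
  proof
    assume "card (vsupp x) = 1"
    then obtain v where "vsupp x = {v}" by (auto simp: card_1_singleton_iff)
    then show False using sum_realization_point[OF assms(1,2), of "{v}"] assms(3) by simp
  qed
  moreover have "card (vsupp x) \<le> card s" using s by (intro card_mono)
  ultimately show c2: "card (vsupp x) = 2" using s(4) by linarith
  then have "vsupp x = s" using s(2,3,4) by (intro card_seteq) auto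
  moreover have "s \<in> edges G"
    using s(1) c2 \<open>vsupp x = s\<close> by (auto simp: graph_simplices_def)
  ultimately show "vsupp x \<in> edges G" by simp
qed

lemma edge_interior_coord:
  assumes "finite_simple_graph G" "x \<in> topspace (realization G)" "card (vsupp x) = 2"
  shows "x v \<noteq> 1"
proof
  assume "x v = 1"
  then have "x = vertex_point v" by (rule realization_point_eq_1[OF assms(1,2)])
  then have "vsupp x = {v}" by (auto simp: vsupp_def vertex_point_def)
  then show False using assms(3) by simp
qed

text \<open>The two coordinates on an edge sum to 1, so either one determines the point. This is why
  one end per edge suffices to order the particles on it.\<close>

lemma edge_point_eqI:
  assumes G: "finite_simple_graph G" and x: "x \<in> topspace (realization G)" "y \<in> topspace (realization G)"
    and s: "vsupp x = vsupp y" "card (vsupp x) = 2" and v: "v \<in> vsupp x" "x v = y v"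
  shows "x = y"
proof -
  obtain u where u: "vsupp x = {u, v}" "u \<noteq> v"
  proof -
    obtain a b where ab: "vsupp x = {a, b}" "a \<noteq> b" using s(2) by (auto simp: card_2_iff)
    then show thesis using that[of a] that[of b] v(1) by (cases "v = a") (auto simp: insert_commute)
  qed
  have "x u + x v = 1" "y u + y v = 1"
    using sum_realization_point[OF G x(1), of "{u, v}"] sum_realization_point[OF G x(2), of "{u, v}"] u s by auto
  show ?thesis
  proof
    fix w show "x w = y w"
    proof (cases "w \<in> {u, v}")
      case True
      then show ?thesis using v(2) \<open>x u + x v = 1\<close> \<open>y u + y v = 1\<close> by auto
    next
      case False
      then have "w \<notin> vsupp x" "w \<notin> vsupp y" using u s by auto
      then show ?thesis by (simp add: vsupp_def)
    qed
  qed
qed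

text \<open>The realization is not convex; segments stay in it when both ends lie in a common
  simplex.\<close>

lemma realization_convex:
  assumes G: "finite_simple_graph G" and x: "x \<in> topspace (realization G)" and y: "y \<in> topspace (realization G)"
    and s: "s \<in> graph_simplices G" "vsupp x \<subseteq> s" "vsupp y \<subseteq> s" and t: "0 \<le> t" "t \<le> 1"
  shows "(\<lambda>v. (1 - t) * x v + t * y v) \<in> topspace (realization G)"
proof -
  have "finite s" using simplex_finite[OF G s(1)] .
  then have "(\<Sum>v\<in>s. (1 - t) * x v + t * y v) = 1"
    using sum_realization_point[OF G x _ s(2)] sum_realization_point[OF G y _ s(3)]
    by (simp add: sum.distrib flip: sum_distrib_left)
  moreover have "vsupp (\<lambda>v. (1 - t) * x v + t * y v) \<subseteq> s"
  proof (rule subsetI, rule ccontr)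
    fix v assume v: "v \<in> vsupp (\<lambda>v. (1 - t) * x v + t * y v)" "v \<notin> s"
    then have "x v = 0" "y v = 0" using not_in_vsupp[OF s(2)] not_in_vsupp[OF s(3)] by simp_all
    then show False using v(1) by (simp add: vsupp_iff)
  qed
  ultimately show ?thesis
    using s(1) t realization_point_nonneg[OF x] realization_point_nonneg[OF y] by (auto simp: realization_points)
qed

lemma continuous_map_realization_coord: "continuous_map (realization G) euclideanreal (\<lambda>x. x v)"
  unfolding realization_def
  by (rule continuous_map_from_subtopology) (auto intro: continuous_map_product_projection[of v UNIV "\<lambda>_. euclideanreal", simplified])

lemma topspace_Conf:
  "topspace (Conf m (realization G)) = {x \<in> {1..m} \<rightarrow>\<^sub>E topspace (realization G). inj_on x {1..m}}"
  by (auto simp: Conf_def)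

lemma continuous_map_Conf_coord:
  assumes "j \<in> {1..m}"
  shows "continuous_map (Conf m (realization G)) euclideanreal (\<lambda>x. x j v)"
proof -
  have "continuous_map (Conf m (realization G)) (realization G) (\<lambda>x. x j)"
    unfolding Conf_def by (intro continuous_map_from_subtopology continuous_map_product_projection assms)
  from continuous_map_compose[OF this continuous_map_realization_coord, of v] show ?thesis by (simp add: o_def)
qed

text \<open>Configuration spaces are subspaces of iterated products of the real line, so continuity
  is checked on real coordinates.\<close>

lemma continuous_map_into_Conf:
  assumes "f \<in> topspace Y \<rightarrow> topspace (Conf m (realization G))"
    and "\<And>j v. j \<in> {1..m} \<Longrightarrow> continuous_map Y euclideanreal (\<lambda>y. f y j v)"
  shows "continuous_map Y (Conf m (realization G)) f"
proof -
  have 1: "f y j \<in> topspace (realization G)" if "y \<in> topspace Y" "j \<in> {1..m}" for y j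
    using funcset_mem[OF assms(1) that(1)] that(2) by (auto simp: topspace_Conf)
  have "continuous_map Y (realization G) (\<lambda>y. f y j)" if j: "j \<in> {1..m}" for j
    unfolding realization_def continuous_map_in_subtopology
  proof
    show "continuous_map Y (powertop_real UNIV) (\<lambda>y. f y j)"
      using assms(2)[OF j] by (simp add: continuous_map_componentwise_UNIV)
    show "(\<lambda>y. f y j) \<in> topspace Y \<rightarrow> {x. (\<forall>v. 0 \<le> x v) \<and> (\<exists>s\<in>graph_simplices G. {v. x v \<noteq> 0} \<subseteq> s \<and> (\<Sum>v\<in>s. x v) = 1)}"
      using 1[OF _ j] by (auto simp: realization_points vsupp_def)
  qed
  moreover have "f \<in> topspace Y \<rightarrow> extensional {1..m}" "f \<in> topspace Y \<rightarrow> {x. inj_on x {1..m}}"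
    using assms(1) unfolding topspace_Conf Pi_iff PiE_def by auto
  ultimately show ?thesis unfolding Conf_def continuous_map_in_subtopology
    by (auto simp: continuous_map_componentwise)
qed

subsection \<open>Maps induced by injective graph homomorphisms\<close>

lemma realization_map_apply:
  "inj_on \<phi> (verts G) \<Longrightarrow> v \<in> verts G \<Longrightarrow> realization_map G \<phi> x (\<phi> v) = x v"
proof -
  assume "inj_on \<phi> (verts G)" "v \<in> verts G"
  then have "{u. u \<in> verts G \<and> \<phi> u = \<phi> v} = {v}" by (auto dest: inj_onD)
  then show ?thesis by (simp add: realization_map_def)
qed

lemma realization_map_outside:
  assumes "w \<notin> \<phi> ` verts G"
  shows "realization_map G \<phi> x w = 0"
proof -
  have "{u. u \<in> verts G \<and> \<phi> u = w} = {}" using assms by blast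
  then show ?thesis unfolding realization_map_def by (simp only: sum.empty)
qed

lemma realization_map_point:
  assumes G: "finite_simple_graph G" and inj: "inj_on \<phi> (verts G)"
    and simp: "\<And>s. s \<in> graph_simplices G \<Longrightarrow> \<phi> ` s \<in> graph_simplices G'"
    and x: "x \<in> topspace (realization G)"
  shows "realization_map G \<phi> x \<in> topspace (realization G')"
proof -
  obtain s where s: "s \<in> graph_simplices G" "vsupp x \<subseteq> s" "s \<subseteq> verts G" "sum x s = 1"
    using G x by (rule realization_pointE)
  have nn: "0 \<le> realization_map G \<phi> x w" for w
    unfolding realization_map_def using realization_point_nonneg[OF x] by (intro sum_nonneg) auto
  have "vsupp (realization_map G \<phi> x) \<subseteq> \<phi> ` s"
  proof
    fix w assume w: "w \<in> vsupp (realization_map G \<phi> x)"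
    then have "w \<in> \<phi> ` verts G" using realization_map_outside[of w \<phi> G x] by (auto simp: vsupp_def)
    then obtain v where v: "v \<in> verts G" "w = \<phi> v" by auto
    then have "x v \<noteq> 0" using w realization_map_apply[OF inj v(1), of x] by (simp add: vsupp_def)
    then show "w \<in> \<phi> ` s" using s(2) v(2) by (auto simp: vsupp_def)
  qed
  moreover have "sum (realization_map G \<phi> x) (\<phi> ` s) = 1"
  proof -
    have "sum (realization_map G \<phi> x) (\<phi> ` s) = (\<Sum>v\<in>s. realization_map G \<phi> x (\<phi> v))"
      using inj_on_subset[OF inj s(3)] by (simp add: sum.reindex o_def)
    also have "\<dots> = sum x s" using realization_map_apply[OF inj] s(3) by (intro sum.cong) auto
    finally show ?thesis using s(4) by simp
  qed
  ultimately show ?thesis using nn simp[OF s(1)] by (auto simp: realization_points)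
qed

lemma realization_map_inject:
  assumes G: "finite_simple_graph G" and inj: "inj_on \<phi> (verts G)"
    and x: "x \<in> topspace (realization G)" "y \<in> topspace (realization G)"
    and eq: "realization_map G \<phi> x = realization_map G \<phi> y"
  shows "x = y"
proof
  fix v show "x v = y v"
  proof (cases "v \<in> verts G")
    case True
    then show ?thesis using fun_cong[OF eq, of "\<phi> v"] realization_map_apply[OF inj] by simp
  next
    case False
    then show ?thesis using not_in_vsupp[OF vsupp_verts[OF G x(1)]] not_in_vsupp[OF vsupp_verts[OF G x(2)]] by simp
  qed
qed

subsection \<open>Two open conditions on configurations\<close>

text \<open>Both conditions on a particle are open, and a particle violating the first one sits on a
  vertex and hence satisfies the second one. So the two conditions cover, for each particle.\<close>

definition closest :: "nat \<Rightarrow> (nat \<Rightarrow> 'v \<Rightarrow> real) \<Rightarrow> nat \<Rightarrow> 'v \<Rightarrow> bool" where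
  "closest m x j v \<longleftrightarrow> 1/2 < x j v \<and> (\<forall>k\<in>{1..m} - {j}. x k v < x j v)"

text \<open>The sets \<open>e\<close> and \<open>w\<close> may overlap, which keeps the family
  closed under the intersections that the union theorem asks for.\<close>

definition Mode :: "nat \<Rightarrow> nat set \<Rightarrow> nat set \<Rightarrow> (nat \<Rightarrow> 'v \<Rightarrow> real) set" where
  "Mode m e w = {x. (\<forall>j\<in>e. \<forall>v. x j v \<noteq> 1) \<and> (\<forall>j\<in>w. \<exists>v. closest m x j v)}"

lemma Mode_empty [simp]: "Mode m {} {} = UNIV"
  by (simp add: Mode_def)

lemma Mode_Int: "Mode m (insert j e) w \<inter> Mode m e (insert j w) = Mode m (insert j e) (insert j w)"
  by (auto simp: Mode_def)

lemma Mode_mono: "Mode m (insert j e) w \<subseteq> Mode m e w" "Mode m e (insert j w) \<subseteq> Mode m e w"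
  by (auto simp: Mode_def)

lemma Mode_cover:
  assumes G: "finite_simple_graph G" and j: "j \<in> {1..m}"
    and x: "x \<in> topspace (Conf m (realization G))" "x \<in> Mode m e w"
  shows "x \<in> Mode m (insert j e) w \<union> Mode m e (insert j w)"
proof (cases "\<forall>v. x j v \<noteq> 1")
  case True
  then show ?thesis using x(2) by (simp add: Mode_def)
next
  case False
  then obtain v where v: "x j v = 1" by blast
  have pts: "x k \<in> topspace (realization G)" if "k \<in> {1..m}" for k using x(1) that by (auto simp: topspace_Conf)
  have inj: "inj_on x {1..m}" using x(1) by (simp add: topspace_Conf)
  have "closest m x j v" unfolding closest_def
  proof (intro conjI ballI)
    fix k assume k: "k \<in> {1..m} - {j}"
    have "x k v \<noteq> 1"
    proof
      assume "x k v = 1"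
      then have "x k = x j"
        using realization_point_eq_1[OF G pts, of k v] realization_point_eq_1[OF G pts[OF j] v] k by simp
      then show False using inj k j by (auto dest: inj_onD)
    qed
    then show "x k v < x j v" using realization_point_le_1[OF G pts, of k v] k v by simp
  qed (simp add: v)
  then have "\<exists>v. closest m x j v" by blast
  then show ?thesis using x(2) by (auto simp: Mode_def)
qed

lemma openin_less:
  assumes "continuous_map X euclideanreal f" "continuous_map X euclideanreal g"
  shows "openin X {x \<in> topspace X. f x < g x}"
proof -
  have "continuous_map X euclideanreal (\<lambda>x. g x - f x)" using assms by (intro continuous_map_diff)
  from openin_continuous_map_preimage[OF this, of "{0<..}"] show ?thesis by simp
qed

lemma openin_Ball:
  assumes "finite J" "\<And>j. j \<in> J \<Longrightarrow> openin X {x \<in> topspace X. P j x}"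
  shows "openin X {x \<in> topspace X. \<forall>j\<in>J. P j x}"
  using assms
proof (induction J rule: finite_induct)
  case (insert j J)
  have "{x \<in> topspace X. \<forall>j\<in>insert j J. P j x} = {x \<in> topspace X. P j x} \<inter> {x \<in> topspace X. \<forall>j\<in>J. P j x}" by auto
  then show ?case using insert by (simp add: openin_Int)
qed simp

lemma openin_Bex:
  assumes "\<And>j. j \<in> J \<Longrightarrow> openin X {x \<in> topspace X. P j x}"
  shows "openin X {x \<in> topspace X. \<exists>j\<in>J. P j x}"
proof -
  have "{x \<in> topspace X. \<exists>j\<in>J. P j x} = (\<Union>j\<in>J. {x \<in> topspace X. P j x})" by auto
  then show ?thesis using assms by auto
qed

lemma openin_conj:
  assumes "openin X {x \<in> topspace X. P x}" "openin X {x \<in> topspace X. Q x}"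
  shows "openin X {x \<in> topspace X. P x \<and> Q x}"
proof -
  have "{x \<in> topspace X. P x \<and> Q x} = {x \<in> topspace X. P x} \<inter> {x \<in> topspace X. Q x}" by auto
  then show ?thesis using assms by (simp add: openin_Int)
qed

lemma openin_closest:
  assumes "j \<in> {1..m}"
  shows "openin (Conf m (realization G)) {x \<in> topspace (Conf m (realization G)). closest m x j v}"
  unfolding closest_def
  by (intro openin_conj openin_Ball openin_less continuous_map_Conf_coord) (use assms in auto)

lemma openin_Mode:
  assumes G: "finite_simple_graph G" and ew: "e \<subseteq> {1..m}" "w \<subseteq> {1..m}"
  shows "openin (Conf m (realization G)) (topspace (Conf m (realization G)) \<inter> Mode m e w)"
proof -
  let ?C = "Conf m (realization G)"
  have fin: "finite e" "finite w" "finite (verts G)"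
    using ew G finite_subset by (auto simp: finite_simple_graph_def)
  have pts: "x k \<in> topspace (realization G)" if "x \<in> topspace ?C" "k \<in> {1..m}" for x k
    using that by (auto simp: topspace_Conf)
  have out: "x k v = 0" if "x \<in> topspace ?C" "k \<in> {1..m}" "v \<notin> verts G" for x k v
    using vsupp_verts[OF G pts[OF that(1,2)]] that(3) by (auto simp: vsupp_def)
  \<comment> \<open>Openness needs finitely many strict inequalities. Quantifiers over all of the
    vertex type are cut down to \<open>verts G\<close>, off which coordinates vanish, and being
    different from 1 becomes being less than 1.\<close>
  have "topspace ?C \<inter> Mode m e w = {x \<in> topspace ?C. (\<forall>j\<in>e. \<forall>v\<in>verts G. x j v < 1) \<and> (\<forall>j\<in>w. \<exists>v\<in>verts G. closest m x j v)}"
  proof (intro equalityI subsetI)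
    fix x assume x: "x \<in> topspace ?C \<inter> Mode m e w"
    have "x j v < 1" if "j \<in> e" for j v
    proof -
      have "x j v \<noteq> 1" using x that by (simp add: Mode_def)
      moreover have "x j v \<le> 1" using realization_point_le_1[OF G pts] x that ew by blast
      ultimately show ?thesis by simp
    qed
    moreover have "\<exists>v\<in>verts G. closest m x j v" if "j \<in> w" for j
    proof -
      have "\<exists>v. closest m x j v" using x that by (simp add: Mode_def)
      then obtain v where v: "closest m x j v" ..
      then have "x j v \<noteq> 0" by (auto simp: closest_def)
      then have "v \<in> verts G" using out[of x j v] x that ew by blast
      then show ?thesis using v by blast
    qed
    ultimately show "x \<in> {x \<in> topspace ?C. (\<forall>j\<in>e. \<forall>v\<in>verts G. x j v < 1) \<and> (\<forall>j\<in>w. \<exists>v\<in>verts G. closest m x j v)}"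
      using x by simp
  next
    fix x assume x: "x \<in> {x \<in> topspace ?C. (\<forall>j\<in>e. \<forall>v\<in>verts G. x j v < 1) \<and> (\<forall>j\<in>w. \<exists>v\<in>verts G. closest m x j v)}"
    have "x j v \<noteq> 1" if "j \<in> e" for j v
      using x that ew out[of x j v] by (cases "v \<in> verts G") force+
    then show "x \<in> topspace ?C \<inter> Mode m e w" using x by (auto simp: Mode_def)
  qed
  moreover have "openin ?C {x \<in> topspace ?C. (\<forall>j\<in>e. \<forall>v\<in>verts G. x j v < 1) \<and> (\<forall>j\<in>w. \<exists>v\<in>verts G. closest m x j v)}"
  proof (intro openin_conj openin_Ball openin_Bex openin_less fin)
    show "continuous_map ?C euclideanreal (\<lambda>x. x j v)" if "j \<in> e" for j v
      using that ew by (intro continuous_map_Conf_coord) auto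
    show "openin ?C {x \<in> topspace ?C. closest m x j v}" if "j \<in> w" for j v
      using that ew by (intro openin_closest) auto
  qed simp
  ultimately show ?thesis by simp
qed

subsection \<open>Contractible pieces\<close>

text \<open>When every particle satisfies one of the two conditions, the combinatorial type of a
  configuration is locally constant: the edges carrying the particles in \<open>e\<close>, the vertices
  near the particles in \<open>w\<close>, and the order along each edge, read off from the coordinate at a
  chosen end of the edge. All defining inequalities of a piece are linear, so a piece is star-shaped
  about any configuration in it whose particles outside \<open>e\<close> sit on vertices.\<close>

definition base_vertex :: "'v set \<Rightarrow> 'v" where
  "base_vertex s = (SOME v. v \<in> s)"

definition near :: "(nat \<Rightarrow> 'v \<Rightarrow> real) \<Rightarrow> nat \<Rightarrow> 'v set" where
  "near x j = {v. 1/2 < x j v}"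

locale conf_pieces =
  fixes G :: "'v graph" and m :: nat and e w :: "nat set"
  assumes G: "finite_simple_graph G" and ew: "e \<union> w = {1..m}"
begin

abbreviation "pts \<equiv> topspace (realization G)"
abbreviation "C \<equiv> Conf m (realization G)"
abbreviation "T \<equiv> topspace C \<inter> Mode m e w"

definition ord :: "(nat \<Rightarrow> 'v \<Rightarrow> real) \<Rightarrow> (nat \<times> nat) set" where
  "ord x = {(i, j). i \<in> e \<and> j \<in> e \<and> vsupp (x i) = vsupp (x j) \<and>
     x i (base_vertex (vsupp (x i))) < x j (base_vertex (vsupp (x i)))}"

text \<open>Components for conditions that are not imposed are blanked out, since they could vary
  within a piece.\<close>

definition ctype :: "(nat \<Rightarrow> 'v \<Rightarrow> real) \<Rightarrow> (nat \<Rightarrow> 'v set \<times> 'v set) \<times> (nat \<times> nat) set" where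
  "ctype x = ((\<lambda>j\<in>{1..m}. (if j \<in> e then vsupp (x j) else {}, if j \<in> w then near x j else {})), ord x)"

text \<open>Given by strict linear inequalities rather than as a fibre of \<open>ctype\<close>, so
  that openness and star-shapedness can be read off. The two descriptions agree by
  \<open>piece_eq\<close>, and the fibres give disjointness and the count.\<close>

definition piece :: "(nat \<Rightarrow> 'v \<Rightarrow> real) \<Rightarrow> (nat \<Rightarrow> 'v \<Rightarrow> real) set" where
  "piece x = {y \<in> {1..m} \<rightarrow>\<^sub>E pts. (\<forall>j\<in>e. \<forall>v\<in>vsupp (x j). 0 < y j v) \<and>
     (\<forall>j\<in>w. \<forall>v\<in>near x j. closest m y j v) \<and>
     (\<forall>(i, j)\<in>ord x. y i (base_vertex (vsupp (x i))) < y j (base_vertex (vsupp (x i))))}"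

lemma ew_sub: "j \<in> e \<Longrightarrow> j \<in> {1..m}" "j \<in> w \<Longrightarrow> j \<in> {1..m}" "j \<in> {1..m} \<Longrightarrow> j \<notin> e \<Longrightarrow> j \<in> w"
  using ew by blast+

lemma fin_ew: "finite e" "finite w"
  using ew by (metis finite_Un finite_atLeastAtMost)+

lemma T_pts: "x \<in> T \<Longrightarrow> j \<in> {1..m} \<Longrightarrow> x j \<in> pts"
  by (auto simp: topspace_Conf)

lemma T_edge: "x \<in> T \<Longrightarrow> j \<in> e \<Longrightarrow> card (vsupp (x j)) = 2 \<and> vsupp (x j) \<in> edges G"
proof -
  assume x: "x \<in> T" "j \<in> e"
  then have "\<forall>v. x j v \<noteq> 1" by (auto simp: Mode_def)
  then show ?thesis using vsupp_edge[OF G T_pts[OF x(1) ew_sub(1)[OF x(2)]]] by simp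
qed

lemma near_unique: "x j \<in> pts \<Longrightarrow> v \<in> near x j \<Longrightarrow> v' \<in> near x j \<Longrightarrow> v = v'"
  using realization_two_coords[OF G, of "x j" v v'] by (auto simp: near_def)

lemma T_closest:
  assumes "x \<in> T" "j \<in> w"
  shows "\<exists>v. near x j = {v} \<and> closest m x j v"
proof -
  have "\<exists>v. closest m x j v" using assms by (simp add: Mode_def)
  then obtain v where v: "closest m x j v" ..
  then have "v \<in> near x j" by (simp add: closest_def near_def)
  then have "near x j = {v}" using near_unique[of x j, OF T_pts[OF assms(1) ew_sub(2)[OF assms(2)]]] by blast
  then show ?thesis using v by blast
qed

lemma base_vertex_in: "s \<noteq> {} \<Longrightarrow> base_vertex s \<in> s"
  unfolding base_vertex_def by (rule someI_ex) blast

lemma piece_self: "x \<in> T \<Longrightarrow> x \<in> piece x"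
proof -
  assume x: "x \<in> T"
  have "0 < x j v" if "j \<in> e" "v \<in> vsupp (x j)" for j v
    using realization_point_nonneg[OF T_pts[OF x ew_sub(1)[OF that(1)]], of v] that(2) by (simp add: vsupp_iff)
  moreover have "closest m x j v" if "j \<in> w" "v \<in> near x j" for j v
    using T_closest[OF x that(1)] that(2) by auto
  moreover have "x \<in> {1..m} \<rightarrow>\<^sub>E pts" using x by (simp add: topspace_Conf)
  ultimately show ?thesis unfolding piece_def ord_def by auto
qed

text \<open>Positivity at both ends of the edge forces the support to contain that edge, and a
  support has no more than two elements.\<close>

lemma piece_supp:
  assumes x: "x \<in> T" and y: "y \<in> piece x" and j: "j \<in> e"
  shows "vsupp (y j) = vsupp (x j)"
proof -
  have yp: "y j \<in> pts" using y ew_sub(1)[OF j] by (auto simp: piece_def)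
  have sub: "vsupp (x j) \<subseteq> vsupp (y j)"
  proof
    fix v assume "v \<in> vsupp (x j)"
    then have "0 < y j v" using y j by (simp add: piece_def)
    then show "v \<in> vsupp (y j)" by (simp add: vsupp_iff)
  qed
  obtain s where s: "vsupp (y j) \<subseteq> s" "finite s" "card s \<le> 2" using G yp by (rule realization_pointE)
  have "card (vsupp (y j)) \<le> card (vsupp (x j))"
    using card_mono[OF s(2,1)] s(3) T_edge[OF x j] by simp
  then show ?thesis using card_seteq[OF finite_vsupp[OF G yp] sub] by simp
qed

lemma piece_near:
  assumes x: "x \<in> T" and y: "y \<in> piece x" and j: "j \<in> w"
  shows "near y j = near x j" "\<And>v. v \<in> near x j \<Longrightarrow> closest m y j v"
proof -
  show cl: "closest m y j v" if "v \<in> near x j" for v using y j that by (simp add: piece_def)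
  obtain v where v: "near x j = {v}" using T_closest[OF x j] by blast
  then have vy: "v \<in> near y j" using cl[of v] by (simp add: closest_def near_def)
  have "y j \<in> pts" using y ew_sub(2)[OF j] by (auto simp: piece_def)
  then have "v' = v" if "v' \<in> near y j" for v' using near_unique[of y j v' v] that vy by blast
  then have "near y j \<subseteq> {v}" by (intro subsetI) simp
  then show "near y j = near x j" unfolding v using vy by (intro equalityI) simp_all
qed

text \<open>Coinciding particles cannot include a strictly closest one, so both are in
  \<open>e\<close> and on the same edge of \<open>x\<close>. There they are distinct in
  \<open>x\<close>, hence comparable, and the order condition separates them.\<close>

lemma piece_inj:
  assumes x: "x \<in> T" and y: "y \<in> piece x"
  shows "inj_on y {1..m}"
proof (rule inj_onI, rule ccontr)
  fix i j assume ij: "i \<in> {1..m}" "j \<in> {1..m}" "y i = y j" "i \<noteq> j"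
  have notw: "k \<notin> w" if kl: "k \<in> {1..m}" "l \<in> {1..m}" "y k = y l" "k \<noteq> l" for k l
  proof
    assume k: "k \<in> w"
    obtain v where "v \<in> near x k" using T_closest[OF x k] by blast
    then have "closest m y k v" by (rule piece_near(2)[OF x y k])
    then have "y l v < y k v" using kl by (auto simp: closest_def)
    then show False using kl(3) by simp
  qed
  have i: "i \<in> e" using notw[of i j] ij ew_sub(3) by blast
  have j: "j \<in> e" using notw[of j i] ij ew_sub(3) by metis
  have s: "vsupp (x i) = vsupp (x j)" using piece_supp[OF x y i] piece_supp[OF x y j] ij(3) by simp
  let ?v = "base_vertex (vsupp (x i))"
  have c2: "card (vsupp (x i)) = 2" using T_edge[OF x i] by blast
  then have v: "?v \<in> vsupp (x i)" by (intro base_vertex_in) auto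
  have "x i \<noteq> x j" using x ij by (auto simp: topspace_Conf dest: inj_onD)
  then have "x i ?v \<noteq> x j ?v"
    using edge_point_eqI[OF G T_pts[OF x ij(1)] T_pts[OF x ij(2)] s c2 v] by blast
  then have "(i, j) \<in> ord x \<or> (j, i) \<in> ord x" using i j s unfolding ord_def by auto
  then have "y i ?v < y j ?v \<or> y j ?v < y i ?v" using y s unfolding piece_def by auto
  then show False using ij(3) by simp
qed

lemma piece_T:
  assumes x: "x \<in> T" and y: "y \<in> piece x"
  shows "y \<in> T"
proof
  show "y \<in> topspace C" using piece_inj[OF x y] y by (simp add: topspace_Conf piece_def)
  have "y j v \<noteq> 1" if "j \<in> e" for j v
  proof -
    have "y j \<in> pts" using y ew_sub(1)[OF that] by (auto simp: piece_def)
    moreover have "card (vsupp (y j)) = 2" using piece_supp[OF x y that] T_edge[OF x that] by simp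
    ultimately show ?thesis by (rule edge_interior_coord[OF G])
  qed
  moreover have "\<exists>v. closest m y j v" if "j \<in> w" for j
    using T_closest[OF x that] piece_near(2)[OF x y that] by blast
  ultimately show "y \<in> Mode m e w" by (simp add: Mode_def)
qed

text \<open>The order of \<open>x\<close> persists in \<open>y\<close>. It compares any two
  particles on the same edge, so \<open>y\<close> has no room for a further, contrary
  comparison.\<close>

lemma piece_ord:
  assumes x: "x \<in> T" and y: "y \<in> piece x"
  shows "ord y = ord x"
proof -
  have sub: "(i, j) \<in> ord y" if ij: "(i, j) \<in> ord x" for i j
  proof -
    have ij': "i \<in> e" "j \<in> e" "vsupp (x i) = vsupp (x j)" using ij by (auto simp: ord_def)
    have "y i (base_vertex (vsupp (x i))) < y j (base_vertex (vsupp (x i)))"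
      using y ij unfolding piece_def by auto
    then show ?thesis using ij' piece_supp[OF x y] by (auto simp: ord_def)
  qed
  have "(i, j) \<in> ord x" if ij: "(i, j) \<in> ord y" for i j
  proof (rule ccontr)
    assume n: "(i, j) \<notin> ord x"
    have ij': "i \<in> e" "j \<in> e" "vsupp (y i) = vsupp (y j)"
      "y i (base_vertex (vsupp (y i))) < y j (base_vertex (vsupp (y i)))" using ij by (auto simp: ord_def)
    then have s: "vsupp (x i) = vsupp (x j)" using piece_supp[OF x y] by auto
    let ?v = "base_vertex (vsupp (x i))"
    have c2: "card (vsupp (x i)) = 2" using T_edge[OF x ij'(1)] by blast
    then have v: "?v \<in> vsupp (x i)" by (intro base_vertex_in) auto
    have "i \<noteq> j" using ij'(4) by auto
    then have "x i \<noteq> x j" using x ew_sub(1)[OF ij'(1)] ew_sub(1)[OF ij'(2)] by (auto simp: topspace_Conf dest: inj_onD)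
    then have "x i ?v \<noteq> x j ?v"
      using edge_point_eqI[OF G T_pts[OF x ew_sub(1)[OF ij'(1)]] T_pts[OF x ew_sub(1)[OF ij'(2)]] s c2 v] by blast
    then have "(j, i) \<in> ord x" using ij' s n unfolding ord_def by auto
    then have "(j, i) \<in> ord y" by (rule sub)
    then show False using ij' by (auto simp: ord_def)
  qed
  then show ?thesis using sub by auto
qed

lemma piece_ctype:
  assumes x: "x \<in> T" and y: "y \<in> piece x"
  shows "ctype y = ctype x"
proof -
  have "(if j \<in> e then vsupp (y j) else {}, if j \<in> w then near y j else {}) =
      (if j \<in> e then vsupp (x j) else {}, if j \<in> w then near x j else {})" for j
    using piece_supp[OF x y, of j] piece_near(1)[OF x y, of j] by simp
  then show ?thesis unfolding ctype_def using piece_ord[OF x y] by (simp only:)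
qed

lemma ctype_eqD:
  assumes "ctype x = ctype y"
  shows "j \<in> e \<Longrightarrow> vsupp (x j) = vsupp (y j)" "j \<in> w \<Longrightarrow> near x j = near y j" "ord x = ord y"
proof -
  have *: "(if j \<in> e then vsupp (x j) else {}, if j \<in> w then near x j else {}) =
      (if j \<in> e then vsupp (y j) else {}, if j \<in> w then near y j else {})" if "j \<in> {1..m}" for j
    using fun_cong[OF arg_cong[OF assms, of fst], of j] that by (simp add: ctype_def)
  show "j \<in> e \<Longrightarrow> vsupp (x j) = vsupp (y j)" using *[OF ew_sub(1)] by auto
  show "j \<in> w \<Longrightarrow> near x j = near y j" using *[OF ew_sub(2)] by auto
  show "ord x = ord y" using arg_cong[OF assms, of snd] by (simp add: ctype_def)
qed

lemma piece_cong:
  assumes "ctype x = ctype y"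
  shows "piece x = piece y"
proof -
  have *: "vsupp (x i) = vsupp (y i)" if "(i, j) \<in> ord y" for i j
    using that ctype_eqD(1)[OF assms, of i] by (auto simp: ord_def)
  show ?thesis unfolding piece_def
    using ctype_eqD(1)[OF assms] ctype_eqD(2)[OF assms] ctype_eqD(3)[OF assms] *
    by (intro Collect_cong conj_cong ball_cong refl) auto
qed

lemma piece_eq: "x \<in> T \<Longrightarrow> piece x = {y \<in> T. ctype y = ctype x}"
proof (intro equalityI subsetI)
  fix y assume x: "x \<in> T" and "y \<in> {y \<in> T. ctype y = ctype x}"
  then have y: "y \<in> T" "ctype y = ctype x" by simp_all
  show "y \<in> piece x" using piece_self[OF y(1)] piece_cong[OF y(2)] by simp
next
  fix y assume x: "x \<in> T" and y: "y \<in> piece x"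
  show "y \<in> {y \<in> T. ctype y = ctype x}" using piece_T[OF x y] piece_ctype[OF x y] by simp
qed

lemma piece_open:
  assumes x: "x \<in> T"
  shows "openin C (piece x)"
proof -
  have "finite (ord x)" by (rule finite_subset[of _ "e \<times> e"]) (use fin_ew in \<open>auto simp: ord_def\<close>)
  moreover have "finite (vsupp (x j))" if "j \<in> e" for j
    using T_edge[OF x that] by (intro card_ge_0_finite) simp
  moreover have "finite (near x j)" if "j \<in> w" for j
    using T_closest[OF x that] by auto
  ultimately have "openin C {y \<in> topspace C. (\<forall>j\<in>e. \<forall>v\<in>vsupp (x j). 0 < y j v) \<and>
     (\<forall>j\<in>w. \<forall>v\<in>near x j. closest m y j v) \<and>
     (\<forall>p\<in>ord x. y (fst p) (base_vertex (vsupp (x (fst p)))) < y (snd p) (base_vertex (vsupp (x (fst p)))))}"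
  proof (intro openin_conj openin_Ball fin_ew)
    show "openin C {y \<in> topspace C. 0 < y j v}" if "j \<in> e" for j v
      by (intro openin_less continuous_map_Conf_coord[OF ew_sub(1)[OF that]]) simp
    show "openin C {y \<in> topspace C. closest m y j v}" if "j \<in> w" for j v
      by (rule openin_closest[OF ew_sub(2)[OF that]])
    show "openin C {y \<in> topspace C. y (fst p) (base_vertex (vsupp (x (fst p)))) < y (snd p) (base_vertex (vsupp (x (fst p))))}"
      if "p \<in> ord x" for p
    proof -
      have "fst p \<in> e" "snd p \<in> e" using that by (auto simp: ord_def)
      then have "fst p \<in> {1..m}" "snd p \<in> {1..m}" by (simp_all only: ew_sub(1))
      then show ?thesis by (intro openin_less continuous_map_Conf_coord)
    qed
  qed
  also have "{y \<in> topspace C. (\<forall>j\<in>e. \<forall>v\<in>vsupp (x j). 0 < y j v) \<and>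
     (\<forall>j\<in>w. \<forall>v\<in>near x j. closest m y j v) \<and>
     (\<forall>p\<in>ord x. y (fst p) (base_vertex (vsupp (x (fst p)))) < y (snd p) (base_vertex (vsupp (x (fst p)))))} = piece x"
    using piece_inj[OF x] by (auto simp: piece_def topspace_Conf)
  finally show ?thesis .
qed

text \<open>Particles in \<open>e\<close> stay where they are, even those that are also in
  \<open>w\<close>; the others move to their nearby vertex. Every point of a center thus lies in a
  simplex of the graph, with no reference to the degree.\<close>

definition center :: "(nat \<Rightarrow> 'v \<Rightarrow> real) \<Rightarrow> nat \<Rightarrow> 'v \<Rightarrow> real" where
  "center x = (\<lambda>j\<in>{1..m}. if j \<in> e then x j else vertex_point (base_vertex (near x j)))"

lemma center_e: "j \<in> e \<Longrightarrow> center x j = x j"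
  using ew_sub(1) by (simp add: center_def)

lemma center_w: "j \<in> {1..m} \<Longrightarrow> j \<notin> e \<Longrightarrow> near x j = {v} \<Longrightarrow> center x j = vertex_point v"
  by (simp add: center_def base_vertex_def)

lemma center_simplex:
  assumes x: "x \<in> T" and j: "j \<in> {1..m}"
  shows "\<exists>s\<in>graph_simplices G. vsupp (center x j) \<subseteq> s" "center x j \<in> pts"
proof -
  show "center x j \<in> pts"
  proof (cases "j \<in> e")
    case True
    then show ?thesis using T_pts[OF x j] by (simp add: center_e)
  next
    case False
    obtain v where v: "near x j = {v}" using T_closest[OF x ew_sub(3)[OF j False]] by blast
    then have "v \<in> vsupp (x j)" by (auto simp: near_def vsupp_iff)
    then have "v \<in> verts G" using vsupp_verts[OF G T_pts[OF x j]] by blast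
    then show ?thesis using center_w[OF j False v] vertex_point_realization by simp
  qed
  then show "\<exists>s\<in>graph_simplices G. vsupp (center x j) \<subseteq> s"
    using realization_pointE[OF G] by metis
qed

text \<open>What must be checked is closeness. A particle left on an edge has coordinate below 1, so
  it does not rival one moved to the vertex. Two moved particles go to different vertices, since
  only one can be strictly closest to a given vertex.\<close>

lemma center_piece:
  assumes x: "x \<in> T"
  shows "center x \<in> piece x"
  unfolding piece_def
proof (intro CollectI conjI ballI)
  show "center x \<in> {1..m} \<rightarrow>\<^sub>E pts" using center_simplex(2)[OF x] by (auto simp: center_def)
  show "0 < center x j v" if "j \<in> e" "v \<in> vsupp (x j)" for j v
    using piece_self[OF x] that by (simp add: center_e piece_def)
  show "case p of (i, j) \<Rightarrow> center x i (base_vertex (vsupp (x i))) < center x j (base_vertex (vsupp (x i)))"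
    if "p \<in> ord x" for p
    using that by (auto simp: ord_def center_e)
  fix j v assume j: "j \<in> w" and v: "v \<in> near x j"
  have jm: "j \<in> {1..m}" by (rule ew_sub(2)[OF j])
  have nj: "near x j = {v}" and cl: "closest m x j v" using T_closest[OF x j] v by auto
  have half: "1/2 < center x j v"
  proof (cases "j \<in> e")
    case True
    then show ?thesis using cl by (simp add: center_e closest_def)
  next
    case False
    then show ?thesis using center_w[OF jm False nj] by (simp add: vertex_point_def)
  qed
  moreover have "center x k v < center x j v" if k: "k \<in> {1..m} - {j}" for k
  proof (cases "k \<in> e")
    case True
    show ?thesis
    proof (cases "j \<in> e")
      case True
      then show ?thesis using cl k \<open>k \<in> e\<close> by (simp add: center_e closest_def)
    next
      case False
      have "x k v \<noteq> 1" using x \<open>k \<in> e\<close> by (simp add: Mode_def)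
      moreover have "x k v \<le> 1" using realization_point_le_1[OF G T_pts[OF x]] k by simp
      ultimately show ?thesis using center_w[OF jm False nj] \<open>k \<in> e\<close> by (simp add: center_e vertex_point_def)
    qed
  next
    case False
    then have kw: "k \<in> w" using k ew_sub(3) by blast
    obtain u where u: "near x k = {u}" "closest m x k u" using T_closest[OF x kw] by blast
    have "u \<noteq> v"
    proof
      assume "u = v"
      then have "x j v < x k v" "x k v < x j v" using u(2) cl k jm by (auto simp: closest_def)
      then show False by simp
    qed
    then have "center x k v = 0" using center_w[OF _ False u(1)] k by (simp add: vertex_point_def)
    then show ?thesis using half by simp
  qed
  ultimately show "closest m (center x) j v" by (simp add: closest_def)
qed

lemma segment_piece:
  assumes x: "x \<in> T" and y: "y \<in> piece x" and t: "0 \<le> t" "t \<le> 1"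
  shows "(\<lambda>j\<in>{1..m}. \<lambda>v. (1 - t) * y j v + t * center x j v) \<in> piece x" (is "?z \<in> _")
proof -
  have c: "center x \<in> piece x" by (rule center_piece[OF x])
  \<comment> \<open>A convex combination of two strict inequalities is strict; \<open>t = 0\<close>
    is separate because multiplying by \<open>t\<close> preserves strictness only for positive
    \<open>t\<close>.\<close>
  have lin: "(1 - t) * a + t * b < (1 - t) * a' + t * b'" if "a < a'" "b < b'" for a b a' b' :: real
  proof (cases "t = 0")
    case False
    then have "t * b < t * b'" "(1 - t) * a \<le> (1 - t) * a'" using that t by (auto intro: mult_left_mono)
    then show ?thesis by linarith
  qed (use that in simp)
  show ?thesis unfolding piece_def
  proof (intro CollectI conjI ballI)
    \<comment> \<open>Both ends of the segment lie in one simplex: a particle in \<open>e\<close>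
      has the same edge in \<open>y\<close> as in \<open>x\<close>, and the vertex to which another
      is moved is in the support of its position in \<open>y\<close>.\<close>
    have zp: "?z j \<in> pts" if j: "j \<in> {1..m}" for j
    proof -
      have yp: "y j \<in> pts" using y j by (auto simp: piece_def)
      obtain s where s: "s \<in> graph_simplices G" "vsupp (y j) \<subseteq> s" using realization_pointE[OF G yp] by metis
      have "vsupp (center x j) \<subseteq> s"
      proof (cases "j \<in> e")
        case True
        then show ?thesis using s(2) piece_supp[OF x y True] by (simp add: center_e)
      next
        case False
        have jw: "j \<in> w" by (rule ew_sub(3)[OF j False])
        obtain v where v: "near x j = {v}" using T_closest[OF x jw] by blast
        then have "v \<in> near y j" using piece_near(1)[OF x y jw] by simp
        then have "v \<in> vsupp (y j)" by (auto simp: near_def vsupp_iff)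
        then have "v \<in> s" using s(2) by blast
        then show ?thesis using center_w[OF j False v] by (auto simp: vsupp_iff vertex_point_def split: if_splits)
      qed
      then have "(\<lambda>v. (1 - t) * y j v + t * center x j v) \<in> pts"
        by (intro realization_convex[OF G yp center_simplex(2)[OF x j] s] t)
      then show ?thesis using j by simp
    qed
    then show "?z \<in> {1..m} \<rightarrow>\<^sub>E pts" by (intro PiE_I) (assumption | simp only: restrict_apply if_False)+
    show "0 < ?z j v" if "j \<in> e" "v \<in> vsupp (x j)" for j v
    proof -
      have "0 < y j v" "0 < center x j v" using y c that by (simp_all add: piece_def)
      from lin[OF this] show ?thesis using ew_sub(1)[OF that(1)] by simp
    qed
    show "case p of (i, j) \<Rightarrow> ?z i (base_vertex (vsupp (x i))) < ?z j (base_vertex (vsupp (x i)))"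
      if p: "p \<in> ord x" for p
    proof -
      obtain i j where ij: "p = (i, j)" by fastforce
      have "i \<in> e" "j \<in> e" using p ij by (auto simp: ord_def)
      then have ijm: "i \<in> {1..m}" "j \<in> {1..m}" using ew_sub(1) by auto
      have "y i (base_vertex (vsupp (x i))) < y j (base_vertex (vsupp (x i)))"
        "center x i (base_vertex (vsupp (x i))) < center x j (base_vertex (vsupp (x i)))"
        using y c p unfolding piece_def ij by auto
      from lin[OF this] show ?thesis using ijm unfolding ij by simp
    qed
    fix j v assume j: "j \<in> w" and v: "v \<in> near x j"
    have jm: "j \<in> {1..m}" by (rule ew_sub(2)[OF j])
    have cy: "closest m y j v" and cc: "closest m (center x) j v"
      using y c j v by (simp_all add: piece_def)
    show "closest m ?z j v" unfolding closest_def
    proof (intro conjI ballI)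
      have "1/2 < y j v" "1/2 < center x j v" using cy cc by (simp_all add: closest_def)
      from lin[OF this] show "1/2 < ?z j v" using jm by (simp add: field_simps)
      fix k assume k: "k \<in> {1..m} - {j}"
      have "y k v < y j v" "center x k v < center x j v" using cy cc k by (simp_all add: closest_def)
      from lin[OF this] show "?z k v < ?z j v" using jm k by simp
    qed
  qed
qed

lemma piece_contractible:
  assumes x: "x \<in> T"
  shows "homotopic_with (\<lambda>_. True) (subtopology C (piece x)) (subtopology C (piece x)) id (\<lambda>_. center x)"
proof -
  let ?P = "subtopology C (piece x)"
  have sub: "piece x \<subseteq> topspace C" using piece_T[OF x] by blast
  have tP: "topspace ?P = piece x" using sub by auto
  define h where "h = (\<lambda>(t, y). \<lambda>j\<in>{1..m}. \<lambda>v. (1 - t) * y j v + t * center x j v :: real)"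
  let ?I = "top_of_set {0..1::real}"
  have "continuous_map (prod_topology ?I ?P) ?P h"
    unfolding continuous_map_in_subtopology
  proof
    have hp: "h p \<in> piece x" if p: "p \<in> topspace (prod_topology ?I ?P)" for p
    proof -
      obtain t y where ty: "p = (t, y)" "0 \<le> t" "t \<le> 1" "y \<in> piece x" using p tP by auto
      show ?thesis using segment_piece[OF x ty(4,2,3)] by (simp add: ty(1) h_def)
    qed
    then show "h \<in> topspace (prod_topology ?I ?P) \<rightarrow> piece x" by blast
    show "continuous_map (prod_topology ?I ?P) C h"
    proof (rule continuous_map_into_Conf)
      show "h \<in> topspace (prod_topology ?I ?P) \<rightarrow> topspace C" using hp sub by blast
      fix j v assume j: "j \<in> {1..m}"
      have 1: "continuous_map (prod_topology ?I ?P) euclideanreal fst"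
        using continuous_map_fst[of ?I ?P] by (rule continuous_map_into_fulltopology)
      have "continuous_map (prod_topology ?I ?P) C snd"
        using continuous_map_snd[of ?I ?P] by (rule continuous_map_into_fulltopology)
      from continuous_map_compose[OF this continuous_map_Conf_coord[OF j, of G v]]
      have 2: "continuous_map (prod_topology ?I ?P) euclideanreal (\<lambda>p. snd p j v)" by (simp add: o_def)
      have "continuous_map (prod_topology ?I ?P) euclideanreal (\<lambda>p. (1 - fst p) * snd p j v + fst p * center x j v)"
        by (intro continuous_map_add continuous_map_real_mult continuous_map_diff 1 2) auto
      then show "continuous_map (prod_topology ?I ?P) euclideanreal (\<lambda>p. h p j v)"
        using j by (simp add: h_def case_prod_unfold)
    qed
  qed
  moreover have "h (0, y) = id y" "h (1, y) = center x" if "y \<in> topspace ?P" for y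
  proof -
    have "y \<in> extensional {1..m}" using that tP by (auto simp: piece_def PiE_def)
    then show "h (0, y) = id y" by (auto simp: h_def extensional_def fun_eq_iff)
    show "h (1, y) = center x" by (auto simp: h_def center_def fun_eq_iff)
  qed
  ultimately show ?thesis by (subst homotopic_with) auto
qed

section \<open>Counting and assembling the pieces\<close>

lemma finite_ctypes:
  "finite (ctype ` T)" "card (ctype ` T) \<le> (3 * card (verts G) ^ 2) ^ m * 2 ^ (m * m)"
proof -
  let ?V = "verts G"
  \<comment> \<open>Possible labels of one particle: near a vertex only, on an edge only, or on an
    edge and near one of its ends. Three labels for each ordered pair of vertices cover all
    cases.\<close>
  define Lab where "Lab = (\<Union>(u, v)\<in>?V \<times> ?V. {({}, {v}), ({u, v}, {}), ({u, v}, {v})})"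
  have fV: "finite ?V" using G by (simp add: finite_simple_graph_def)
  have fL: "finite Lab" unfolding Lab_def using fV by auto
  have "card Lab \<le> (\<Sum>p\<in>?V \<times> ?V. card (case p of (u, v) \<Rightarrow> {({}, {v}), ({u, v}, {}), ({u, v}, {v})}))"
    unfolding Lab_def using fV by (intro card_UN_le) auto
  also have "\<dots> \<le> (\<Sum>p\<in>?V \<times> ?V. 3)"
    by (intro sum_mono) (auto simp: card_insert_if)
  also have "\<dots> = 3 * card ?V ^ 2" by (simp add: card_cartesian_product power2_eq_square)
  finally have cL: "card Lab \<le> 3 * card ?V ^ 2" .
  \<comment> \<open>The order along the edges is a relation on the \<open>m\<close> particles, so it
    contributes a factor independent of the graph.\<close>
  let ?R = "({1..m} \<rightarrow>\<^sub>E Lab) \<times> Pow ({1..m} \<times> {1..m})"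
  have fR: "finite ?R" using fL by (auto intro!: finite_PiE)
  have "ctype x \<in> ?R" if x: "x \<in> T" for x
  proof -
    have "(if j \<in> e then vsupp (x j) else {}, if j \<in> w then near x j else {}) \<in> Lab" if j: "j \<in> {1..m}" for j
    proof -
      have sV: "vsupp (x j) \<subseteq> ?V" by (rule vsupp_verts[OF G T_pts[OF x j]])
      have 1: "\<exists>v\<in>vsupp (x j). near x j = {v}" if jw: "j \<in> w"
      proof -
        obtain v where v: "near x j = {v}" using T_closest[OF x jw] by blast
        then have "1/2 < x j v" by (auto simp: near_def)
        then show ?thesis using v by (intro bexI[of _ v]) (auto simp: vsupp_iff)
      qed
      have 2: "\<exists>u v. vsupp (x j) = {u, v}" if "j \<in> e"
        using T_edge[OF x that] by (auto simp: card_2_iff)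
      show ?thesis
      proof (cases "j \<in> e")
        case False
        then have "j \<in> w" using j ew_sub(3) by blast
        then obtain v where "v \<in> vsupp (x j)" "near x j = {v}" using 1 by blast
        then show ?thesis using False \<open>j \<in> w\<close> sV unfolding Lab_def by auto
      next
        case True
        then obtain u v where uv: "vsupp (x j) = {u, v}" using 2 by blast
        show ?thesis
        proof (cases "j \<in> w")
          case False
          then show ?thesis using True uv sV unfolding Lab_def by auto
        next
          case jw: True
          then obtain v' where "v' \<in> vsupp (x j)" "near x j = {v'}" using 1 by blast
          then have "(vsupp (x j) = {u, v} \<and> near x j = {v}) \<or> (vsupp (x j) = {v, u} \<and> near x j = {u})"
            using uv by auto
          then show ?thesis using True jw sV unfolding Lab_def by auto
        qed
      qed
    qed
    moreover have "ord x \<subseteq> {1..m} \<times> {1..m}" using ew_sub(1) by (auto simp: ord_def)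
    ultimately show ?thesis unfolding ctype_def by auto
  qed
  then have sub: "ctype ` T \<subseteq> ?R" by blast
  show "finite (ctype ` T)" by (rule finite_subset[OF sub fR])
  have "card (ctype ` T) \<le> card ?R" by (rule card_mono[OF fR sub])
  also have "\<dots> = card Lab ^ m * 2 ^ (m * m)"
    by (simp add: card_cartesian_product card_PiE card_Pow)
  also have "\<dots> \<le> (3 * card ?V ^ 2) ^ m * 2 ^ (m * m)"
    using cL by (intro mult_le_mono1 power_mono) auto
  finally show "card (ctype ` T) \<le> (3 * card ?V ^ 2) ^ m * 2 ^ (m * m)" .
qed

lemma pieces:
  "finite (piece ` T)" "card (piece ` T) \<le> (3 * card (verts G) ^ 2) ^ m * 2 ^ (m * m)"
  "pairwise disjnt (piece ` T)" "\<Union>(piece ` T) = T"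
proof -
  have "piece ` T = (\<lambda>\<tau>. {y \<in> T. ctype y = \<tau>}) ` ctype ` T" unfolding image_image using piece_eq by (intro image_cong) auto
  then show "finite (piece ` T)" "card (piece ` T) \<le> (3 * card (verts G) ^ 2) ^ m * 2 ^ (m * m)"
    using finite_ctypes card_image_le[OF finite_ctypes(1), of "\<lambda>\<tau>. {y \<in> T. ctype y = \<tau>}"] by auto
  show "pairwise disjnt (piece ` T)"
  proof (rule pairwiseI)
    fix A B assume AB: "A \<in> piece ` T" "B \<in> piece ` T" "A \<noteq> B"
    obtain x where x: "x \<in> T" "A = piece x" using AB(1) by (rule imageE)
    obtain y where y: "y \<in> T" "B = piece y" using AB(2) by (rule imageE)
    have "\<not> (z \<in> A \<and> z \<in> B)" for z
    proof
      assume z: "z \<in> A \<and> z \<in> B"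
      have "ctype x = ctype y"
        using piece_ctype[OF x(1), of z] piece_ctype[OF y(1), of z] z x(2) y(2) by simp
      then show False using piece_cong[of x y] x(2) y(2) AB(3) by simp
    qed
    then show "disjnt A B" unfolding disjnt_iff by (rule allI)
  qed
  show "\<Union>(piece ` T) = T"
  proof (intro equalityI subsetI)
    fix y assume "y \<in> \<Union>(piece ` T)"
    then obtain x where x: "x \<in> T" "y \<in> piece x" by (elim UnionE imageE) simp
    then show "y \<in> T" by (rule piece_T)
  next
    fix y assume "y \<in> T"
    then show "y \<in> \<Union>(piece ` T)" using UnionI[OF imageI[of y T piece] piece_self[of y]] by simp
  qed
qed

end

subsection \<open>Rational functionals on the real numbers\<close>

interpretation rat_real: vector_space "\<lambda>(q::rat) (x::real). of_rat q * x"
  by unfold_locales (simp_all add: algebra_simps of_rat_add of_rat_mult)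

definition hamel :: "real set" where "hamel = rat_real.extend_basis {}"

text \<open>A coordinate in a basis of the reals over the rationals, embedded back into the reals so
  that it can be applied to coefficients of real chains.\<close>

definition hcoord :: "real \<Rightarrow> real \<Rightarrow> real" where
  "hcoord b x = of_rat (rat_real.representation hamel x b)"

lemma hamel: "rat_real.independent hamel" "rat_real.span hamel = UNIV"
  unfolding hamel_def
  by (simp_all add: rat_real.independent_extend_basis rat_real.independent_empty rat_real.span_extend_basis)

lemma hcoord_add: "hcoord b (x + y) = hcoord b x + hcoord b y"
  unfolding hcoord_def using hamel by (simp add: rat_real.representation_add of_rat_add)

lemma hcoord_0 [simp]: "hcoord b 0 = 0"
  unfolding hcoord_def by (simp add: rat_real.representation_zero)

lemma hcoord_Rats: "hcoord b x \<in> \<rat>"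
  unfolding hcoord_def by simp

lemma hcoord_sum_nonzero:
  "finite {b. hcoord b x \<noteq> 0}" "(\<Sum>b | hcoord b x \<noteq> 0. hcoord b x * b) = x"
proof -
  show "finite {b. hcoord b x \<noteq> 0}"
    unfolding hcoord_def using rat_real.finite_representation[of hamel x] by simp
  show "(\<Sum>b | hcoord b x \<noteq> 0. hcoord b x * b) = x"
    unfolding hcoord_def using rat_real.sum_nonzero_representation_eq[of hamel x] hamel by simp
qed

lemma hcoord_nonzero: "x \<noteq> 0 \<Longrightarrow> \<exists>b. hcoord b x \<noteq> 0"
  using hcoord_sum_nonzero(2)[of x] by (metis (mono_tags, lifting) empty_Collect_eq sum.empty)

subsection \<open>Change of coefficients\<close>

lemma lookup_scaleR [simp]: "Poly_Mapping.lookup (r *\<^sub>R c) f = r *\<^sub>R Poly_Mapping.lookup c f"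
proof -
  have "finite {i. r *\<^sub>R Poly_Mapping.lookup c i \<noteq> 0}"
    by (rule finite_subset[OF _ finite_lookup[of c]]) auto
  then show ?thesis unfolding scaleR_poly_mapping_def by (simp add: Abs_poly_mapping_inverse)
qed

definition chain_coeffs :: "('b::zero \<Rightarrow> 'c::zero) \<Rightarrow> ('a \<Rightarrow>\<^sub>0 'b) \<Rightarrow> 'a \<Rightarrow>\<^sub>0 'c" where
  "chain_coeffs \<phi> c = Poly_Mapping.map \<phi> c"

lemma lookup_chain_coeffs: "\<phi> 0 = 0 \<Longrightarrow> Poly_Mapping.lookup (chain_coeffs \<phi> c) f = \<phi> (Poly_Mapping.lookup c f)"
  unfolding chain_coeffs_def by (simp add: map.rep_eq when_def)

lemma keys_chain_coeffs: "\<phi> 0 = 0 \<Longrightarrow> Poly_Mapping.keys (chain_coeffs \<phi> c) \<subseteq> Poly_Mapping.keys c"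
  by (auto simp: in_keys_iff lookup_chain_coeffs)

lemma chain_coeffs_add:
  "\<phi> 0 = 0 \<Longrightarrow> (\<And>x y. \<phi> (x + y) = \<phi> x + \<phi> y) \<Longrightarrow> chain_coeffs \<phi> (c + d) = chain_coeffs \<phi> c + chain_coeffs \<phi> d"
  by (rule poly_mapping_eqI) (simp add: lookup_chain_coeffs lookup_add)

lemma chain_coeffs_0 [simp]: "\<phi> 0 = 0 \<Longrightarrow> chain_coeffs \<phi> 0 = 0"
  by (rule poly_mapping_eqI) (simp add: lookup_chain_coeffs)

lemma chain_coeffs_sum:
  "\<phi> 0 = 0 \<Longrightarrow> (\<And>x y. \<phi> (x + y) = \<phi> x + \<phi> y) \<Longrightarrow> chain_coeffs \<phi> (\<Sum>i\<in>I. c i) = (\<Sum>i\<in>I. chain_coeffs \<phi> (c i))"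
  by (induction I rule: infinite_finite_induct) (simp_all add: chain_coeffs_add)

lemma chain_coeffs_single: "\<phi> 0 = 0 \<Longrightarrow> chain_coeffs \<phi> (Poly_Mapping.single f a) = Poly_Mapping.single f (\<phi> a)"
  by (rule poly_mapping_eqI) (simp add: lookup_chain_coeffs lookup_single when_def)

lemma real_boundary_superset:
  assumes "finite K" "Poly_Mapping.keys c \<subseteq> K" "p \<noteq> 0"
  shows "real_boundary p c = (\<Sum>f\<in>K. \<Sum>k\<le>p. Poly_Mapping.single (singular_face p k f) ((-1) ^ k * Poly_Mapping.lookup c f))"
  unfolding real_boundary_def using assms
  by (auto intro!: sum.mono_neutral_left sum.neutral simp: in_keys_iff)

lemma real_boundary_add: "real_boundary p (c + d) = real_boundary p c + real_boundary p d"
proof (cases "p = 0")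
  case False
  let ?K = "Poly_Mapping.keys c \<union> Poly_Mapping.keys d"
  have "real_boundary p (c + d) = (\<Sum>f\<in>?K. \<Sum>k\<le>p. Poly_Mapping.single (singular_face p k f) ((-1) ^ k * Poly_Mapping.lookup (c + d) f))"
    using False Poly_Mapping.keys_add[of c d] by (intro real_boundary_superset) auto
  also have "\<dots> = real_boundary p c + real_boundary p d"
    using False by (subst (1 2) real_boundary_superset[of ?K])
      (auto simp: lookup_add algebra_simps single_add sum.distrib)
  finally show ?thesis .
qed (simp add: real_boundary_def)

lemma real_boundary_scaleR: "real_boundary p (r *\<^sub>R c) = r *\<^sub>R real_boundary p c"
proof (cases "p = 0")
  case False
  have *: "Poly_Mapping.single f (r * a) = r *\<^sub>R Poly_Mapping.single f a" for f :: 'b and a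
    by (rule poly_mapping_eqI) (simp add: lookup_single when_def lookup_scaleR)
  have "real_boundary p (r *\<^sub>R c) = (\<Sum>f\<in>Poly_Mapping.keys c. \<Sum>k\<le>p. Poly_Mapping.single (singular_face p k f) ((-1) ^ k * Poly_Mapping.lookup (r *\<^sub>R c) f))"
    using False by (intro real_boundary_superset) (auto simp: in_keys_iff lookup_scaleR)
  also have "\<dots> = (\<Sum>f\<in>Poly_Mapping.keys c. \<Sum>k\<le>p. r *\<^sub>R Poly_Mapping.single (singular_face p k f) ((-1) ^ k * Poly_Mapping.lookup c f))"
    by (intro sum.cong refl) (simp add: lookup_scaleR mult.left_commute flip: *)
  also have "\<dots> = r *\<^sub>R real_boundary p c"
    using False by (simp add: real_boundary_def scaleR_right.sum)
  finally show ?thesis .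
qed (simp add: real_boundary_def)

lemma real_boundary_0 [simp]: "real_boundary p 0 = 0"
  by (simp add: real_boundary_def)

text \<open>The boundary has coefficients 1 and -1, so additivity of \<open>\<phi>\<close> is all
  that is used; the coordinates \<open>hcoord b\<close> are not linear over the reals.\<close>

lemma real_boundary_coeffs:
  assumes "\<phi> 0 = 0" "\<And>x y. \<phi> (x + y) = \<phi> x + \<phi> y"
  shows "real_boundary p (chain_coeffs \<phi> c) = chain_coeffs \<phi> (real_boundary p c)"
proof (cases "p = 0")
  case False
  have neg: "\<phi> (- x) = - \<phi> x" for x using assms(2)[of x "- x"] assms(1) by simp
  have sgn: "\<phi> ((-1) ^ k * x) = (-1) ^ k * \<phi> x" for k x
    by (cases "even k") (simp_all add: neg)
  have "real_boundary p (chain_coeffs \<phi> c) = (\<Sum>f\<in>Poly_Mapping.keys c. \<Sum>k\<le>p.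
      Poly_Mapping.single (singular_face p k f) ((-1) ^ k * Poly_Mapping.lookup (chain_coeffs \<phi> c) f))"
    using False assms(1) by (intro real_boundary_superset keys_chain_coeffs) auto
  also have "\<dots> = chain_coeffs \<phi> (real_boundary p c)"
    unfolding real_boundary_def using False assms
    by (simp add: chain_coeffs_sum chain_coeffs_single lookup_chain_coeffs sgn)
  finally show ?thesis .
qed (simp add: real_boundary_def assms)

definition of_int_chain :: "'a chain \<Rightarrow> 'a real_chain" where
  "of_int_chain c = chain_coeffs of_int c"

lemma lookup_of_int_chain: "Poly_Mapping.lookup (of_int_chain c) f = of_int (Poly_Mapping.lookup c f)"
  by (simp add: of_int_chain_def lookup_chain_coeffs)

lemma of_int_chain_add: "of_int_chain (c + d) = of_int_chain c + of_int_chain d"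
  unfolding of_int_chain_def by (rule chain_coeffs_add) auto

lemma of_int_chain_0 [simp]: "of_int_chain 0 = 0"
  by (simp add: of_int_chain_def)

lemma of_int_chain_sum: "of_int_chain (\<Sum>i\<in>I. c i) = (\<Sum>i\<in>I. of_int_chain (c i))"
  unfolding of_int_chain_def by (rule chain_coeffs_sum) auto

lemma of_int_chain_cmul: "of_int_chain (frag_cmul k c) = of_int k *\<^sub>R of_int_chain c"
  by (rule poly_mapping_eqI) (simp add: lookup_of_int_chain lookup_scaleR)

lemma of_int_chain_inject: "of_int_chain c = of_int_chain d \<longleftrightarrow> c = d"
  by (auto simp: poly_mapping_eq_iff fun_eq_iff lookup_of_int_chain)

lemma keys_of_int_chain: "Poly_Mapping.keys (of_int_chain c) = Poly_Mapping.keys c"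
  by (auto simp: in_keys_iff lookup_of_int_chain)

lemma real_boundary_of_int: "real_boundary p (of_int_chain c) = of_int_chain (chain_boundary p c)"
proof (cases "p = 0")
  case False
  have "chain_boundary p c = (\<Sum>f\<in>Poly_Mapping.keys c. frag_cmul (Poly_Mapping.lookup c f)
      (\<Sum>k\<le>p. frag_cmul ((-1) ^ k) (frag_of (singular_face p k f))))"
    using False by (simp add: chain_boundary_def frag_extend_def)
  moreover have "Poly_Mapping.single g ((-1) ^ k * of_int a) = of_int a *\<^sub>R (of_int ((-1) ^ k) *\<^sub>R of_int_chain (frag_of g))" for g :: "(nat \<Rightarrow> real) \<Rightarrow> 'a" and a k
    by (rule poly_mapping_eqI) (simp add: lookup_of_int_chain lookup_single when_def)
  ultimately show ?thesis using False
    by (simp add: real_boundary_def keys_of_int_chain lookup_of_int_chain of_int_chain_sum of_int_chain_cmul scaleR_right.sum del: of_int_power)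
qed (simp add: real_boundary_def chain_boundary_def)

lemma common_denominator:
  assumes "finite K" "\<And>f. f \<in> K \<Longrightarrow> g f \<in> (\<rat> :: real set)"
  shows "\<exists>N::int. N > 0 \<and> (\<forall>f\<in>K. of_int N * g f \<in> \<int>)"
  using assms
proof (induction K rule: finite_induct)
  case (insert h K)
  then obtain N :: int where N: "N > 0" "\<forall>f\<in>K. of_int N * g f \<in> \<int>" by auto
  obtain a b :: int where ab: "b > 0" "g h = of_int a / of_int b"
    using Rats_cases'[OF insert.prems[of h, OF insertI1]] by metis
  have "of_int (N * b) * g f \<in> \<int>" if "f \<in> insert h K" for f
  proof (cases "f = h")
    case True
    then have "of_int (N * b) * g f = of_int (N * a)" using ab by simp
    then show ?thesis by (metis Ints_of_int)
  next
    case False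
    then have "of_int N * g f \<in> \<int>" using N that by auto
    then have "of_int b * (of_int N * g f) \<in> \<int>" by (rule Ints_mult[OF Ints_of_int])
    moreover have "of_int (N * b) * g f = of_int b * (of_int N * g f)" by simp
    ultimately show ?thesis by (simp only:)
  qed
  then show ?case using N ab by (intro exI[of _ "N * b"]) auto
qed (auto intro: exI[of _ 1])

lemma clear_denominators:
  assumes "\<And>f. Poly_Mapping.lookup c f \<in> \<rat>"
  obtains N :: int and z where "N > 0" "of_int N *\<^sub>R c = of_int_chain z" "Poly_Mapping.keys z \<subseteq> Poly_Mapping.keys c"
proof -
  obtain N :: int where N: "N > 0" "\<forall>f\<in>Poly_Mapping.keys c. of_int N * Poly_Mapping.lookup c f \<in> \<int>"
    using common_denominator[OF finite_keys[of c], of "Poly_Mapping.lookup c"] assms by blast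
  \<comment> \<open>The multiplied coefficients are already integers; the floor only changes their
    type.\<close>
  define z where "z = chain_coeffs (\<lambda>x. \<lfloor>of_int N * x\<rfloor>) c"
  have "of_int N *\<^sub>R c = of_int_chain z"
  proof (rule poly_mapping_eqI)
    fix f
    have "of_int N * Poly_Mapping.lookup c f \<in> \<int>"
      using N(2) by (cases "f \<in> Poly_Mapping.keys c") (auto simp: in_keys_iff)
    then show "Poly_Mapping.lookup (of_int N *\<^sub>R c) f = Poly_Mapping.lookup (of_int_chain z) f"
      by (auto simp: z_def lookup_of_int_chain lookup_chain_coeffs lookup_scaleR elim: Ints_cases)
  qed
  moreover have "Poly_Mapping.keys z \<subseteq> Poly_Mapping.keys c" unfolding z_def by (rule keys_chain_coeffs) simp
  ultimately show thesis using N(1) that by blast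
qed

subsection \<open>Real homology as a vector space\<close>

definition real_class :: "nat \<Rightarrow> 'a topology \<Rightarrow> 'a real_chain \<Rightarrow> 'a real_chain set" where
  "real_class p X z = {z + b | b. b \<in> real_boundaries p X}"

lemma keys_scaleR_subset: "Poly_Mapping.keys (r *\<^sub>R c) \<subseteq> Poly_Mapping.keys (c :: 'a \<Rightarrow>\<^sub>0 real)"
  by (auto simp: in_keys_iff)

lemma real_chains_0: "0 \<in> real_chains p X"
  by (simp add: real_chains_def)

lemma real_chains_add: "c \<in> real_chains p X \<Longrightarrow> d \<in> real_chains p X \<Longrightarrow> c + d \<in> real_chains p X"
  unfolding real_chains_def using Poly_Mapping.keys_add[of c d] by blast

lemma real_chains_scaleR: "c \<in> real_chains p X \<Longrightarrow> r *\<^sub>R c \<in> real_chains p X"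
  unfolding real_chains_def using keys_scaleR_subset[of r c] by blast

lemma real_chains_coeffs: "\<phi> 0 = 0 \<Longrightarrow> c \<in> real_chains p X \<Longrightarrow> chain_coeffs \<phi> c \<in> real_chains p X"
  unfolding real_chains_def using keys_chain_coeffs[of \<phi> c] by blast

lemma real_cycles_0: "0 \<in> real_cycles p X"
  by (simp add: real_cycles_def real_chains_0)

lemma real_cycles_add: "c \<in> real_cycles p X \<Longrightarrow> d \<in> real_cycles p X \<Longrightarrow> c + d \<in> real_cycles p X"
  by (simp add: real_cycles_def real_chains_add real_boundary_add)

lemma real_cycles_scaleR: "c \<in> real_cycles p X \<Longrightarrow> r *\<^sub>R c \<in> real_cycles p X"
  by (simp add: real_cycles_def real_chains_scaleR real_boundary_scaleR)

lemma real_boundariesI: "e \<in> real_chains (Suc p) X \<Longrightarrow> real_boundary (Suc p) e \<in> real_boundaries p X"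
  by (simp add: real_boundaries_def)

lemma real_boundaries_0: "0 \<in> real_boundaries p X"
  using real_boundariesI[OF real_chains_0] by simp

lemma real_boundaries_add: "c \<in> real_boundaries p X \<Longrightarrow> d \<in> real_boundaries p X \<Longrightarrow> c + d \<in> real_boundaries p X"
proof -
  assume "c \<in> real_boundaries p X" "d \<in> real_boundaries p X"
  then obtain e e' where e: "e \<in> real_chains (Suc p) X" "c = real_boundary (Suc p) e"
      and e': "e' \<in> real_chains (Suc p) X" "d = real_boundary (Suc p) e'"
    unfolding real_boundaries_def by (elim imageE)
  show ?thesis using real_boundariesI[OF real_chains_add[OF e(1) e'(1)]] by (simp add: e(2) e'(2) real_boundary_add)
qed

lemma real_boundaries_scaleR: "c \<in> real_boundaries p X \<Longrightarrow> r *\<^sub>R c \<in> real_boundaries p X"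
proof -
  assume "c \<in> real_boundaries p X"
  then obtain e where e: "e \<in> real_chains (Suc p) X" "c = real_boundary (Suc p) e"
    unfolding real_boundaries_def by (elim imageE)
  show ?thesis using real_boundariesI[OF real_chains_scaleR[OF e(1)], of r] by (simp add: e(2) real_boundary_scaleR)
qed

lemma real_boundaries_uminus: "c \<in> real_boundaries p X \<Longrightarrow> - c \<in> real_boundaries p X"
  using real_boundaries_scaleR[of c p X "-1"] by simp

lemma real_class_eq_iff: "real_class p X z = real_class p X w \<longleftrightarrow> z - w \<in> real_boundaries p X"
proof
  assume "real_class p X z = real_class p X w"
  moreover have "z \<in> real_class p X z" using real_boundaries_0[of p X] by (force simp: real_class_def)
  ultimately obtain b where "b \<in> real_boundaries p X" "z = w + b" by (auto simp: real_class_def)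
  then show "z - w \<in> real_boundaries p X" by simp
next
  assume *: "z - w \<in> real_boundaries p X"
  have "real_class p X z' \<subseteq> real_class p X w'" if "z' - w' \<in> real_boundaries p X" for z' w'
  proof
    fix y assume "y \<in> real_class p X z'"
    then obtain b where b: "b \<in> real_boundaries p X" "y = z' + b" by (auto simp: real_class_def)
    then have "y = w' + ((z' - w') + b)" "(z' - w') + b \<in> real_boundaries p X"
      using real_boundaries_add[OF that b(1)] by (simp_all add: algebra_simps)
    then show "y \<in> real_class p X w'" unfolding real_class_def by blast
  qed
  from this[OF *] this[of w z] show "real_class p X z = real_class p X w"
    using real_boundaries_uminus[OF *] by auto
qed

lemma real_class_0: "real_class p X 0 = real_boundaries p X"
  by (simp add: real_class_def)

lemma real_class_add:
  "{a + b | a b. a \<in> real_class p X z \<and> b \<in> real_class p X w} = real_class p X (z + w)" (is "?L = ?R")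
proof
  show "?L \<subseteq> ?R"
  proof clarify
    fix a b assume "a \<in> real_class p X z" "b \<in> real_class p X w"
    then obtain s t where "s \<in> real_boundaries p X" "a = z + s" "t \<in> real_boundaries p X" "b = w + t"
      by (auto simp: real_class_def)
    then have "a + b = z + w + (s + t)" "s + t \<in> real_boundaries p X"
      by (auto simp: algebra_simps real_boundaries_add)
    then show "a + b \<in> ?R" unfolding real_class_def by blast
  qed
  show "?R \<subseteq> ?L"
  proof
    fix y assume "y \<in> ?R"
    then obtain s where s: "s \<in> real_boundaries p X" "y = z + w + s" by (auto simp: real_class_def)
    have "z + 0 \<in> real_class p X z" "w + s \<in> real_class p X w"
      unfolding real_class_def using s(1) real_boundaries_0[of p X] by blast+
    moreover have "y = (z + 0) + (w + s)" using s(2) by (simp add: algebra_simps)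
    ultimately show "y \<in> ?L" by blast
  qed
qed

lemma real_class_scaleR:
  "{r *\<^sub>R a + b | a b. a \<in> real_class p X z \<and> b \<in> real_boundaries p X} = real_class p X (r *\<^sub>R z)" (is "?L = ?R")
proof
  show "?L \<subseteq> ?R"
  proof clarify
    fix a b assume "a \<in> real_class p X z" and b: "b \<in> real_boundaries p X"
    then obtain s where "s \<in> real_boundaries p X" "a = z + s" by (auto simp: real_class_def)
    then have "r *\<^sub>R a + b = r *\<^sub>R z + (r *\<^sub>R s + b)" "r *\<^sub>R s + b \<in> real_boundaries p X"
      using b by (auto simp: algebra_simps intro: real_boundaries_add real_boundaries_scaleR)
    then show "r *\<^sub>R a + b \<in> ?R" unfolding real_class_def by blast
  qed
  show "?R \<subseteq> ?L"
  proof
    fix y assume "y \<in> ?R"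
    then obtain s where s: "s \<in> real_boundaries p X" "y = r *\<^sub>R z + s" by (auto simp: real_class_def)
    moreover have "z \<in> real_class p X z" using real_boundaries_0[of p X] by (force simp: real_class_def)
    ultimately show "y \<in> ?L" by blast
  qed
qed

lemma real_homology_simps:
  "carrier (real_homology p X) = real_class p X ` real_cycles p X"
  "\<zero>\<^bsub>real_homology p X\<^esub> = real_class p X 0"
  "real_class p X z \<oplus>\<^bsub>real_homology p X\<^esub> real_class p X w = real_class p X (z + w)"
  "r \<odot>\<^bsub>real_homology p X\<^esub> real_class p X z = real_class p X (r *\<^sub>R z)"
  unfolding real_class_add[symmetric] real_class_scaleR[symmetric] real_class_0
  by (simp_all add: real_homology_def real_class_def image_def)

lemma vectorspace_real_homology: "vectorspace class_ring (real_homology p X)"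
proof -
  let ?V = "real_homology p X"
  have cr: "cring (class_ring :: real ring)" using class_field by (rule fieldE(1))
  have "module class_ring ?V"
  proof (rule module_criteria[OF cr])
    show "\<zero>\<^bsub>?V\<^esub> \<in> carrier ?V" by (simp add: real_homology_simps real_cycles_0)
    show "\<forall>v w. v \<in> carrier ?V \<and> w \<in> carrier ?V \<longrightarrow> v \<oplus>\<^bsub>?V\<^esub> w \<in> carrier ?V"
      by (auto simp: real_homology_simps real_cycles_add)
    show "\<forall>v\<in>carrier ?V. \<exists>w\<in>carrier ?V. v \<oplus>\<^bsub>?V\<^esub> w = \<zero>\<^bsub>?V\<^esub>"
    proof
      fix v assume "v \<in> carrier ?V"
      then obtain z where z: "z \<in> real_cycles p X" "v = real_class p X z" by (auto simp: real_homology_simps)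
      have "real_class p X (-1 *\<^sub>R z) \<in> carrier ?V"
        unfolding real_homology_simps using real_cycles_scaleR[OF z(1), of "-1"] by (rule imageI)
      moreover have "v \<oplus>\<^bsub>?V\<^esub> real_class p X (-1 *\<^sub>R z) = \<zero>\<^bsub>?V\<^esub>"
        unfolding z(2) real_homology_simps by simp
      ultimately show "\<exists>w\<in>carrier ?V. v \<oplus>\<^bsub>?V\<^esub> w = \<zero>\<^bsub>?V\<^esub>" by blast
    qed
  qed (auto simp: real_homology_simps real_cycles_scaleR class_ring_simps scaleR_add_left scaleR_add_right add_ac)
  then show ?thesis using class_field by (rule vectorspace.intro)
qed

text \<open>A test on chains for the classes of the \<open>w i\<close> to form a basis, so that the
  comparison can be carried out with cycles and boundaries.\<close>

lemma real_homology_dim_criterion: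
  assumes I: "finite I" and w: "\<And>i. i \<in> I \<Longrightarrow> w i \<in> real_cycles p X"
    and li: "\<And>a. (\<Sum>i\<in>I. a i *\<^sub>R w i) \<in> real_boundaries p X \<Longrightarrow> \<forall>i\<in>I. a i = 0"
    and sp: "\<And>c. c \<in> real_cycles p X \<Longrightarrow> \<exists>a. c - (\<Sum>i\<in>I. a i *\<^sub>R w i) \<in> real_boundaries p X"
  shows "vectorspace.fin_dim class_ring (real_homology p X)
    \<and> vectorspace.dim class_ring (real_homology p X) = card I"
proof -
  let ?V = "real_homology p X"
  interpret V: vectorspace "class_ring :: real ring" ?V by (rule vectorspace_real_homology)
  define u where "u i = real_class p X (w i)" for i
  have uV: "u ` J \<subseteq> carrier ?V" if "J \<subseteq> I" for J using w that by (auto simp: u_def real_homology_simps)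
  \<comment> \<open>A basis is a set of vectors, so the family must be shown to have distinct
    classes before its cardinality can be used.\<close>
  have inj: "inj_on u I"
  proof (rule inj_onI)
    fix i j assume ij: "i \<in> I" "j \<in> I" "u i = u j"
    show "i = j"
    proof (rule ccontr)
      assume "i \<noteq> j"
      let ?a = "\<lambda>k. if k = i then 1 else if k = j then -1 else (0::real)"
      have "(\<Sum>k\<in>I. ?a k *\<^sub>R w k) = (\<Sum>k\<in>{i, j}. ?a k *\<^sub>R w k)"
        using I ij by (intro sum.mono_neutral_right) auto
      also have "\<dots> = w i - w j" using \<open>i \<noteq> j\<close> by simp
      also have "\<dots> \<in> real_boundaries p X" using ij(3) by (simp add: u_def real_class_eq_iff)
      finally have "\<forall>k\<in>I. ?a k = 0" by (rule li)
      from bspec[OF this ij(1)] show False by simp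
    qed
  qed
  have lc: "V.lincomb a (u ` J) = real_class p X (\<Sum>i\<in>J. a (u i) *\<^sub>R w i)" if "J \<subseteq> I" for a J
    using finite_subset[OF that I] that
  proof (induction J rule: finite_induct)
    case empty
    then show ?case by (simp add: V.lincomb_def real_homology_simps)
  next
    case (insert i J)
    have ni: "u i \<notin> u ` J" using insert.hyps insert.prems inj by (auto simp: inj_on_def)
    have "V.lincomb a (u ` J \<union> {u i}) = a (u i) \<odot>\<^bsub>?V\<^esub> u i \<oplus>\<^bsub>?V\<^esub> V.lincomb a (u ` J)"
      using insert.hyps insert.prems ni uV[of J] uV[of "{i}"]
      by (intro V.lincomb_insert) (auto simp: class_ring_simps)
    also have "\<dots> = real_class p X (\<Sum>i\<in>insert i J. a (u i) *\<^sub>R w i)"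
      using insert by (simp add: u_def real_homology_simps)
    finally show ?case by simp
  qed
  have "V.lin_indpt (u ` I)"
  proof
    assume "V.lin_dep (u ` I)"
    then obtain a v where a: "V.lincomb a (u ` I) = \<zero>\<^bsub>?V\<^esub>" "v \<in> u ` I" "a v \<noteq> \<zero>\<^bsub>class_ring\<^esub>"
      using V.finite_lin_dep[of "u ` I"] I uV[OF order_refl] by blast
    then have "(\<Sum>i\<in>I. a (u i) *\<^sub>R w i) \<in> real_boundaries p X"
      using lc[OF order_refl, of a] by (simp add: real_homology_simps real_class_eq_iff)
    then show False using li[of "\<lambda>i. a (u i)"] a(2,3) by (auto simp: class_ring_simps)
  qed
  moreover have gen: "V.gen_set (u ` I)"
  proof
    show "V.span (u ` I) \<subseteq> carrier ?V" using uV[OF order_refl] by (rule V.span_is_subset2)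
    show "carrier ?V \<subseteq> V.span (u ` I)"
    proof
      fix v assume "v \<in> carrier ?V"
      then obtain c where c: "c \<in> real_cycles p X" "v = real_class p X c" by (auto simp: real_homology_simps)
      then obtain a where "c - (\<Sum>i\<in>I. a i *\<^sub>R w i) \<in> real_boundaries p X" using sp by blast
      then have "v = real_class p X (\<Sum>i\<in>I. a i *\<^sub>R w i)" using c(2) by (simp add: real_class_eq_iff)
      also have "\<dots> = V.lincomb (\<lambda>x. a (the_inv_into I u x)) (u ` I)"
        using lc[OF order_refl, of "\<lambda>x. a (the_inv_into I u x)"] inj by (simp add: the_inv_into_f_f)
      finally show "v \<in> V.span (u ` I)" unfolding V.span_def using I by (auto simp: class_ring_simps)
    qed
  qed
  ultimately have basis: "V.basis (u ` I)" unfolding V.basis_def using uV[OF order_refl] by blast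
  have "V.dim = card (u ` I)" using V.dim_basis[OF _ basis] I by simp
  then have "V.dim = card I" using inj by (simp add: card_image)
  moreover have "V.fin_dim" unfolding V.fin_dim_def using gen I uV[OF order_refl] by blast
  ultimately show ?thesis by simp
qed

subsection \<open>Comparison of integral and real homology\<close>

text \<open>Integral cycles representing a maximal independent family become a basis over the reals.
  A real cycle is a combination of its rational coordinate cycles, which become integral after
  scaling. A real relation with \<open>a j\<close> nonzero yields an integral one by applying a
  coordinate that does not vanish at \<open>a j\<close> and clearing denominators.\<close>

theorem real_homology_dim:
  assumes "has_rank (homology_group (int p) X) r"
  shows "vectorspace.fin_dim class_ring (real_homology p X)
    \<and> vectorspace.dim class_ring (real_homology p X) = r"
proof -
  let ?H = "homology_group (int p) X" and ?h = "homologous_rel_set p X {}"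
  obtain I :: "nat set" and x where x: "zindep ?H I x" and r: "card I = r"
    and span: "\<forall>y\<in>carrier ?H. \<exists>N c. N \<noteq> 0 \<and> y [^]\<^bsub>?H\<^esub> (N::int) = zcomb ?H I x c"
    using assms unfolding has_rank_def by (elim exE conjE)
  have I: "finite I" and xH: "x \<in> I \<rightarrow> carrier ?H" using x by (auto simp: zindep_def)
  interpret H: comm_group ?H by simp
  have "\<forall>i\<in>I. \<exists>z. singular_relcycle p X {} z \<and> x i = ?h z"
  proof
    fix i assume "i \<in> I"
    then have "x i \<in> carrier ?H" using xH by blast
    then show "\<exists>z. singular_relcycle p X {} z \<and> x i = ?h z"
      unfolding carrier_relative_homology_group by (elim imageE) auto
  qed
  from bchoice[OF this] obtain z where "\<forall>i\<in>I. singular_relcycle p X {} (z i) \<and> x i = ?h (z i)" ..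
  then have z: "\<And>i. i \<in> I \<Longrightarrow> singular_relcycle p X {} (z i)" "\<And>i. i \<in> I \<Longrightarrow> x i = ?h (z i)" by simp_all
  have zc: "zcomb ?H I x c = ?h (\<Sum>i\<in>I. frag_cmul (c i) (z i))" for c
  proof -
    have "zcomb ?H I x c = zcomb ?H I (\<lambda>i. ?h (z i)) c"
      using z by (intro H.zcomb_cong) (auto simp: carrier_relative_homology_group)
    then show ?thesis by (simp add: zcomb_homology_group[OF I z(1)])
  qed
  have indep: "\<forall>i\<in>I. c i = 0" if "singular_relboundary p X {} (\<Sum>i\<in>I. frag_cmul (c i) (z i))" for c
  proof -
    have "zcomb ?H I x c = \<one>\<^bsub>?H\<^esub>" using that by (simp add: zc homologous_rel_set_eq_relboundary)
    then show ?thesis using x by (simp add: zindep_def)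
  qed
  have spanZ: "\<exists>N c. N \<noteq> 0 \<and> singular_relboundary p X {} (frag_cmul N y - (\<Sum>i\<in>I. frag_cmul (c i) (z i)))"
    if y: "singular_relcycle p X {} y" for y
  proof -
    have yH: "?h y \<in> carrier ?H" using y by (auto simp: carrier_relative_homology_group)
    then obtain N c where Nc: "N \<noteq> 0" "?h y [^]\<^bsub>?H\<^esub> (N::int) = zcomb ?H I x c" using bspec[OF span yH] by (elim exE conjE)
    have "?h y [^]\<^bsub>?H\<^esub> N = zcomb ?H {()} (\<lambda>_. ?h y) (\<lambda>_. N)"
      using H.zcomb_singleton[of "{()}" "\<lambda>_. ?h y" "()" N] yH by simp
    also have "\<dots> = ?h (frag_cmul N y)" using zcomb_homology_group[of "{()}" p X "\<lambda>_. y" "\<lambda>_. N"] y by simp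
    finally have "?h (frag_cmul N y) = ?h (\<Sum>i\<in>I. frag_cmul (c i) (z i))" using Nc(2) zc by simp
    then have "homologous_rel p X {} (frag_cmul N y) (\<Sum>i\<in>I. frag_cmul (c i) (z i))"
      using homologous_rel_refl by blast
    then show ?thesis using Nc(1) unfolding homologous_rel_def by blast
  qed
  have cyc: "of_int_chain y \<in> real_cycles p X \<longleftrightarrow> singular_relcycle p X {} y" for y
    using of_int_chain_inject[of "chain_boundary p y" 0]
    by (auto simp: real_cycles_def real_chains_def keys_of_int_chain real_boundary_of_int singular_cycle singular_chain_def)
  have bdr: "of_int_chain y \<in> real_boundaries p X" if y: "singular_relboundary p X {} y" for y
  proof -
    obtain d where d: "singular_chain (Suc p) X d" "chain_boundary (Suc p) d = y"
      using y by (auto simp: singular_boundary)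
    then have "of_int_chain d \<in> real_chains (Suc p) X"
      by (simp add: real_chains_def keys_of_int_chain singular_chain_def)
    from real_boundariesI[OF this] show ?thesis using d(2) by (simp add: real_boundary_of_int)
  qed
  have oic: "of_int_chain (\<Sum>i\<in>I. frag_cmul (c i) (z i)) = (\<Sum>i\<in>I. of_int (c i) *\<^sub>R of_int_chain (z i))" for c
    by (simp add: of_int_chain_sum of_int_chain_cmul)
  define w where "w i = of_int_chain (z i)" for i
  \<comment> \<open>The real span of the \<open>w i\<close> modulo boundaries. Membership is shown
    for integral, then rational, then all real cycles.\<close>
  define Sp where "Sp = {c. \<exists>a. c - (\<Sum>i\<in>I. a i *\<^sub>R w i) \<in> real_boundaries p X}"
  have Sp_add: "c + d \<in> Sp" if cd: "c \<in> Sp" "d \<in> Sp" for c d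
  proof -
    obtain a where a: "c - (\<Sum>i\<in>I. a i *\<^sub>R w i) \<in> real_boundaries p X"
      using cd(1) unfolding Sp_def by (elim CollectE exE)
    obtain b where b: "d - (\<Sum>i\<in>I. b i *\<^sub>R w i) \<in> real_boundaries p X"
      using cd(2) unfolding Sp_def by (elim CollectE exE)
    from real_boundaries_add[OF a b] show ?thesis unfolding Sp_def
      by (intro CollectI exI[of _ "\<lambda>i. a i + b i"]) (simp add: scaleR_add_left sum.distrib algebra_simps)
  qed
  have Sp_scale: "s *\<^sub>R c \<in> Sp" if c: "c \<in> Sp" for c s
  proof -
    obtain a where "c - (\<Sum>i\<in>I. a i *\<^sub>R w i) \<in> real_boundaries p X" using c unfolding Sp_def by (elim CollectE exE)
    from real_boundaries_scaleR[OF this, of s] show ?thesis unfolding Sp_def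
      by (intro CollectI exI[of _ "\<lambda>i. s * a i"]) (simp add: scaleR_diff_right scaleR_right.sum)
  qed
  have Sp_0: "0 \<in> Sp" unfolding Sp_def using real_boundaries_0 by (intro CollectI exI[of _ "\<lambda>_. 0"]) simp
  have Sp_sum: "(\<Sum>j\<in>J. c j) \<in> Sp" if "\<And>j. j \<in> J \<Longrightarrow> c j \<in> Sp" for J :: "real set" and c
    using that by (induction J rule: infinite_finite_induct) (simp_all add: Sp_0 Sp_add)
  have Sp_int: "of_int_chain y \<in> Sp" if y: "singular_relcycle p X {} y" for y
  proof -
    obtain N c where Nc: "N \<noteq> 0" "singular_relboundary p X {} (frag_cmul N y - (\<Sum>i\<in>I. frag_cmul (c i) (z i)))"
      using spanZ[OF y] by (elim exE conjE)
    have "of_int_chain (frag_cmul N y - (\<Sum>i\<in>I. frag_cmul (c i) (z i)))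
        = of_int N *\<^sub>R of_int_chain y - (\<Sum>i\<in>I. of_int (c i) *\<^sub>R w i)"
      using of_int_chain_add[of "frag_cmul N y - (\<Sum>i\<in>I. frag_cmul (c i) (z i))" "\<Sum>i\<in>I. frag_cmul (c i) (z i)"]
      by (simp add: oic of_int_chain_cmul w_def algebra_simps)
    then have "of_int N *\<^sub>R of_int_chain y \<in> Sp" unfolding Sp_def using bdr[OF Nc(2)] by auto
    from Sp_scale[OF this, of "1 / of_int N"] show ?thesis using Nc(1) by simp
  qed
  have Sp_rat: "c \<in> Sp" if c: "c \<in> real_cycles p X" and rat: "\<And>f. Poly_Mapping.lookup c f \<in> \<rat>" for c
  proof -
    obtain N :: int and y where N: "N > 0" "of_int N *\<^sub>R c = of_int_chain y" using clear_denominators[OF rat] .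
    have "of_int_chain y \<in> real_cycles p X" unfolding N(2)[symmetric] by (rule real_cycles_scaleR[OF c])
    then have "of_int N *\<^sub>R c \<in> Sp" unfolding N(2) cyc by (rule Sp_int)
    from Sp_scale[OF this, of "1 / of_int N"] show ?thesis using N(1) by simp
  qed
  have hc: "hcoord b 0 = 0" "hcoord b (s + t) = hcoord b s + hcoord b t" for b s t by (simp_all add: hcoord_add)
  have "card I = card I \<and> vectorspace.fin_dim class_ring (real_homology p X)
    \<and> vectorspace.dim class_ring (real_homology p X) = card I"
  proof (intro conjI[OF refl] real_homology_dim_criterion[where w=w, OF I])
    show "w i \<in> real_cycles p X" if "i \<in> I" for i using z(1)[OF that] by (simp add: w_def cyc)
  next
    fix c assume c: "c \<in> real_cycles p X"
    \<comment> \<open>Only finitely many basis elements occur in the coefficients of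
      \<open>c\<close>, so its decomposition into coordinate chains is a finite sum.\<close>
    let ?B = "\<Union>f\<in>Poly_Mapping.keys c. {b. hcoord b (Poly_Mapping.lookup c f) \<noteq> 0}"
    have fB: "finite ?B" using hcoord_sum_nonzero(1) by simp
    have "chain_coeffs (hcoord b) c \<in> Sp" for b
    proof (rule Sp_rat)
      show "chain_coeffs (hcoord b) c \<in> real_cycles p X"
        using c real_boundary_coeffs[of "hcoord b" p c] by (simp add: real_cycles_def real_chains_coeffs hc)
    qed (simp add: lookup_chain_coeffs hcoord_Rats)
    then have "(\<Sum>b\<in>?B. b *\<^sub>R chain_coeffs (hcoord b) c) \<in> Sp" by (intro Sp_sum Sp_scale)
    moreover have "(\<Sum>b\<in>?B. b *\<^sub>R chain_coeffs (hcoord b) c) = c"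
    proof (rule poly_mapping_eqI)
      fix f
      have "Poly_Mapping.lookup (\<Sum>b\<in>?B. b *\<^sub>R chain_coeffs (hcoord b) c) f = (\<Sum>b\<in>?B. hcoord b (Poly_Mapping.lookup c f) * b)"
        by (simp add: lookup_sum lookup_chain_coeffs mult.commute)
      also have "\<dots> = Poly_Mapping.lookup c f"
      proof (cases "f \<in> Poly_Mapping.keys c")
        case True
        then have "(\<Sum>b\<in>?B. hcoord b (Poly_Mapping.lookup c f) * b) = (\<Sum>b | hcoord b (Poly_Mapping.lookup c f) \<noteq> 0. hcoord b (Poly_Mapping.lookup c f) * b)"
          using fB by (intro sum.mono_neutral_right) auto
        then show ?thesis using hcoord_sum_nonzero(2) by simp
      qed (simp add: in_keys_iff)
      finally show "Poly_Mapping.lookup (\<Sum>b\<in>?B. b *\<^sub>R chain_coeffs (hcoord b) c) f = Poly_Mapping.lookup c f" .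
    qed
    ultimately show "\<exists>a. c - (\<Sum>i\<in>I. a i *\<^sub>R w i) \<in> real_boundaries p X" unfolding Sp_def by simp
  next
    fix a assume a: "(\<Sum>i\<in>I. a i *\<^sub>R w i) \<in> real_boundaries p X"
    show "\<forall>i\<in>I. a i = 0"
    proof (rule ccontr)
      assume "\<not> (\<forall>i\<in>I. a i = 0)"
      then obtain j where j: "j \<in> I" "a j \<noteq> 0" by blast
      obtain b where b: "hcoord b (a j) \<noteq> 0" using hcoord_nonzero[OF j(2)] by blast
      let ?\<phi> = "hcoord b"
      obtain e where e: "e \<in> real_chains (Suc p) X" "(\<Sum>i\<in>I. a i *\<^sub>R w i) = real_boundary (Suc p) e"
        using a by (auto simp: real_boundaries_def)
      have \<phi>neg: "?\<phi> (- t) = - ?\<phi> t" for t using hc(2)[of b t "- t"] hc(1) by simp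
      have \<phi>nat: "?\<phi> (t * real n) = ?\<phi> t * real n" for t n
        by (induction n) (simp_all add: algebra_simps hc)
      have \<phi>int: "?\<phi> (t * of_int k) = ?\<phi> t * of_int k" for t k
        by (cases k rule: int_cases2) (simp_all add: \<phi>nat \<phi>neg)
      have \<phi>w: "chain_coeffs ?\<phi> (a i *\<^sub>R w i) = ?\<phi> (a i) *\<^sub>R w i" for i
        by (rule poly_mapping_eqI) (simp add: lookup_chain_coeffs w_def lookup_of_int_chain \<phi>int)
      have "(\<Sum>i\<in>I. ?\<phi> (a i) *\<^sub>R w i) = chain_coeffs ?\<phi> (\<Sum>i\<in>I. a i *\<^sub>R w i)"
        by (simp add: chain_coeffs_sum hc \<phi>w)
      also have "\<dots> = real_boundary (Suc p) (chain_coeffs ?\<phi> e)"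
        unfolding e(2) by (rule real_boundary_coeffs[symmetric]) (simp_all add: hc)
      finally have eq: "(\<Sum>i\<in>I. ?\<phi> (a i) *\<^sub>R w i) = real_boundary (Suc p) (chain_coeffs ?\<phi> e)" .
      \<comment> \<open>Two denominators are cleared: \<open>N\<close> for the chain bounding the
        relation and \<open>M\<close> for its coefficients. Their product makes the whole equation
        integral.\<close>
      obtain N :: int and y where N: "N > 0" "of_int N *\<^sub>R chain_coeffs ?\<phi> e = of_int_chain y"
          "Poly_Mapping.keys y \<subseteq> Poly_Mapping.keys (chain_coeffs ?\<phi> e)"
        using clear_denominators[of "chain_coeffs ?\<phi> e"] by (auto simp: lookup_chain_coeffs hcoord_Rats)
      obtain M :: int where M: "M > 0" "\<forall>i\<in>I. of_int M * ?\<phi> (a i) \<in> \<int>"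
        using common_denominator[OF I, of "\<lambda>i. ?\<phi> (a i)"] hcoord_Rats by blast
      define c where "c i = \<lfloor>of_int M * ?\<phi> (a i)\<rfloor>" for i
      have c: "of_int (c i) = of_int M * ?\<phi> (a i)" if "i \<in> I" for i using M(2) that by (auto simp: c_def elim!: Ints_cases dest!: bspec)
      have "of_int_chain (\<Sum>i\<in>I. frag_cmul (N * c i) (z i)) = (of_int N * of_int M) *\<^sub>R (\<Sum>i\<in>I. ?\<phi> (a i) *\<^sub>R w i)"
        unfolding oic scaleR_right.sum by (intro sum.cong) (auto simp: c w_def)
      also have "\<dots> = of_int M *\<^sub>R real_boundary (Suc p) (of_int N *\<^sub>R chain_coeffs ?\<phi> e)"
        unfolding eq real_boundary_scaleR by (simp add: mult.commute)
      also have "\<dots> = of_int_chain (frag_cmul M (chain_boundary (Suc p) y))"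
        unfolding N(2) by (simp add: real_boundary_of_int of_int_chain_cmul)
      finally have "(\<Sum>i\<in>I. frag_cmul (N * c i) (z i)) = chain_boundary (Suc p) (frag_cmul M y)"
        by (simp add: of_int_chain_inject chain_boundary_cmul)
      moreover have "singular_chain (Suc p) X (frag_cmul M y)"
        using N(3) keys_chain_coeffs[of ?\<phi> e] e(1)
        by (intro singular_chain_cmul) (auto simp: singular_chain_def real_chains_def)
      ultimately have "\<forall>i\<in>I. N * c i = 0" by (intro indep) (auto simp: singular_boundary)
      then have "of_int M * ?\<phi> (a j) = 0" using c[OF j(1)] j(1) N(1) by simp
      then show False using b M(1) by simp
    qed
  qed
  then show ?thesis using r by simp
qed

subsection \<open>Configurations in a vertex-stable FI-graph\<close>

locale stable_FI_graph = FI_graph G F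
  for G :: "nat \<Rightarrow> 'v graph" and F :: "nat \<Rightarrow> nat \<Rightarrow> (nat \<Rightarrow> nat) \<Rightarrow> 'v \<Rightarrow> 'v" +
  fixes d m :: nat
  assumes vs: "vertex_stable G F d" and inj_trans: "injective_transitions G F"
begin

abbreviation "X n \<equiv> Conf m (realization (G n))"
abbreviation "FX k n f \<equiv> Conf_map m (realization_map (G k) (F k n f))"
abbreviation "S e w n \<equiv> topspace (X n) \<inter> Mode m e w"
abbreviation "Y e w n \<equiv> subtopology (X n) (S e w n)"

lemma F_inj: "f \<in> FI_hom k n \<Longrightarrow> inj_on (F k n f) (verts (G k))"
  using inj_trans by (auto simp: injective_transitions_def)

lemma Conf_pts: "x \<in> topspace (X n) \<Longrightarrow> j \<in> {1..m} \<Longrightarrow> x j \<in> topspace (realization (G n))"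
  by (auto simp: topspace_Conf)

lemma Conf_outside: "x \<in> topspace (X n) \<Longrightarrow> j \<in> {1..m} \<Longrightarrow> v \<notin> verts (G n) \<Longrightarrow> x j v = 0"
  by (rule not_in_vsupp[OF vsupp_verts[OF graph Conf_pts]])

lemma FX_apply: "f \<in> FI_hom k n \<Longrightarrow> j \<in> {1..m} \<Longrightarrow> v \<in> verts (G k) \<Longrightarrow> FX k n f x j (F k n f v) = x j v"
  by (simp add: Conf_map_def realization_map_apply[OF F_inj])

lemma FX_outside: "j \<in> {1..m} \<Longrightarrow> u \<notin> F k n f ` verts (G k) \<Longrightarrow> FX k n f x j u = 0"
  by (simp add: Conf_map_def realization_map_outside)

lemma FX_Conf:
  assumes f: "f \<in> FI_hom k n" and x: "x \<in> topspace (X k)"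
  shows "FX k n f x \<in> topspace (X n)"
proof -
  have "inj_on (FX k n f x) {1..m}"
  proof (rule inj_onI)
    fix i j assume ij: "i \<in> {1..m}" "j \<in> {1..m}" "FX k n f x i = FX k n f x j"
    then have "realization_map (G k) (F k n f) (x i) = realization_map (G k) (F k n f) (x j)"
      by (simp add: Conf_map_def)
    then have "x i = x j" by (rule realization_map_inject[OF graph F_inj[OF f] Conf_pts[OF x ij(1)] Conf_pts[OF x ij(2)]])
    then show "i = j" using x ij(1,2) by (auto simp: topspace_Conf dest: inj_onD)
  qed
  moreover have "FX k n f x \<in> {1..m} \<rightarrow>\<^sub>E topspace (realization (G n))"
    unfolding Conf_map_def
    by (intro restrict_PiE_iff[THEN iffD2] ballI realization_map_point[OF graph F_inj[OF f] F_simplex[OF f]] Conf_pts[OF x])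
  ultimately show ?thesis by (simp add: topspace_Conf)
qed

lemma FX_ident: "x \<in> topspace (X n) \<Longrightarrow> FX n n (FI_id n) x = x"
proof
  fix j assume x: "x \<in> topspace (X n)"
  show "FX n n (FI_id n) x j = x j"
  proof (cases "j \<in> {1..m}")
    case True
    show ?thesis
    proof
      fix v show "FX n n (FI_id n) x j v = x j v"
      proof (cases "v \<in> verts (G n)")
        case v: True
        show ?thesis using FX_apply[OF FI_id_in[of n] True v, of x] ident[OF v] by simp
      next
        case False
        then have "v \<notin> F n n (FI_id n) ` verts (G n)" using ident by auto
        then show ?thesis using FX_outside[OF True, of v n n "FI_id n" x] Conf_outside[OF x True False] by simp
      qed
    qed
  next
    case False
    then have "x j = undefined" using x by (auto simp: topspace_Conf PiE_def extensional_def)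
    then show ?thesis using False by (simp only: Conf_map_def restrict_apply if_False)
  qed
qed

lemma FX_comp:
  assumes f: "f \<in> FI_hom l k" and g: "g \<in> FI_hom k n"
  shows "FX l n (FI_comp l g f) x = FX k n g (FX l k f x)"
proof
  fix j
  show "FX l n (FI_comp l g f) x j = FX k n g (FX l k f x) j"
  proof (cases "j \<in> {1..m}")
    case j: True
    show ?thesis
    proof
      fix u
      show "FX l n (FI_comp l g f) x j u = FX k n g (FX l k f x) j u"
      proof (cases "u \<in> F k n g ` verts (G k)")
        case True
        then obtain u' where u': "u' \<in> verts (G k)" "u = F k n g u'" by (rule imageE)
        have R: "FX k n g (FX l k f x) j u = FX l k f x j u'" unfolding u'(2) by (rule FX_apply[OF g j u'(1)])
        show ?thesis
        proof (cases "u' \<in> F l k f ` verts (G l)")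
          case True
          then obtain v where v: "v \<in> verts (G l)" "u' = F l k f v" by (rule imageE)
          have "FX l k f x j u' = x j v" unfolding v(2) by (rule FX_apply[OF f j v(1)])
          moreover have "FX l n (FI_comp l g f) x j u = x j v"
            unfolding u'(2) v(2) comp[OF f g v(1), symmetric] by (rule FX_apply[OF FI_comp_in[OF f g] j v(1)])
          ultimately show ?thesis using R by simp
        next
          case False
          have "u \<notin> F l n (FI_comp l g f) ` verts (G l)"
          proof
            assume "u \<in> F l n (FI_comp l g f) ` verts (G l)"
            then obtain v where v: "v \<in> verts (G l)" "u = F l n (FI_comp l g f) v" by (rule imageE)
            then have "F k n g u' = F k n g (F l k f v)" using comp[OF f g v(1)] u'(2) by simp
            then have "u' = F l k f v" by (rule inj_onD[OF F_inj[OF g] _ u'(1) F_verts[OF f v(1)]])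
            then show False using False v(1) by blast
          qed
          then show ?thesis using R FX_outside[OF j False] FX_outside[OF j] by simp
        qed
      next
        case False
        have "u \<notin> F l n (FI_comp l g f) ` verts (G l)"
        proof
          assume "u \<in> F l n (FI_comp l g f) ` verts (G l)"
          then obtain v where v: "v \<in> verts (G l)" "u = F l n (FI_comp l g f) v" by (rule imageE)
          then show False using False comp[OF f g v(1)] F_verts[OF f v(1)] by simp
        qed
        then show ?thesis using FX_outside[OF j False] FX_outside[OF j] by simp
      qed
    qed
  qed (simp only: Conf_map_def restrict_apply if_False)
qed

lemma FI_space_Conf: "FI_space X FX"
proof
  fix k n f assume f: "f \<in> FI_hom k n"
  show "continuous_map (X k) (X n) (FX k n f)"
  proof (rule continuous_map_into_Conf)
    show "FX k n f \<in> topspace (X k) \<rightarrow> topspace (X n)" using FX_Conf[OF f] by (rule funcsetI)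
    fix j u assume j: "j \<in> {1..m}"
    have "finite (verts (G k))" using graph[of k] by (simp add: finite_simple_graph_def)
    then have "continuous_map (X k) euclideanreal (\<lambda>x. \<Sum>v | v \<in> verts (G k) \<and> F k n f v = u. x j v)"
      by (intro continuous_map_sum continuous_map_Conf_coord[OF j]) simp
    then show "continuous_map (X k) euclideanreal (\<lambda>x. FX k n f x j u)"
      using j by (simp add: Conf_map_def realization_map_def)
  qed
qed (rule FX_ident FX_comp, assumption+)+

lemma FX_closest:
  assumes "f \<in> FI_hom k n" "j \<in> {1..m}" "v \<in> verts (G k)"
  shows "closest m (FX k n f x) j (F k n f v) \<longleftrightarrow> closest m x j v"
proof -
  have "FX k n f x i (F k n f v) = x i v" if "i \<in> {1..m}" for i by (rule FX_apply[OF assms(1) that assms(3)])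
  then show ?thesis using assms(2) unfolding closest_def by simp
qed

text \<open>Coordinates are carried along injectively and vanish off the image. Forwards this makes
  the subspaces FI-subspaces; backwards it shows in \<open>center_generated\<close> that a
  configuration pulled back to a smaller graph still satisfies the conditions.\<close>

lemma FX_Mode:
  assumes f: "f \<in> FI_hom k n" and x: "x \<in> topspace (X k)" and e: "e \<subseteq> {1..m}" and w: "w \<subseteq> {1..m}"
  shows "FX k n f x \<in> Mode m e w \<longleftrightarrow> x \<in> Mode m e w"
proof -
  \<comment> \<open>Vertices witnessing either condition have nonzero coordinates and thus lie in
    the image, so an existential statement transfers between the two graphs.\<close>
  have supp: "(\<exists>u. P (FX k n f x) u) \<longleftrightarrow> (\<exists>v. P' v)"
    if P: "\<And>v. v \<in> verts (G k) \<Longrightarrow> P (FX k n f x) (F k n f v) \<longleftrightarrow> P' v"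
      and z: "\<And>u. P (FX k n f x) u \<Longrightarrow> u \<in> F k n f ` verts (G k)" "\<And>v. P' v \<Longrightarrow> v \<in> verts (G k)" for P P'
  proof
    assume "\<exists>u. P (FX k n f x) u"
    then obtain u where u: "P (FX k n f x) u" ..
    obtain v where v: "v \<in> verts (G k)" "u = F k n f v" using z(1)[OF u] by (rule imageE)
    then show "\<exists>v. P' v" using P[OF v(1)] u by blast
  next
    assume "\<exists>v. P' v"
    then obtain v where v: "P' v" ..
    then show "\<exists>u. P (FX k n f x) u" using P[OF z(2)[OF v]] by blast
  qed
  have "(\<exists>u. FX k n f x j u = 1) \<longleftrightarrow> (\<exists>v. x j v = 1)" if "j \<in> {1..m}" for j
  proof (rule supp[of "\<lambda>y u. y j u = 1" "\<lambda>v. x j v = 1"])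
    show "FX k n f x j (F k n f v) = 1 \<longleftrightarrow> x j v = 1" if "v \<in> verts (G k)" for v
      using FX_apply[OF f \<open>j \<in> {1..m}\<close> that] by simp
    show "u \<in> F k n f ` verts (G k)" if "FX k n f x j u = 1" for u
    proof (rule ccontr)
      assume "u \<notin> F k n f ` verts (G k)"
      from FX_outside[OF \<open>j \<in> {1..m}\<close> this, of x] that show False by simp
    qed
    show "v \<in> verts (G k)" if "x j v = 1" for v
    proof (rule ccontr)
      assume "v \<notin> verts (G k)"
      from Conf_outside[OF x \<open>j \<in> {1..m}\<close> this] that show False by simp
    qed
  qed
  moreover have "(\<exists>u. closest m (FX k n f x) j u) \<longleftrightarrow> (\<exists>v. closest m x j v)" if "j \<in> {1..m}" for j
  proof (rule supp[of "\<lambda>y. closest m y j" "closest m x j"])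
    show "closest m (FX k n f x) j (F k n f v) \<longleftrightarrow> closest m x j v" if "v \<in> verts (G k)" for v
      by (rule FX_closest[OF f \<open>j \<in> {1..m}\<close> that])
    show "u \<in> F k n f ` verts (G k)" if "closest m (FX k n f x) j u" for u
    proof (rule ccontr)
      assume "u \<notin> F k n f ` verts (G k)"
      from FX_outside[OF \<open>j \<in> {1..m}\<close> this, of x] that show False by (simp add: closest_def)
    qed
    show "v \<in> verts (G k)" if "closest m x j v" for v
    proof (rule ccontr)
      assume "v \<notin> verts (G k)"
      from Conf_outside[OF x \<open>j \<in> {1..m}\<close> this] that show False by (simp add: closest_def)
    qed
  qed
  ultimately show ?thesis using e w unfolding Mode_def mem_Collect_eq by (metis subsetD)
qed

lemma FX_S: "e \<subseteq> {1..m} \<Longrightarrow> w \<subseteq> {1..m} \<Longrightarrow> f \<in> FI_hom k n \<Longrightarrow> FX k n f \<in> S e w k \<rightarrow> S e w n"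
  using FX_Mode FX_Conf by blast

text \<open>Each of the \<open>m\<close> points lies in a simplex coming from degree at most
  \<open>K\<close>. The \<open>m\<close> injections involved factor jointly through
  \<open>m * K\<close>, so one transition map produces the whole configuration.\<close>

lemma center_generated:
  assumes ew: "e \<union> w = {1..m}"
    and K: "\<And>n s. s \<in> graph_simplices (G n) \<Longrightarrow> \<exists>k\<le>K. \<exists>g\<in>FI_hom k n. \<exists>s0\<in>graph_simplices (G k). F k n g ` s0 = s"
    and y: "y \<in> S e w n" and sy: "\<And>j. j \<in> {1..m} \<Longrightarrow> \<exists>s\<in>graph_simplices (G n). vsupp (y j) \<subseteq> s"
  shows "\<exists>k\<le>m * K. \<exists>f\<in>FI_hom k n. \<exists>c\<in>S e w k. y = FX k n f c"
proof (cases "n \<le> m * K")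
  case True
  have "y = FX n n (FI_id n) y" using FX_ident y by simp
  then show ?thesis using True y FI_id_in[of n] by blast
next
  case False
  let ?N = "m * K"
  have ex: "\<forall>j\<in>{1..m}. \<exists>p. fst p \<le> K \<and> fst (snd p) \<in> FI_hom (fst p) n \<and> snd (snd p) \<in> graph_simplices (G (fst p)) \<and>
      vsupp (y j) \<subseteq> F (fst p) n (fst (snd p)) ` snd (snd p)"
  proof
    fix j assume "j \<in> {1..m}"
    from sy[OF this] obtain s where s: "s \<in> graph_simplices (G n)" "vsupp (y j) \<subseteq> s" by (rule bexE)
    from K[OF s(1)] obtain k g s0 where "k \<le> K" "g \<in> FI_hom k n" "s0 \<in> graph_simplices (G k)" "F k n g ` s0 = s"
      by (elim exE conjE bexE)
    then show "\<exists>p. fst p \<le> K \<and> fst (snd p) \<in> FI_hom (fst p) n \<and> snd (snd p) \<in> graph_simplices (G (fst p)) \<and>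
      vsupp (y j) \<subseteq> F (fst p) n (fst (snd p)) ` snd (snd p)"
      using s(2) by (intro exI[of _ "(k, g, s0)"]) simp
  qed
  from bchoice[OF ex] obtain p where p: "\<forall>j\<in>{1..m}. fst (p j) \<le> K \<and> fst (snd (p j)) \<in> FI_hom (fst (p j)) n \<and>
      snd (snd (p j)) \<in> graph_simplices (G (fst (p j))) \<and>
      vsupp (y j) \<subseteq> F (fst (p j)) n (fst (snd (p j))) ` snd (snd (p j))" ..
  define k where "k j = fst (p j)" for j
  define g where "g j = fst (snd (p j))" for j
  define s0 where "s0 j = snd (snd (p j))" for j
  have k: "k j \<le> K" and g: "g j \<in> FI_hom (k j) n" and s0: "s0 j \<in> graph_simplices (G (k j))"
    and ys: "vsupp (y j) \<subseteq> F (k j) n (g j) ` s0 j" if "j \<in> {1..m}" for j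
    using p that by (simp_all add: k_def g_def s0_def)
  have "(\<Sum>j\<in>{1..m}. k j) \<le> ?N" using sum_bounded_above[of "{1..m}" k K] k by simp
  with g False obtain h where h: "h \<in> FI_hom ?N n"
      and hg: "\<And>j. j \<in> {1..m} \<Longrightarrow> \<exists>g'\<in>FI_hom (k j) ?N. g j = FI_comp (k j) h g'"
    using FI_factor_through[of "{1..m}" g k n ?N] by (metis finite_atLeastAtMost nat_le_linear)
  let ?\<phi> = "F ?N n h"
  have t: "\<exists>t\<in>graph_simplices (G ?N). vsupp (y j) \<subseteq> ?\<phi> ` t" if j: "j \<in> {1..m}" for j
  proof -
    obtain g' where g': "g' \<in> FI_hom (k j) ?N" "g j = FI_comp (k j) h g'" using hg[OF j] by (rule bexE)
    have "F (k j) n (g j) ` s0 j = ?\<phi> ` F (k j) ?N g' ` s0 j"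
      unfolding g'(2) by (rule F_comp_image[OF g'(1) h simplex_subset[OF s0[OF j]], symmetric])
    then show ?thesis using ys[OF j] F_simplex[OF g'(1) s0[OF j]] by auto
  qed
  have yp: "y j \<in> topspace (realization (G n))" if "j \<in> {1..m}" for j using Conf_pts y that by blast
  \<comment> \<open>The preimage configuration: coordinates are pulled back along the injective
    vertex map, and no mass is lost because the supports lie in its image.\<close>
  define c where "c = (\<lambda>j\<in>{1..m}. \<lambda>v. if v \<in> verts (G ?N) then y j (?\<phi> v) else 0)"
  have cj: "c j v = y j (?\<phi> v)" if "j \<in> {1..m}" "v \<in> verts (G ?N)" for j v using that by (simp add: c_def)
  have cj0: "c j v = 0" if "j \<in> {1..m}" "v \<notin> verts (G ?N)" for j v using that by (simp add: c_def)
  have cp: "c j \<in> topspace (realization (G ?N))" if j: "j \<in> {1..m}" for j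
  proof -
    obtain t where t: "t \<in> graph_simplices (G ?N)" "vsupp (y j) \<subseteq> ?\<phi> ` t" using t[OF j] by (rule bexE)
    have tv: "t \<subseteq> verts (G ?N)" by (rule simplex_subset[OF t(1)])
    have "v \<in> t" if v: "c j v \<noteq> 0" for v
    proof -
      have vv: "v \<in> verts (G ?N)" using cj0[OF j] v by blast
      then have "?\<phi> v \<in> vsupp (y j)" using v cj[OF j vv] by (simp add: vsupp_iff)
      then have "?\<phi> v \<in> ?\<phi> ` t" using t(2) by blast
      then show "v \<in> t" using inj_on_image_mem_iff[OF F_inj[OF h] vv tv] by blast
    qed
    moreover have "sum (c j) t = 1"
    proof -
      have "sum (c j) t = (\<Sum>v\<in>t. y j (?\<phi> v))" using cj[OF j] tv by (intro sum.cong) auto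
      also have "\<dots> = sum (y j) (?\<phi> ` t)" using inj_on_subset[OF F_inj[OF h] tv] by (simp add: sum.reindex)
      also have "\<dots> = 1"
        using simplex_finite[OF graph t(1)] by (intro sum_realization_point[OF graph yp[OF j] _ t(2)]) simp
      finally show ?thesis .
    qed
    moreover have "0 \<le> c j v" for v
      using cj[OF j, of v] cj0[OF j, of v] realization_point_nonneg[OF yp[OF j]] by (cases "v \<in> verts (G ?N)") simp_all
    ultimately show ?thesis unfolding realization_points vsupp_def using t(1) by auto
  qed
  have yc: "y j = realization_map (G ?N) ?\<phi> (c j)" if j: "j \<in> {1..m}" for j
  proof
    fix u show "y j u = realization_map (G ?N) ?\<phi> (c j) u"
    proof (cases "u \<in> ?\<phi> ` verts (G ?N)")
      case True
      then obtain v where v: "v \<in> verts (G ?N)" "u = ?\<phi> v" by (rule imageE)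
      then show ?thesis using realization_map_apply[OF F_inj[OF h] v(1), of "c j"] cj[OF j v(1)] by simp
    next
      case False
      obtain t where t: "t \<in> graph_simplices (G ?N)" "vsupp (y j) \<subseteq> ?\<phi> ` t" using t[OF j] by (rule bexE)
      have "u \<notin> ?\<phi> ` t" using False simplex_subset[OF t(1)] by blast
      then have "y j u = 0" by (rule not_in_vsupp[OF t(2)])
      then show ?thesis using realization_map_outside[OF False, of "c j"] by simp
    qed
  qed
  have "inj_on c {1..m}"
  proof (rule inj_onI)
    fix i j assume ij: "i \<in> {1..m}" "j \<in> {1..m}" "c i = c j"
    then have "y i = y j" using yc[OF ij(1)] yc[OF ij(2)] by simp
    then show "i = j" using y ij(1,2) by (auto simp: topspace_Conf dest: inj_onD)
  qed
  moreover have "c \<in> extensional {1..m}" by (simp add: c_def)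
  ultimately have cX: "c \<in> topspace (X ?N)" using cp by (simp add: topspace_Conf PiE_def Pi_iff)
  have yF: "y = FX ?N n h c"
  proof
    fix j show "y j = FX ?N n h c j"
    proof (cases "j \<in> {1..m}")
      case True
      then show ?thesis using yc[OF True] by (simp add: Conf_map_def)
    next
      case False
      then have "y j = undefined" using y by (auto simp: topspace_Conf PiE_def extensional_def)
      then show ?thesis using False by (simp only: Conf_map_def restrict_apply if_False)
    qed
  qed
  have "e \<subseteq> {1..m}" "w \<subseteq> {1..m}" using ew by blast+
  from FX_Mode[OF h cX this] have "c \<in> S e w ?N" using cX y yF by simp
  then show ?thesis using yF h by blast
qed

lemma FI_growth_pieces:
  assumes ew: "e \<union> w = {1..m}"
  shows "FI_growth (FI_homology p (Y e w)) (FI_homology_map p (Y e w) FX) (2 * d * m)"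
proof -
  have sub: "e \<subseteq> {1..m}" "w \<subseteq> {1..m}" using ew by blast+
  obtain C0 where C0: "\<And>n. n \<ge> 1 \<Longrightarrow> card (verts (G n)) \<le> C0 * n ^ d" using card_verts_growth[OF vs] by metis
  obtain K where K: "\<And>n s. s \<in> graph_simplices (G n) \<Longrightarrow>
    \<exists>k\<le>K. \<exists>g\<in>FI_hom k n. \<exists>s0\<in>graph_simplices (G k). F k n g ` s0 = s" using simplices_generated[OF vs] by metis
  interpret cp: conf_pieces "G n" m e w for n using graph ew by unfold_locales
  define P where "P n = cp.piece n ` S e w n" for n
  \<comment> \<open>The center depends on the configuration used to describe the piece, so one
    representative is fixed for each piece.\<close>
  define pick where "pick n U = (SOME x. x \<in> S e w n \<and> cp.piece n x = U)" for n U
  have pick: "pick n U \<in> S e w n \<and> cp.piece n (pick n U) = U" if "U \<in> P n" for n U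
  proof -
    obtain x where "x \<in> S e w n" "U = cp.piece n x" using \<open>U \<in> P n\<close> unfolding P_def by (elim imageE)
    then have "\<exists>x. x \<in> S e w n \<and> cp.piece n x = U" by (intro exI[of _ x]) simp
    then show ?thesis unfolding pick_def by (rule someI_ex)
  qed
  have PS: "U \<subseteq> S e w n" if "U \<in> P n" for n U
    using cp.pieces(4)[of n] that unfolding P_def by blast
  have tY: "topspace (Y e w n) = S e w n" for n by simp
  have YU: "subtopology (Y e w n) U = subtopology (X n) U" if "U \<in> P n" for n U
    unfolding subtopology_subtopology using PS[OF that] by (simp add: Int_absorb1)
  have FS: "FI_space (Y e w) FX" by (rule FI_space_subspace[OF FI_space_Conf FX_S[OF sub]])
  show ?thesis
  proof (rule FI_growth_contractible_pieces[OF FS, where \<U> = P and c = "\<lambda>n U. cp.center (pick n U)"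
        and C = "(3 * C0 ^ 2) ^ m * 2 ^ (m * m)" and K = "m * K"])
    fix n
    show "finite (P n)" "pairwise disjnt (P n)" "\<Union> (P n) = topspace (Y e w n)"
      unfolding P_def tY by (rule cp.pieces)+
    show "card (P n) \<le> (3 * C0 ^ 2) ^ m * 2 ^ (m * m) * n ^ (2 * d * m)" if n: "n \<ge> 1"
    proof -
      have "card (P n) \<le> (3 * card (verts (G n)) ^ 2) ^ m * 2 ^ (m * m)" unfolding P_def by (rule cp.pieces)
      \<comment> \<open>Two vertices for each of the \<open>m\<close> particles, with a multiple of
        \<open>n ^ d\<close> choices each, account for the exponent.\<close>
      also have "\<dots> \<le> (3 * (C0 * n ^ d) ^ 2) ^ m * 2 ^ (m * m)"
        using C0[OF n] by (intro mult_le_mono1 power_mono mult_le_mono2) auto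
      also have "\<dots> = (3 * C0 ^ 2) ^ m * 2 ^ (m * m) * n ^ (2 * d * m)"
        by (simp add: power_mult_distrib mult_ac flip: power_mult)
      finally show ?thesis .
    qed
    fix U assume U: "U \<in> P n"
    note x = pick[OF U, THEN conjunct1] and pU = pick[OF U, THEN conjunct2]
    show "openin (Y e w n) U"
      using cp.piece_open[OF x] PS[OF U] pU openin_open_subtopology[OF openin_Mode[OF graph sub]] by simp
    show cU: "cp.center (pick n U) \<in> U" using cp.center_piece[OF x] pU by simp
    show "homotopic_with (\<lambda>_. True) (subtopology (Y e w n) U) (subtopology (Y e w n) U) id (\<lambda>_. cp.center (pick n U))"
      unfolding YU[OF U] using cp.piece_contractible[OF x] pU by simp
    have "cp.center (pick n U) \<in> S e w n" using cU PS[OF U] by blast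
    from center_generated[OF ew K this cp.center_simplex(1)[OF x]]
    show "\<exists>k\<le>m * K. \<exists>f\<in>FI_hom k n. \<exists>c'\<in>topspace (Y e w k). cp.center (pick n U) = FX k n f c'"
      unfolding tY .
  qed
qed

text \<open>Induction on the number of particles without a condition. Such a particle
  \<open>j\<close> is added to \<open>e\<close>, to \<open>w\<close>, or to both; each of the three
  subspaces in the union theorem then has one unconstrained particle fewer.\<close>

lemma FI_growth_Mode:
  assumes "e \<subseteq> {1..m}" "w \<subseteq> {1..m}"
  shows "FI_growth (FI_homology p (Y e w)) (FI_homology_map p (Y e w) FX) (2 * d * m)"
  using assms
proof (induction "card ({1..m} - (e \<union> w))" arbitrary: e w p)
  case 0
  then have "e \<union> w = {1..m}" by auto
  then show ?case by (rule FI_growth_pieces)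
next
  case (Suc q)
  then have "{1..m} - (e \<union> w) \<noteq> {}" by (metis card.empty nat.distinct(1))
  then obtain j where j: "j \<in> {1..m}" "j \<notin> e" "j \<notin> w" by blast
  have c: "card ({1..m} - (insert j e \<union> w)) = q"
  proof -
    have "{1..m} - (insert j e \<union> w) = ({1..m} - (e \<union> w)) - {j}" by blast
    then show ?thesis using Suc.hyps(2) j by simp
  qed
  have c': "insert j e \<union> w = e \<union> insert j w" "insert j e \<union> insert j w = insert j e \<union> w" by blast+
  let ?e = "insert j e" and ?w = "insert j w"
  have sub: "?e \<subseteq> {1..m}" "?w \<subseteq> {1..m}" using Suc.prems j(1) by simp_all
  have IH: "FI_growth (FI_homology p (Y e' w')) (FI_homology_map p (Y e' w') FX) (2 * d * m)"
    if "e' \<subseteq> {1..m}" "w' \<subseteq> {1..m}" "e' \<union> w' = ?e \<union> w" for e' w' p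
    using Suc.hyps(1)[of e' w' p] that c by simp
  have YA: "subtopology (Y e w n) (S ?e w n) = Y ?e w n" "subtopology (Y e w n) (S e ?w n) = Y e ?w n"
    "subtopology (Y e w n) (S ?e w n \<inter> S e ?w n) = Y ?e ?w n" for n
    unfolding subtopology_subtopology Mode_Int[symmetric]
    by (rule arg_cong[of _ _ "subtopology (X n)"], use Mode_mono[where m = m and j = j] in blast)+
  show ?case
  proof (rule FI_growth_union[where A = "S ?e w" and B = "S e ?w"], unfold YA)
    show "FI_space (Y e w) FX" by (rule FI_space_subspace[OF FI_space_Conf FX_S[OF Suc.prems]])
    show "openin (Y e w n) (S ?e w n)" "openin (Y e w n) (S e ?w n)" for n
      unfolding openin_open_subtopology[OF openin_Mode[OF graph Suc.prems]]
      using openin_Mode[OF graph sub(1) Suc.prems(2)] openin_Mode[OF graph Suc.prems(1) sub(2)] Mode_mono[where m = m and j = j] by blast+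
    show "S ?e w n \<union> S e ?w n = topspace (Y e w n)" for n
      unfolding topspace_subtopology using Mode_cover[OF graph j(1), of _ n e w] Mode_mono[where m = m and j = j] by blast
    show "FX k n f \<in> S ?e w k \<rightarrow> S ?e w n" "FX k n f \<in> S e ?w k \<rightarrow> S e ?w n" if "f \<in> FI_hom k n" for k n f
      using FX_S[OF sub(1) Suc.prems(2) that] FX_S[OF Suc.prems(1) sub(2) that] .
  qed (rule IH; use Suc.prems sub in blast)+
qed

lemma FI_growth_Conf: "FI_growth (FI_homology p X) (FI_homology_map p X FX) (2 * d * m)"
  using FI_growth_Mode[of "{}" "{}" p] by simp

end

theorem theorem7:
  fixes G :: "nat \<Rightarrow> 'v graph"
    and F :: "nat \<Rightarrow> nat \<Rightarrow> (nat \<Rightarrow> nat) \<Rightarrow> 'v \<Rightarrow> 'v"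
    and d m :: nat
  assumes "FI_graph G F"
    and "vertex_stable G F d"
    and "injective_transitions G F"
    and "\<And>n. connected_graph (G n)"
    and "m \<ge> 1"
  shows "representation_stable
           (\<lambda>n. Conf m (realization (G n)))
           (\<lambda>k n f. Conf_map m (realization_map (G k) (F k n f)))
       \<and> (\<forall>i::nat. \<exists>P::real poly. degree P \<le> 2 * d * m \<and>
            (\<forall>\<^sub>F n in sequentially.
               vectorspace.fin_dim class_ring (real_homology i (Conf m (realization (G n)))) \<and>
               real (vectorspace.dim class_ring (real_homology i (Conf m (realization (G n)))))
                 = poly P (real n)))"
proof -
  interpret FI_graph G F by fact
  interpret stable_FI_graph G F d m using assms(2,3) by unfold_locales
  have "\<exists>P::real poly. degree P \<le> 2 * d * m \<and>
      (\<forall>\<^sub>F n in sequentially. vectorspace.fin_dim class_ring (real_homology i (X n)) \<and>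
         real (vectorspace.dim class_ring (real_homology i (X n))) = poly P (real n))" for i
  proof -
    have fg: "finitely_generated_FI_module (FI_homology (int i) X) (FI_homology_map (int i) X FX)"
      using FI_growth_Conf by (simp add: FI_growth_def)
    obtain C :: nat where C: "\<And>n. n \<ge> 1 \<Longrightarrow> rank_le (homology_group (int i) (X n)) (C * n ^ (2 * d * m))"
      using FI_growth_Conf[of "int i"] unfolding FI_growth_def by blast
    obtain r where r: "\<And>n. has_rank (homology_group (int i) (X n)) (r n)" "evpoly (\<lambda>n. real (r n))"
      using rank_evpoly[OF fg] by metis
    obtain P where P: "\<forall>\<^sub>F n in sequentially. real (r n) = poly P (real n)"
      using r(2) unfolding evpoly_def by blast
    \<comment> \<open>The exact rank is below every bound on independent families; as
      \<open>P\<close> eventually equals it, the growth rate limits the degree of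
      \<open>P\<close>.\<close>
    have bound: "real (r n) \<le> real C * real n ^ (2 * d * m)" if "n \<ge> 1" for n
    proof -
      have "r n \<le> C * n ^ (2 * d * m)" by (rule has_rank_le[OF _ r(1) C[OF that]]) simp
      then show ?thesis by (simp flip: of_nat_power of_nat_mult)
    qed
    have "\<forall>\<^sub>F n in sequentially. \<bar>poly P (real n)\<bar> \<le> real C * real n ^ (2 * d * m)"
      using P eventually_ge_at_top[of 1]
    proof eventually_elim
      case (elim n)
      show ?case using bound[OF elim(2)] by (simp flip: elim(1))
    qed
    then have "degree P \<le> 2 * d * m" by (rule degree_le_of_growth)
    moreover have "\<forall>\<^sub>F n in sequentially. vectorspace.fin_dim class_ring (real_homology i (X n)) \<and>
         real (vectorspace.dim class_ring (real_homology i (X n))) = poly P (real n)"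
      using P by eventually_elim (use real_homology_dim[OF r(1)] in simp)
    ultimately show ?thesis by blast
  qed
  then show ?thesis
    using FI_space_Conf FI_growth_Conf by (simp add: representation_stable_def FI_growth_def)
qed

end
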